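(* $\mathrm{AC}^0\mathrm{O}_{\mathrm{NLO}}\ne\mathrm{AC}^0\mathrm{AS}_{\mathrm{NLO}}$, $\mathrm{AC}^0\mathrm{AS}_{\mathrm{NLO}}\neq\mathrm{APXAC}^0_{\mathrm{NLO}}$, and $\mathrm{APXAC}^0_{\mathrm{NLO}}\ne\mathrm{NC}^1\mathrm{O}_{\mathrm{NLO}}$.
   Context: An optimization problem is $P=(I,SOL,m,goal)$ with instances $I$, finite solution sets $SOL(x)$, $goal\in\{\max,\min\}$, measure into $\mathbb N^{+}$, optimum $m^*(x)$, optimal set $SOL^*(x)$, ratio $R(x,y)=\max\{m(x,y)/m^*(x),m^*(x)/m(x,y)\}$. An auxiliary Turing machine is a deterministic Turing machine with read-only input tape, read-once auxiliary input tape, work tapes and write-only output tape. $P$ is an NLO problem if $I$ is in deterministic log space, solutions have polynomial length, and membership $y\in SOL(x)$ and $m(x,y)$ are computed by auxiliary Turing machines using $O(\log|x|)$ work space with $y$ on the auxiliary tape. $\mathrm{AC}^0$ circuit families: DLOGTIME-uniform, polynomial-size, constant-depth, unbounded fan-in AND/OR; $\mathrm{NC}^1$ circuit families: DLOGTIME-uniform, polynomial-size, $O(\log n)$-depth, bounded fan-in. $\mathrm{AC}^0\mathrm{O}_{\mathrm{NLO}}$ (resp. $\mathrm{NC}^1\mathrm{O}_{\mathrm{NLO}}$): NLO problems for which an $\mathrm{AC}^0$ (resp. $\mathrm{NC}^1$) circuit family outputs on every $x\in I$ an element of $SOL^*(x)$ if $SOL(x)\neq\emptyset$ and $\bot$ otherwise,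 with $m^*(x)$ computable in that model. $\mathrm{APXAC}^0_{\mathrm{NLO}}$: NLO problems for which, for some constant $\gamma>1$, an $\mathrm{AC}^0$ circuit family outputs on $x\in I$ some $y\in SOL(x)$ with $R(x,y)\le\gamma$ if $SOL(x)\neq\emptyset$ ($\bot$ otherwise), with $m(x,y)$ $\mathrm{AC}^0$-computable. $\mathrm{AC}^0\mathrm{AS}_{\mathrm{NLO}}$: NLO problems such that for every fixed rational $r>1$ there is an unbounded fan-in circuit family of polynomial size $p_r(n)$ and depth bounded by a constant depending on $r$ (uniform in logarithmic time), outputting on $x\in I$ some $y\in SOL(x)$ with $R(x,y)\le r$ if $SOL(x)\ne\emptyset$ ($\bot$ otherwise). *)

theory Defs
  imports
    Complex_Main
    "HOL-Library.Landau_Symbols"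
    "HOL-Computational_Algebra.Polynomial"
begin

section \<open>Growth rates and binary numerals\<close>

definition log_bounded :: "(nat \<Rightarrow> nat) \<Rightarrow> bool" where
  "log_bounded f \<longleftrightarrow> (\<lambda>n. real (f n)) \<in> O(\<lambda>n. ln (real n))"

definition poly_bounded :: "(nat \<Rightarrow> nat) \<Rightarrow> bool" where
  "poly_bounded f \<longleftrightarrow> (\<exists>p :: nat poly. \<forall>n. f n \<le> poly p n)"

text \<open>Binary representations have the most significant bit first. \<open>bin\<close> writes no leading
  zeros, \<open>bin_value\<close> ignores them.\<close>

fun bin :: "nat \<Rightarrow> bool list" where
  "bin n = (if n = 0 then [] else bin (n div 2) @ [odd n])"

declare bin.simps [simp del]

definition bin_value :: "bool list \<Rightarrow> nat" where
  "bin_value bs = horner_sum of_bool 2 (rev bs)"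

lemma bin_value_bin: "bin_value (bin n) = n"
proof (induction n rule: bin.induct)
  case (1 n)
  then show ?case
    by (subst bin.simps) (auto simp: bin_value_def)
qed


section \<open>Auxiliary Turing machines\<close>

text \<open>The input tape holds the input between two end markers. It is read-only and its head
  moves in both directions. The auxiliary tape holds a bit string; its head never moves left,
  and past the last bit it reads \<open>None\<close>. States and work tape symbols are natural numbers, and
  the blank is \<open>0\<close>. Work tapes are infinite to the right, and a left move from cell \<open>0\<close> has no
  effect. The write-only output tape is the list of the bits written so far.
  An ordinary Turing machine is one that is run on the empty auxiliary string.\<close>

datatype 'a tape_symbol = Left_End | Right_End | Symbol 'a

datatype move = Move_Left | Stay | Move_Right

record action =
  next_state :: nat
  input_move :: move
  aux_advance :: bool
  work_actions :: "(nat \<times> move) list"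
  emit :: "bool option"

record 'a aux_tm =
  states :: "nat set"
  symbols :: "nat set"
  work_tapes :: nat
  start :: nat
  accept :: nat
  reject :: nat
  delta :: "nat \<Rightarrow> 'a tape_symbol \<Rightarrow> bool option \<Rightarrow> nat list \<Rightarrow> action"

definition wf_tm :: "'a aux_tm \<Rightarrow> bool" where
  "wf_tm M \<longleftrightarrow>
     finite (states M) \<and> finite (symbols M) \<and> 0 \<in> symbols M \<and>
     start M \<in> states M \<and> accept M \<in> states M \<and> reject M \<in> states M \<and> accept M \<noteq> reject M \<and>
     (\<forall>q\<in>states M. \<forall>a b ws. length ws = work_tapes M \<and> set ws \<subseteq> symbols M \<longrightarrow>
        next_state (delta M q a b ws) \<in> states M \<and>
        length (work_actions (delta M q a b ws)) = work_tapes M \<and>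
        fst ` set (work_actions (delta M q a b ws)) \<subseteq> symbols M)"

text \<open>Each work tape is given by its head position and its contents.\<close>

record config =
  state :: nat
  input_pos :: nat
  aux_pos :: nat
  work :: "(nat \<times> (nat \<Rightarrow> nat)) list"
  written :: "bool list"

fun move_head :: "move \<Rightarrow> nat \<Rightarrow> nat" where
  "move_head Move_Left p = p - 1"
| "move_head Stay p = p"
| "move_head Move_Right p = p + 1"

definition input_symbol :: "'a list \<Rightarrow> nat \<Rightarrow> 'a tape_symbol" where
  "input_symbol x p =
     (if p = 0 then Left_End else if p \<le> length x then Symbol (x ! (p - 1)) else Right_End)"

definition aux_symbol :: "bool list \<Rightarrow> nat \<Rightarrow> bool option" where
  "aux_symbol y p = (if p < length y then Some (y ! p) else None)"

definition initial :: "'a aux_tm \<Rightarrow> config" where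
  "initial M = \<lparr>state = start M, input_pos = 0, aux_pos = 0,
     work = replicate (work_tapes M) (0, \<lambda>_. 0), written = []\<rparr>"

definition step :: "'a aux_tm \<Rightarrow> 'a list \<Rightarrow> bool list \<Rightarrow> config \<Rightarrow> config" where
  "step M x y c =
     (if state c = accept M \<or> state c = reject M then c
      else let d = delta M (state c) (input_symbol x (input_pos c)) (aux_symbol y (aux_pos c))
                     (map (\<lambda>(p, t). t p) (work c))
           in \<lparr>state = next_state d,
               input_pos = min (length x + 1) (move_head (input_move d) (input_pos c)),
               aux_pos = (if aux_advance d then aux_pos c + 1 else aux_pos c),
               work = map2 (\<lambda>(p, t) (s, mv). (move_head mv p, t(p := s))) (work c) (work_actions d),
               written = written c @ (case emit d of None \<Rightarrow> [] | Some b \<Rightarrow> [b])\<rparr>)"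

definition run :: "'a aux_tm \<Rightarrow> 'a list \<Rightarrow> bool list \<Rightarrow> nat \<Rightarrow> config" where
  "run M x y t = (step M x y ^^ t) (initial M)"

text \<open>Accepting and rejecting configurations are never left, so being in a halting state after
  exactly \<open>t\<close> steps means having halted within \<open>t\<close> steps.\<close>

definition decides_in_time :: "'a aux_tm \<Rightarrow> 'a list \<Rightarrow> bool list \<Rightarrow> bool \<Rightarrow> nat \<Rightarrow> bool" where
  "decides_in_time M x y b t \<longleftrightarrow> state (run M x y t) = (if b then accept M else reject M)"

definition decides :: "'a aux_tm \<Rightarrow> 'a list \<Rightarrow> bool list \<Rightarrow> bool \<Rightarrow> bool" where
  "decides M x y b \<longleftrightarrow> (\<exists>t. decides_in_time M x y b t)"

definition writes :: "'a aux_tm \<Rightarrow> 'a list \<Rightarrow> bool list \<Rightarrow> bool list \<Rightarrow> bool" where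
  "writes M x y w \<longleftrightarrow> (\<exists>t. state (run M x y t) = accept M \<and> written (run M x y t) = w)"

definition work_space :: "'a aux_tm \<Rightarrow> 'a list \<Rightarrow> bool list \<Rightarrow> nat \<Rightarrow> bool" where
  "work_space M x y s \<longleftrightarrow> (\<forall>t. \<forall>(p, _) \<in> set (work (run M x y t)). p < s)"

definition logspace :: "bool list set \<Rightarrow> bool" where
  "logspace A \<longleftrightarrow> (\<exists>M s. wf_tm M \<and> log_bounded s \<and>
     (\<forall>x. decides M x [] (x \<in> A) \<and> work_space M x [] (s (length x))))"


section \<open>Optimization problems\<close>

datatype objective = Maximize | Minimize

record problem =
  instances :: "bool list set"
  SOL :: "bool list \<Rightarrow> bool list set"
  measr :: "bool list \<Rightarrow> bool list \<Rightarrow> nat"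
  goal :: objective

definition optimization_problem :: "problem \<Rightarrow> bool" where
  "optimization_problem P \<longleftrightarrow>
     (\<forall>x\<in>instances P. finite (SOL P x) \<and> (\<forall>y\<in>SOL P x. measr P x y > 0))"

text \<open>The optimum is only used for instances with a solution.\<close>

definition optimum :: "problem \<Rightarrow> bool list \<Rightarrow> nat" where
  "optimum P x = (case goal P of
      Maximize \<Rightarrow> Max (measr P x ` SOL P x)
    | Minimize \<Rightarrow> Min (measr P x ` SOL P x))"

definition optimal_solutions :: "problem \<Rightarrow> bool list \<Rightarrow> bool list set" where
  "optimal_solutions P x = {y \<in> SOL P x. measr P x y = optimum P x}"

definition ratio :: "problem \<Rightarrow> bool list \<Rightarrow> bool list \<Rightarrow> real" where
  "ratio P x y = max (real (measr P x y) / real (optimum P x))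
                     (real (optimum P x) / real (measr P x y))"

definition NLO :: "problem set" where
  "NLO = {P. optimization_problem P \<and> logspace (instances P) \<and>
     (\<exists>p :: nat poly. \<forall>x\<in>instances P. \<forall>y\<in>SOL P x. length y \<le> poly p (length x)) \<and>
     (\<exists>M s. wf_tm M \<and> log_bounded s \<and> (\<forall>x\<in>instances P. \<forall>y.
        decides M x y (y \<in> SOL P x) \<and> work_space M x y (s (length x)))) \<and>
     (\<exists>M s. wf_tm M \<and> log_bounded s \<and> (\<forall>x\<in>instances P. \<forall>y\<in>SOL P x.
        writes M x y (bin (measr P x y)) \<and> work_space M x y (s (length x))))}"


section \<open>Circuits\<close>

datatype gate = Input nat | Neg | Conj | Disj

text \<open>The gates are the numbers below \<open>gates\<close>. A pair \<open>(g, h)\<close> in \<open>wires\<close> says that the value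
  of \<open>h\<close> is fed into \<open>g\<close>. An output gate may occur several times in the list \<open>outs\<close>.\<close>

record circuit =
  gates :: nat
  kind :: "nat \<Rightarrow> gate"
  wires :: "(nat \<times> nat) set"
  outs :: "nat list"

definition children :: "circuit \<Rightarrow> nat \<Rightarrow> nat set" where
  "children C g = {h. (g, h) \<in> wires C}"

definition wf_circuit :: "nat \<Rightarrow> circuit \<Rightarrow> bool" where
  "wf_circuit n C \<longleftrightarrow>
     wires C \<subseteq> {..<gates C} \<times> {..<gates C} \<and> acyclic (wires C) \<and> set (outs C) \<subseteq> {..<gates C} \<and>
     (\<forall>g<gates C. case kind C g of
         Input i \<Rightarrow> i < n \<and> children C g = {}
       | Neg \<Rightarrow> card (children C g) = 1
       | _ \<Rightarrow> True)"

text \<open>Conjunction and disjunction gates without children are the constants.\<close>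

definition gate_values :: "circuit \<Rightarrow> bool list \<Rightarrow> (nat \<Rightarrow> bool) \<Rightarrow> bool" where
  "gate_values C x v \<longleftrightarrow> (\<forall>g<gates C. v g = (case kind C g of
      Input i \<Rightarrow> x ! i
    | Neg \<Rightarrow> \<forall>h\<in>children C g. \<not> v h
    | Conj \<Rightarrow> \<forall>h\<in>children C g. v h
    | Disj \<Rightarrow> \<exists>h\<in>children C g. v h))"

definition circuit_output :: "circuit \<Rightarrow> bool list \<Rightarrow> bool list \<Rightarrow> bool" where
  "circuit_output C x w \<longleftrightarrow> (\<exists>v. gate_values C x v \<and> w = map v (outs C))"

lemma wf_circuit_wf_wires:
  assumes "wf_circuit n C"
  shows "wf ((wires C)\<inverse>)"
proof (rule finite_acyclic_wf_converse)
  show "finite (wires C)"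
    using assms finite_subset unfolding wf_circuit_def by blast
  show "acyclic (wires C)"
    using assms unfolding wf_circuit_def by blast
qed

lemma gate_values_unique:
  assumes wf: "wf_circuit n C" and v: "gate_values C x v" and v': "gate_values C x v'"
  shows "g < gates C \<Longrightarrow> v g = v' g"
proof (induction g rule: wf_induct_rule[OF wf_circuit_wf_wires[OF wf]])
  case (1 g)
  have "v h = v' h" if "h \<in> children C g" for h
    using 1(1)[of h] that wf unfolding wf_circuit_def children_def by auto
  moreover have "v g = (case kind C g of Input i \<Rightarrow> x ! i | Neg \<Rightarrow> \<forall>h\<in>children C g. \<not> v h
      | Conj \<Rightarrow> \<forall>h\<in>children C g. v h | Disj \<Rightarrow> \<exists>h\<in>children C g. v h)"
    "v' g = (case kind C g of Input i \<Rightarrow> x ! i | Neg \<Rightarrow> \<forall>h\<in>children C g. \<not> v' h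
      | Conj \<Rightarrow> \<forall>h\<in>children C g. v' h | Disj \<Rightarrow> \<exists>h\<in>children C g. v' h)"
    using v v' 1(2) unfolding gate_values_def by blast+
  ultimately show ?case
    by (auto split: gate.splits)
qed

lemma circuit_output_ex1:
  assumes wf: "wf_circuit n C"
  shows "\<exists>!w. circuit_output C x w"
proof (rule ex_ex1I)
  define F where "F v g = (case kind C g of Input i \<Rightarrow> x ! i | Neg \<Rightarrow> \<forall>h\<in>children C g. \<not> v h
      | Conj \<Rightarrow> \<forall>h\<in>children C g. v h | Disj \<Rightarrow> \<exists>h\<in>children C g. v h)" for v g
  let ?v = "wfrec ((wires C)\<inverse>) F"
  have "?v g = F ?v g" for g
  proof -
    have "?v g = F (cut ?v ((wires C)\<inverse>) g) g"
      by (rule wfrec[OF wf_circuit_wf_wires[OF wf]])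
    also have "\<dots> = F ?v g"
      unfolding F_def children_def by (auto simp: cut_apply split: gate.split)
    finally show ?thesis .
  qed
  then have "gate_values C x ?v"
    unfolding gate_values_def F_def by blast
  then show "\<exists>w. circuit_output C x w"
    unfolding circuit_output_def by blast
next
  fix w w' assume "circuit_output C x w" "circuit_output C x w'"
  then obtain v v' where v: "gate_values C x v" "w = map v (outs C)"
    and v': "gate_values C x v'" "w' = map v' (outs C)"
    unfolding circuit_output_def by blast
  have "set (outs C) \<subseteq> {..<gates C}"
    using wf unfolding wf_circuit_def by blast
  then show "w = w'"
    using v v' gate_values_unique[OF wf v(1) v'(1)] by (auto intro!: map_cong)
qed

definition circuit_size :: "circuit \<Rightarrow> nat" where
  "circuit_size C = gates C + length (outs C)"

text \<open>The length of a longest path; negations are counted, too.\<close>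

definition depth :: "circuit \<Rightarrow> nat" where
  "depth C = Max {k. wires C ^^ k \<noteq> {}}"


subsection \<open>Uniform families\<close>

text \<open>The direct connection language. The first component is the index of the circuit in the
  family and the second one tells which question is asked about it.\<close>

definition direct_connections :: "(nat \<Rightarrow> circuit) \<Rightarrow> nat list set" where
  "direct_connections C =
     {[n, 0, g] | n g. g < gates (C n) \<and> kind (C n) g = Neg} \<union>
     {[n, 1, g] | n g. g < gates (C n) \<and> kind (C n) g = Conj} \<union>
     {[n, 2, g] | n g. g < gates (C n) \<and> kind (C n) g = Disj} \<union>
     {[n, 3, g, i] | n g i. g < gates (C n) \<and> kind (C n) g = Input i} \<union>
     {[n, 4, g, h] | n g h. (g, h) \<in> wires (C n)} \<union>
     {[n, 5, j, g] | n j g. j < length (outs (C n)) \<and> outs (C n) ! j = g}"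

text \<open>Numbers in binary, each one terminated by the separator \<open>None\<close>.\<close>

definition encode_nats :: "nat list \<Rightarrow> bool option list" where
  "encode_nats ns = concat (map (\<lambda>k. map Some (bin k) @ [None]) ns)"

text \<open>The time bound is logarithmic in the number of inputs \<open>n\<close> of the circuit, not in the
  length of the query, in which \<open>n\<close> is written in binary.\<close>

definition dlogtime_uniform :: "(nat \<Rightarrow> circuit) \<Rightarrow> bool" where
  "dlogtime_uniform C \<longleftrightarrow> (\<exists>M T. wf_tm M \<and> log_bounded T \<and> (\<forall>n q.
     decides_in_time M (encode_nats (n # q)) [] (n # q \<in> direct_connections C) (T n)))"

definition uniform_poly_size :: "(nat \<Rightarrow> circuit) \<Rightarrow> bool" where
  "uniform_poly_size C \<longleftrightarrow>
     (\<forall>n. wf_circuit n (C n)) \<and> poly_bounded (\<lambda>n. circuit_size (C n)) \<and> dlogtime_uniform C"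

definition AC0 :: "(nat \<Rightarrow> circuit) set" where
  "AC0 = {C. uniform_poly_size C \<and> (\<exists>d. \<forall>n. depth (C n) \<le> d)}"

definition NC1 :: "(nat \<Rightarrow> circuit) set" where
  "NC1 = {C. uniform_poly_size C \<and> log_bounded (\<lambda>n. depth (C n)) \<and>
     (\<forall>n. \<forall>g<gates (C n). card (children (C n) g) \<le> 2)}"

text \<open>A circuit has a fixed number of outputs. It outputs a string of any length, or \<open>\<bottom>\<close>
  (here \<open>None\<close>), symbol by symbol with two bits each: \<open>10\<close> and \<open>11\<close> are the bits,
  \<open>01\<close> is \<open>\<bottom>\<close>, and \<open>00\<close> is a blank that pads the output.\<close>

fun output_code :: "bool list option \<Rightarrow> bool list" where
  "output_code (Some y) = concat (map (\<lambda>b. [True, b]) y)"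
| "output_code None = [False, True]"

definition outputs_string :: "(nat \<Rightarrow> circuit) \<Rightarrow> bool list \<Rightarrow> bool list option \<Rightarrow> bool" where
  "outputs_string C x z \<longleftrightarrow>
     (\<exists>k. circuit_output (C (length x)) x (output_code z @ replicate (2 * k) False))"

definition outputs_number :: "(nat \<Rightarrow> circuit) \<Rightarrow> bool list \<Rightarrow> nat \<Rightarrow> bool" where
  "outputs_number C x k \<longleftrightarrow> (\<exists>w. circuit_output (C (length x)) x w \<and> bin_value w = k)"


section \<open>Classes of optimization problems\<close>

definition exactly_solvable :: "(nat \<Rightarrow> circuit) set \<Rightarrow> problem \<Rightarrow> bool" where
  "exactly_solvable \<C> P \<longleftrightarrow>
     (\<exists>C\<in>\<C>. \<forall>x\<in>instances P.
        if SOL P x = {} then outputs_string C x None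
        else \<exists>y\<in>optimal_solutions P x. outputs_string C x (Some y)) \<and>
     (\<exists>D\<in>\<C>. \<forall>x\<in>instances P. SOL P x \<noteq> {} \<longrightarrow> outputs_number D x (optimum P x))"

definition approximates :: "(nat \<Rightarrow> circuit) \<Rightarrow> problem \<Rightarrow> real \<Rightarrow> bool" where
  "approximates C P r \<longleftrightarrow> (\<forall>x\<in>instances P.
     if SOL P x = {} then outputs_string C x None
     else \<exists>y\<in>SOL P x. outputs_string C x (Some y) \<and> ratio P x y \<le> r)"

definition AC0O_NLO :: "problem set" where
  "AC0O_NLO = {P \<in> NLO. exactly_solvable AC0 P}"

definition NC1O_NLO :: "problem set" where
  "NC1O_NLO = {P \<in> NLO. exactly_solvable NC1 P}"

text \<open>Here the family \<open>D\<close> computes the measure of the solution that \<open>C\<close> outputs.\<close>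

definition APXAC0_NLO :: "problem set" where
  "APXAC0_NLO = {P \<in> NLO. \<exists>\<gamma>::real. \<gamma> > 1 \<and> (\<exists>C\<in>AC0. approximates C P \<gamma> \<and>
     (\<exists>D\<in>AC0. \<forall>x\<in>instances P. \<forall>y\<in>SOL P x.
        outputs_string C x (Some y) \<longrightarrow> outputs_number D x (measr P x y)))}"

definition AC0AS_NLO :: "problem set" where
  "AC0AS_NLO = {P \<in> NLO. \<forall>r::rat. r > 1 \<longrightarrow> (\<exists>C\<in>AC0. approximates C P (of_rat r))}"

end

theory Submission
  imports
    Defs
    "HOL-Library.Countable"
    "HOL-Library.FuncSet"
    "HOL-Library.Numeral_Type"
    "HOL-Real_Asymp.Real_Asymp"
begin

text \<open>One problem separates all the pairs. Every instance \<open>x\<close> has the empty string as its only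
  solution, whose measure is \<open>1\<close> plus the parity of \<open>x\<close>. Every solution is then optimal, and the
  definition of \<open>AC0AS_NLO\<close> does not ask for the measure to be computed, so that a circuit without
  gates is an approximation scheme. The other two \<open>AC0\<close> classes do ask for the measure, that is,
  for parity. Parity is outside \<open>AC0\<close> by the argument of Razborov and Smolensky: a circuit of
  small depth agrees on most inputs with a polynomial of low degree over the field with three
  elements; in variables with values \<open>1\<close> and \<open>- 1\<close>, parity is the product of all variables, and
  agreeing with it on a large set \<open>A\<close> would make all functions on \<open>A\<close> polynomials of degree little
  more than \<open>n / 2\<close>, of which there are too few. Parity is in \<open>NC1\<close> by a balanced tree in which
  each node computes the parity of its leaves and its negation.\<close>

text \<open>The field with three elements is the smallest one in which 1 and -1 differ, and in it
  every nonzero square is 1. Hence \<open>l\<close> subset sums, each squared, replace a disjunction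
  by a polynomial at the price of a factor \<open>2 * l\<close> in the degree. With \<open>l\<close>
  logarithmic in the size, the degree stays polylogarithmic. This is far below the square root of
  the input length, which is about the number of middle layers of the cube that the counting can
  afford. On the side of \<open>NC1\<close> the obstacle is uniformity. The machine has O(log n)
  steps, but a query may be arbitrarily long, and there is no random access to it. The tree is
  therefore padded to a power of two and numbered like a heap: the type of a gate is read off the
  high bits of its number and the tree node off the low ones, going to a child is a shift by one
  bit, and every question becomes a test by a finite automaton that reads \<open>n\<close> and the
  other numbers of the query in parallel. Eight types take three bits, so a number with more than
  three bits beyond those of \<open>n\<close> can be rejected at once.\<close>

definition parity :: "bool list \<Rightarrow> bool" where
  "parity x \<longleftrightarrow> odd (length (filter (\<lambda>b. b) x))"

lemma parity_card: "parity x \<longleftrightarrow> odd (card {i. i < length x \<and> x ! i})"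
  by (simp add: parity_def length_filter_conv_card)

lemma bin_0 [simp]: "bin 0 = []"
  by (subst bin.simps) simp

lemma bin_pos: "0 < n \<Longrightarrow> bin n = bin (n div 2) @ [odd n]"
  by (subst bin.simps) simp

section \<open>Parity is not in \<open>AC0\<close>\<close>

lemma mod3_cases: "(c::3) = 0 \<or> c = 1 \<or> c = - 1"
proof -
  have "card {0, 1, - 1 :: 3} = card (UNIV :: 3 set)" by simp
  then have "{0, 1, - 1 :: 3} = UNIV"
    by (metis card_subset_eq finite_class.finite_UNIV subset_UNIV)
  then show ?thesis by blast
qed

lemma mod3_square: "(c::3)\<^sup>2 = of_bool (c \<noteq> 0)"
  using mod3_cases[of c] by auto

text \<open>Averaging over all \<open>S\<close>: for a fixed \<open>x\<close> with
  \<open>u h x\<close>, toggling the membership of \<open>h\<close> in \<open>S\<close> changes the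
  sum by 1 or -1, so it maps the \<open>S\<close> with sum 0 injectively to others. At most half of
  all \<open>S\<close> therefore vanish at \<open>x\<close>, and some \<open>S\<close> is at least
  as good as the average.\<close>

lemma halving_subset:
  fixes u :: "'a \<Rightarrow> 'b \<Rightarrow> bool"
  assumes H: "finite H" and B: "finite B" and nz: "\<And>x. x \<in> B \<Longrightarrow> \<exists>h\<in>H. u h x"
  shows "\<exists>S\<subseteq>H. 2 * card {x \<in> B. (\<Sum>h\<in>S. of_bool (u h x) :: 3) = 0} \<le> card B"
proof (rule ccontr)
  define Z where "Z S x \<longleftrightarrow> (\<Sum>h\<in>S. of_bool (u h x) :: 3) = 0" for S x
  assume "\<not> ?thesis"
  then have gt: "card B < 2 * card {x \<in> B. Z S x}" if "S \<in> Pow H" for S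
    using that unfolding Z_def by (auto simp: not_le)
  have half: "2 * card {S \<in> Pow H. Z S x} \<le> card (Pow H)" if x: "x \<in> B" for x
  proof -
    obtain h where h: "h \<in> H" "u h x" using nz[OF x] by blast
    define t where "t S = (if h \<in> S then S - {h} else insert h S)" for S
    have inj: "inj_on t (Pow H)"
      unfolding t_def inj_on_def by (auto split: if_splits)
    have flip: "\<not> Z (t S) x" if S: "S \<in> {S \<in> Pow H. Z S x}" for S
    proof -
      have fin: "finite S" using S H finite_subset by auto
      show ?thesis
        using S fin h
        by (auto simp: t_def Z_def sum_diff1 simp del: sum_of_bool_eq split: if_splits)
    qed
    have "t ` {S \<in> Pow H. Z S x} \<subseteq> {S \<in> Pow H. \<not> Z S x}"
    proof (intro image_subsetI CollectI conjI)
      fix S assume S: "S \<in> {S \<in> Pow H. Z S x}"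
      show "t S \<in> Pow H" using S h(1) unfolding t_def by auto
      show "\<not> Z (t S) x" by (rule flip[OF S])
    qed
    then have "card {S \<in> Pow H. Z S x} \<le> card {S \<in> Pow H. \<not> Z S x}"
      by (intro card_inj_on_le[of t]) (auto intro: inj_on_subset[OF inj] simp: H)
    moreover have "card {S \<in> Pow H. Z S x} + card {S \<in> Pow H. \<not> Z S x} = card (Pow H)"
      by (subst card_Un_disjoint[symmetric]) (auto simp: H intro!: arg_cong[where f = card])
    ultimately show ?thesis by linarith
  qed
  have "card (Pow H) * card B = (\<Sum>S\<in>Pow H. card B)" by simp
  also have "\<dots> < (\<Sum>S\<in>Pow H. 2 * card {x \<in> B. Z S x})"
    using gt H by (intro sum_strict_mono) auto
  also have "\<dots> = 2 * (\<Sum>S\<in>Pow H. \<Sum>x\<in>B. of_bool (Z S x))"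
    by (simp add: sum_distrib_left B Int_def)
  also have "\<dots> = 2 * (\<Sum>x\<in>B. \<Sum>S\<in>Pow H. of_bool (Z S x))"
    by (subst sum.swap) simp
  also have "\<dots> = (\<Sum>x\<in>B. 2 * card {S \<in> Pow H. Z S x})"
    using H by (simp add: sum_distrib_left Int_def)
  also have "\<dots> \<le> (\<Sum>x\<in>B. card (Pow H))"
    using half by (intro sum_mono) auto
  also have "\<dots> = card (Pow H) * card B" by simp
  finally show False by simp
qed

text \<open>Each round applies the halving to the points on which all earlier sums vanish.\<close>

lemma iterated_halving:
  fixes u :: "'a \<Rightarrow> 'b \<Rightarrow> bool"
  assumes H: "finite H" and B: "finite B" and nz: "\<And>x. x \<in> B \<Longrightarrow> \<exists>h\<in>H. u h x"
  shows "\<exists>S. (\<forall>j<l. S j \<subseteq> H) \<and>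
    2 ^ l * card {x \<in> B. \<forall>j<l. (\<Sum>h\<in>S j. of_bool (u h x) :: 3) = 0} \<le> card B"
proof (induction l)
  case 0
  then show ?case by auto
next
  case (Suc l)
  then obtain S where S: "\<forall>j<l. S j \<subseteq> H"
    "2 ^ l * card {x \<in> B. \<forall>j<l. (\<Sum>h\<in>S j. of_bool (u h x) :: 3) = 0} \<le> card B" by blast
  define B' where "B' = {x \<in> B. \<forall>j<l. (\<Sum>h\<in>S j. of_bool (u h x) :: 3) = 0}"
  obtain S' where S': "S' \<subseteq> H" "2 * card {x \<in> B'. (\<Sum>h\<in>S'. of_bool (u h x) :: 3) = 0} \<le> card B'"
    using halving_subset[OF H, of B' u] nz B unfolding B'_def by auto
  have eq: "{x \<in> B. \<forall>j<Suc l. (\<Sum>h\<in>(S(l := S')) j. of_bool (u h x) :: 3) = 0} =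
    {x \<in> B'. (\<Sum>h\<in>S'. of_bool (u h x) :: 3) = 0}"
    unfolding B'_def by (auto simp: less_Suc_eq)
  have "2 ^ Suc l * card {x \<in> B'. (\<Sum>h\<in>S'. of_bool (u h x) :: 3) = 0} \<le> 2 ^ l * card B'"
    using S'(2) by simp
  also have "\<dots> \<le> card B" using S(2) unfolding B'_def .
  finally show ?case
    using S(1) S'(1) eq by (intro exI[of _ "S(l := S')"]) (auto simp: less_Suc_eq)
qed

section \<open>Multilinear polynomials on the cube\<close>

definition cube :: "nat \<Rightarrow> bool list set" where
  "cube n = {x. length x = n}"

lemma finite_cube [simp]: "finite (cube n)"
  using finite_lists_length_eq[of "UNIV :: bool set" n] by (simp add: cube_def)

lemma card_cube [simp]: "card (cube n) = 2 ^ n"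
  using card_lists_length_eq[of "UNIV :: bool set" n] by (simp add: cube_def)

definition spin :: "bool list \<Rightarrow> nat \<Rightarrow> 3" where
  "spin x i = (if x ! i then - 1 else 1)"

text \<open>The Walsh character of \<open>T\<close>. Since spins square to 1, multilinear monomials
  suffice for all polynomials.\<close>

definition monomial :: "nat set \<Rightarrow> bool list \<Rightarrow> 3" where
  "monomial T x = (\<Prod>i\<in>T. spin x i)"

definition supports :: "nat \<Rightarrow> nat \<Rightarrow> nat set set" where
  "supports n d = {T. T \<subseteq> {..<n} \<and> card T \<le> d}"

definition low_degree :: "nat \<Rightarrow> nat \<Rightarrow> (bool list \<Rightarrow> 3) \<Rightarrow> bool" where
  "low_degree n d f \<longleftrightarrow>
     (\<exists>c. \<forall>x\<in>cube n. f x = (\<Sum>T\<in>supports n d. c T * monomial T x))"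

lemma spin_square [simp]: "spin x i * spin x i = 1"
  by (simp add: spin_def)

lemma finite_supports [simp]: "finite (supports n d)"
  unfolding supports_def by (rule finite_subset[of _ "Pow {..<n}"]) auto

text \<open>The common spins occur twice and cancel.\<close>

lemma monomial_mult:
  assumes "finite S" "finite T"
  shows "monomial S x * monomial T x = monomial (sym_diff S T) x"
proof -
  have "monomial S x = monomial (S - T) x * monomial (S \<inter> T) x"
    unfolding monomial_def using assms
    by (subst prod.union_disjoint[symmetric]) (auto intro!: prod.cong)
  moreover have "monomial T x = monomial (T - S) x * monomial (S \<inter> T) x"
    unfolding monomial_def using assms
    by (subst prod.union_disjoint[symmetric]) (auto intro!: prod.cong)
  moreover have "monomial (S \<inter> T) x * monomial (S \<inter> T) x = 1"
    unfolding monomial_def by (simp flip: prod.distrib)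
  moreover have "monomial (S - T) x * monomial (T - S) x = monomial (sym_diff S T) x"
    unfolding monomial_def using assms by (subst prod.union_disjoint) auto
  ultimately show ?thesis by (metis (no_types, lifting) mult.assoc mult.commute mult.left_neutral)
qed

lemma low_degree_cong:
  assumes "\<And>x. x \<in> cube n \<Longrightarrow> f x = g x"
  shows "low_degree n d f \<longleftrightarrow> low_degree n d g"
  using assms unfolding low_degree_def by auto

lemma low_degree_mono:
  assumes "low_degree n d f" "d \<le> e"
  shows "low_degree n e f"
proof -
  obtain c where c: "\<forall>x\<in>cube n. f x = (\<Sum>T\<in>supports n d. c T * monomial T x)"
    using assms(1) unfolding low_degree_def by blast
  have sub: "supports n d \<subseteq> supports n e" using assms(2) unfolding supports_def by auto
  have "f x = (\<Sum>T\<in>supports n e. (if T \<in> supports n d then c T else 0) * monomial T x)"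
    if "x \<in> cube n" for x
    using c that sub
    by (auto intro!: sum.mono_neutral_cong_left)
  then show ?thesis
    unfolding low_degree_def by (intro exI[of _ "\<lambda>T. if T \<in> supports n d then c T else 0"]) blast
qed

lemma low_degree_monomial:
  assumes "T \<in> supports n d"
  shows "low_degree n d (monomial T)"
  unfolding low_degree_def
proof (intro exI ballI)
  fix x
  show "monomial T x = (\<Sum>S\<in>supports n d. of_bool (S = T) * monomial S x)"
    using assms by (subst sum.remove[of _ T]) (auto intro!: sum.neutral)
qed

lemma low_degree_const: "low_degree n d (\<lambda>_. c)"
  unfolding low_degree_def
proof (intro exI ballI)
  fix x
  show "c = (\<Sum>S\<in>supports n d. (of_bool (S = {}) * c) * monomial S x)"
    by (subst sum.remove[of _ "{}"]) (auto simp: supports_def monomial_def intro!: sum.neutral)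
qed

lemma low_degree_add:
  assumes "low_degree n d f" "low_degree n d g"
  shows "low_degree n d (\<lambda>x. f x + g x)"
proof -
  obtain a b where "\<forall>x\<in>cube n. f x = (\<Sum>T\<in>supports n d. a T * monomial T x)"
    "\<forall>x\<in>cube n. g x = (\<Sum>T\<in>supports n d. b T * monomial T x)"
    using assms unfolding low_degree_def by blast
  then show ?thesis
    unfolding low_degree_def
    by (intro exI[of _ "\<lambda>T. a T + b T"]) (auto simp: sum.distrib ring_distribs)
qed

lemma low_degree_scale:
  assumes "low_degree n d f"
  shows "low_degree n d (\<lambda>x. c * f x)"
proof -
  obtain a where "\<forall>x\<in>cube n. f x = (\<Sum>T\<in>supports n d. a T * monomial T x)"
    using assms unfolding low_degree_def by blast
  then show ?thesis
    unfolding low_degree_def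
    by (intro exI[of _ "\<lambda>T. c * a T"]) (auto simp: sum_distrib_left mult.assoc)
qed

lemma low_degree_sum:
  assumes "\<And>i. i \<in> I \<Longrightarrow> low_degree n d (f i)"
  shows "low_degree n d (\<lambda>x. \<Sum>i\<in>I. f i x)"
  using assms
  by (induction I rule: infinite_finite_induct) (auto simp: low_degree_const low_degree_add)

lemma low_degree_mult:
  assumes "low_degree n d f" "low_degree n e g"
  shows "low_degree n (d + e) (\<lambda>x. f x * g x)"
proof -
  obtain a b where a: "\<forall>x\<in>cube n. f x = (\<Sum>S\<in>supports n d. a S * monomial S x)"
    and b: "\<forall>x\<in>cube n. g x = (\<Sum>T\<in>supports n e. b T * monomial T x)"
    using assms unfolding low_degree_def by blast
  have "low_degree n (d + e) (\<lambda>x. monomial S x * monomial T x)"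
    if "S \<in> supports n d" "T \<in> supports n e" for S T
  proof -
    have fin: "finite S" "finite T"
      using that finite_subset unfolding supports_def by auto
    have "card (sym_diff S T) \<le> card (S \<union> T)"
      using fin by (intro card_mono) auto
    also have "\<dots> \<le> d + e"
      using card_Un_le[of S T] that unfolding supports_def by auto
    finally have "sym_diff S T \<in> supports n (d + e)"
      using that unfolding supports_def by auto
    then show ?thesis
      using low_degree_monomial fin by (simp add: monomial_mult)
  qed
  then have "low_degree n (d + e)
      (\<lambda>x. \<Sum>S\<in>supports n d. \<Sum>T\<in>supports n e. (a S * b T) * (monomial S x * monomial T x))"
    by (intro low_degree_sum low_degree_scale)
  then show ?thesis
    by (rule iffD1[OF low_degree_cong, rotated])
      (simp add: a b sum_product algebra_simps)
qed

lemma low_degree_prod: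
  assumes "\<And>i. i \<in> I \<Longrightarrow> low_degree n d (f i)" "finite I"
  shows "low_degree n (card I * d) (\<lambda>x. \<Prod>i\<in>I. f i x)"
  using assms(2,1)
  by (induction I rule: finite_induct)
    (auto simp: low_degree_const intro!: low_degree_mult)

lemma low_degree_diff:
  assumes "low_degree n d f" "low_degree n d g"
  shows "low_degree n d (\<lambda>x. f x - g x)"
  using low_degree_add[OF assms(1) low_degree_scale[OF assms(2), of "-1"]] by simp

lemma low_degree_input:
  assumes "i < n"
  shows "low_degree n 1 (\<lambda>x. of_bool (x ! i))"
proof -
  \<comment> \<open>Over this field \<open>spin x i - 1\<close> is the bit itself: for a true bit it
    is -2 = 1.\<close>
  have "low_degree n 1 (\<lambda>x. monomial {i} x - 1)"
    using assms by (intro low_degree_diff low_degree_monomial low_degree_const)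
      (auto simp: supports_def)
  then show ?thesis
    by (rule iffD1[OF low_degree_cong, rotated])
      (auto simp: monomial_def spin_def)
qed

text \<open>Interpolation: a sum over the points \<open>a\<close> of \<open>f a\<close> times the
  indicator of \<open>a\<close>, which is a product of \<open>n\<close> factors of degree 1.\<close>

lemma low_degree_all: "low_degree n n f"
proof -
  define e :: "bool list \<Rightarrow> nat \<Rightarrow> bool list \<Rightarrow> 3"
    where "e a i x = of_bool (x ! i = a ! i)" for a i x
  have "low_degree n 1 (e a i)" if "i < n" for a i
  proof (cases "a ! i")
    case True
    then show ?thesis using low_degree_input[OF that] by (simp add: e_def[abs_def])
  next
    case False
    then show ?thesis
      using low_degree_diff[OF low_degree_const low_degree_input[OF that], of 1]
      by (simp add: e_def[abs_def] of_bool_not_iff)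
  qed
  then have "low_degree n (card {..<n} * 1) (\<lambda>x. \<Prod>i<n. e a i x)" for a
    by (intro low_degree_prod) auto
  then have "low_degree n n (\<lambda>x. \<Sum>a\<in>cube n. f a * (\<Prod>i<n. e a i x))"
    by (intro low_degree_sum low_degree_scale) auto
  then show ?thesis
  proof (rule iffD1[OF low_degree_cong, rotated])
    fix x :: "bool list" assume x: "x \<in> cube n"
    have "(\<Prod>i<n. e a i x) = of_bool (a = x)" if a: "a \<in> cube n" for a
    proof (cases "a = x")
      case True
      then show ?thesis by (simp add: e_def)
    next
      case False
      then obtain i where "i < n" "x ! i \<noteq> a ! i"
        using x a unfolding cube_def by (auto simp: list_eq_iff_nth_eq)
      then show ?thesis using False by (auto simp: e_def intro!: prod_zero bexI[of _ i])
    qed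
    then show "(\<Sum>a\<in>cube n. f a * (\<Prod>i<n. e a i x)) = f x"
      using x by (simp add: of_bool_def if_distrib[of "\<lambda>t. f _ * t"] cong: if_cong)
  qed
qed

text \<open>Smolensky's counting. On \<open>A\<close>, a monomial with more than half of the
  variables is the complementary monomial times \<open>p\<close>, hence of degree at most
  \<open>n div 2 + d\<close>. So every function on \<open>A\<close> arises from coefficients on
  \<open>supports n (n div 2 + d)\<close>, and there are \<open>3 ^ card A\<close> such
  functions.\<close>

lemma card_agreement_le:
  assumes A: "A \<subseteq> cube n" and p: "low_degree n d p"
    and agree: "\<And>x. x \<in> A \<Longrightarrow> p x = monomial {..<n} x"
  shows "card A \<le> card (supports n (n div 2 + d))"
proof -
  define e where "e = n div 2 + d"
  define ev where "ev c x = (\<Sum>T\<in>supports n e. c T * monomial T x)" for c :: "nat set \<Rightarrow> 3" and x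
  have mono_low: "\<exists>g. low_degree n e g \<and> (\<forall>x\<in>A. monomial T x = g x)" if T: "T \<subseteq> {..<n}" for T
  proof (cases "card T \<le> n div 2")
    case True
    then have "T \<in> supports n e" using T unfolding supports_def e_def by auto
    then show ?thesis using low_degree_monomial by blast
  next
    case False
    have fin: "finite T" using T finite_subset by auto
    have "card ({..<n} - T) = n - card T" using T fin by (simp add: card_Diff_subset)
    with False have "{..<n} - T \<in> supports n (n div 2)" unfolding supports_def by auto
    then have "low_degree n e (\<lambda>x. monomial ({..<n} - T) x * p x)"
      unfolding e_def using low_degree_monomial p by (intro low_degree_mult) auto
    moreover have "monomial T x = monomial ({..<n} - T) x * p x" if "x \<in> A" for x
    proof -
      have "sym_diff ({..<n} - T) {..<n} = T" using T by blast
      then show ?thesis using that by (simp add: agree monomial_mult)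
    qed
    ultimately show ?thesis by blast
  qed
  have ex: "\<exists>c. \<forall>x\<in>A. f x = ev c x" for f :: "bool list \<Rightarrow> 3"
  proof -
    obtain c where c: "\<forall>x\<in>cube n. f x = (\<Sum>T\<in>supports n n. c T * monomial T x)"
      using low_degree_all[of n f] unfolding low_degree_def by blast
    obtain g where g: "\<And>T. T \<in> supports n n \<Longrightarrow> low_degree n e (g T)"
      "\<And>T x. T \<in> supports n n \<Longrightarrow> x \<in> A \<Longrightarrow> monomial T x = g T x"
      using mono_low unfolding supports_def by (metis (no_types, lifting) mem_Collect_eq)
    have "low_degree n e (\<lambda>x. \<Sum>T\<in>supports n n. c T * g T x)"
      using g(1) by (intro low_degree_sum low_degree_scale) auto
    then obtain b where "\<forall>x\<in>cube n. (\<Sum>T\<in>supports n n. c T * g T x) = ev b x"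
      unfolding low_degree_def ev_def by blast
    then have "f x = ev b x" if "x \<in> A" for x
      using that A c g(2) by (auto simp: subset_iff)
    then show ?thesis by blast
  qed
  have "PiE A (\<lambda>_. UNIV :: 3 set) \<subseteq> (\<lambda>c. restrict (ev c) A) ` PiE (supports n e) (\<lambda>_. UNIV)"
  proof
    fix f :: "bool list \<Rightarrow> 3" assume f: "f \<in> PiE A (\<lambda>_. UNIV)"
    obtain c where c: "\<forall>x\<in>A. f x = ev c x" using ex by blast
    have "ev (restrict c (supports n e)) x = ev c x" for x
      unfolding ev_def by (intro sum.cong) auto
    then have "f = restrict (ev (restrict c (supports n e))) A"
      using f c by (auto simp: PiE_def extensional_def restrict_def)
    moreover have "restrict c (supports n e) \<in> PiE (supports n e) (\<lambda>_. UNIV)" by simp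
    ultimately show "f \<in> (\<lambda>c. restrict (ev c) A) ` PiE (supports n e) (\<lambda>_. UNIV)"
      by (rule image_eqI)
  qed
  then have "card (PiE A (\<lambda>_. UNIV :: 3 set)) \<le> card (PiE (supports n e) (\<lambda>_. UNIV :: 3 set))"
    by (rule surj_card_le[rotated]) (simp add: finite_PiE)
  moreover have "finite A" using finite_subset[OF A] by simp
  ultimately have "(3 :: nat) ^ card A \<le> 3 ^ card (supports n e)"
    by (simp add: card_PiE)
  then show ?thesis unfolding e_def by simp
qed

section \<open>Counting monomials up to slightly above the middle layer\<close>

text \<open>The squared form of the bound 4^m / sqrt (2 m + 1). The induction step comes down to (2
  m + 1) (2 m + 3) being at most (2 m + 2)^2.\<close>

lemma central_binomial_upper_bound: "(2 * m choose m)\<^sup>2 * (2 * m + 1) \<le> (16::nat) ^ m"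
proof (induction m)
  case (Suc m)
  define b where "b = (2 * m choose m)"
  have "Suc m * (Suc (2 * m + 1) choose Suc m) = Suc (2 * m + 1) * (2 * m + 1 choose m)"
    using Suc_times_binomial_eq[of "2 * m + 1" m] by (simp only: mult.commute)
  moreover have "Suc m * (Suc (2 * m) choose m) = Suc (2 * m) * b"
  proof -
    have "(Suc (2 * m) choose m) = (Suc (2 * m) choose Suc m)"
      using binomial_symmetric[of m "Suc (2 * m)"] by simp
    then show ?thesis unfolding b_def using Suc_times_binomial_eq[of "2 * m" m] by simp
  qed
  ultimately have step: "Suc m * (2 * Suc m choose Suc m) = 2 * (2 * m + 1) * b"
    by (simp add: algebra_simps)
  define a where "a = (2 * Suc m choose Suc m)"
  have "(Suc m)\<^sup>2 * (a\<^sup>2 * (2 * Suc m + 1)) = (Suc m * a)\<^sup>2 * (2 * m + 3)"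
  proof -
    have "2 * Suc m + 1 = 2 * m + 3" by simp
    then show ?thesis by (simp only: power_mult_distrib mult.assoc)
  qed
  also have "\<dots> = (4 * (2 * m + 1) * (2 * m + 3)) * (b\<^sup>2 * (2 * m + 1))"
  proof -
    have "(2 * r * b)\<^sup>2 * t = (4 * r * t) * (b\<^sup>2 * r)" for r t :: nat
      by (simp add: power2_eq_square)
    then show ?thesis unfolding step[folded a_def] .
  qed
  also have "\<dots> \<le> (16 * (Suc m)\<^sup>2) * 16 ^ m"
  proof (rule mult_le_mono)
    show "4 * (2 * m + 1) * (2 * m + 3) \<le> 16 * (Suc m)\<^sup>2"
      by (simp add: power2_eq_square algebra_simps)
    show "b\<^sup>2 * (2 * m + 1) \<le> 16 ^ m"
      using Suc.IH unfolding b_def .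
  qed
  finally have "(Suc m)\<^sup>2 * (a\<^sup>2 * (2 * Suc m + 1)) \<le> (Suc m)\<^sup>2 * 16 ^ Suc m" by simp
  then show ?case unfolding a_def by (subst (asm) mult_le_cancel1) simp
qed simp

text \<open>Complementation shows that the layers below the middle hold at most half of all subsets.
  The \<open>d + 1\<close> layers from the middle on are each at most the central one, and the
  assumption makes their total at most a quarter.\<close>

lemma card_supports_le:
  assumes "(4 * (d + 1))\<^sup>2 \<le> 2 * m + 1"
  shows "4 * card (supports (2 * m) (m + d)) \<le> 3 * 4 ^ m"
proof -
  define n where "n = 2 * m"
  define K where "K P = card {T. T \<subseteq> {..<n} \<and> P (card T)}" for P
  have finP [simp]: "finite {T. T \<subseteq> {..<n} \<and> P (card T)}" for P
    by (rule finite_subset[of _ "Pow {..<n}"]) auto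
  have compl: "card ({..<n} - T) = n - card T" if "T \<subseteq> {..<n}" for T
    using that finite_subset by (subst card_Diff_subset) auto
  have "K (\<lambda>k. k < m) \<le> K (\<lambda>k. m < k)"
    unfolding K_def
  proof (rule card_inj_on_le[of "\<lambda>T. {..<n} - T"])
    show "inj_on (\<lambda>T. {..<n} - T) {T. T \<subseteq> {..<n} \<and> card T < m}"
      by (auto simp: inj_on_def)
    show "(\<lambda>T. {..<n} - T) ` {T. T \<subseteq> {..<n} \<and> card T < m} \<subseteq> {T. T \<subseteq> {..<n} \<and> m < card T}"
    proof (intro image_subsetI CollectI conjI)
      fix T assume "T \<in> {T. T \<subseteq> {..<n} \<and> card T < m}"
      then show "m < card ({..<n} - T)" using compl[of T] unfolding n_def by simp linarith
    qed auto
  qed simp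
  moreover have "K (\<lambda>k. k < m) + K (\<lambda>k. m < k) \<le> 4 ^ m"
  proof -
    have "K (\<lambda>k. k < m) + K (\<lambda>k. m < k) =
        card ({T. T \<subseteq> {..<n} \<and> card T < m} \<union> {T. T \<subseteq> {..<n} \<and> m < card T})"
      unfolding K_def by (intro card_Un_disjoint[symmetric] finP) auto
    also have "\<dots> \<le> card (Pow {..<n})" by (intro card_mono) auto
    also have "\<dots> = 4 ^ m" by (simp add: card_Pow n_def power_mult)
    finally show ?thesis .
  qed
  ultimately have low: "2 * K (\<lambda>k. k < m) \<le> 4 ^ m" by linarith
  have "card (supports (2 * m) (m + d)) \<le> K (\<lambda>k. k < m) + (\<Sum>k\<in>{m..m + d}. n choose k)"
  proof -
    have "supports (2 * m) (m + d) = {T. T \<subseteq> {..<n} \<and> card T < m} \<union>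
        (\<Union>k\<in>{m..m + d}. {T. T \<subseteq> {..<n} \<and> card T = k})"
      unfolding supports_def n_def by auto
    then have "card (supports (2 * m) (m + d)) \<le> K (\<lambda>k. k < m) +
        card (\<Union>k\<in>{m..m + d}. {T. T \<subseteq> {..<n} \<and> card T = k})"
      unfolding K_def by (simp add: card_Un_le)
    also have "card (\<Union>k\<in>{m..m + d}. {T. T \<subseteq> {..<n} \<and> card T = k}) \<le>
        (\<Sum>k\<in>{m..m + d}. card {T. T \<subseteq> {..<n} \<and> card T = k})"
      by (intro card_UN_le) simp
    also have "\<dots> = (\<Sum>k\<in>{m..m + d}. n choose k)"
      using n_subsets[of "{..<n}"] by simp
    finally show ?thesis by simp
  qed
  also have "(\<Sum>k\<in>{m..m + d}. n choose k) \<le> (\<Sum>k\<in>{m..m + d}. n choose m)"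
    using binomial_maximum'[of m] unfolding n_def by (intro sum_mono) simp
  also have "\<dots> = (d + 1) * (n choose m)" by simp
  finally have *: "card (supports (2 * m) (m + d)) \<le> K (\<lambda>k. k < m) + (d + 1) * (n choose m)"
    by simp
  have "(4 * ((d + 1) * (n choose m)))\<^sup>2 = (n choose m)\<^sup>2 * (4 * (d + 1))\<^sup>2"
  proof -
    have "(4 * (e * b))\<^sup>2 = b\<^sup>2 * (4 * e)\<^sup>2" for e b :: nat by (simp add: power_mult_distrib)
    then show ?thesis .
  qed
  also have "\<dots> \<le> (n choose m)\<^sup>2 * (2 * m + 1)" using assms by (intro mult_left_mono) auto
  also have "\<dots> \<le> 16 ^ m" unfolding n_def by (rule central_binomial_upper_bound)
  also have "\<dots> = (4 ^ m)\<^sup>2" 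
    by (simp add: power2_eq_square flip: power_mult_distrib)
  finally have "4 * ((d + 1) * (n choose m)) \<le> 4 ^ m"
    by (rule power2_le_imp_le) simp
  with * low show ?thesis by linarith
qed

text \<open>Agreement covers at most 3/4 of the cube and \<open>Bad\<close> at most 1/8, so some
  point is left over.\<close>

lemma uncovered_low_degree:
  assumes "finite Bad" "8 * card Bad \<le> 4 ^ m" "(4 * (d + 1))\<^sup>2 \<le> 2 * m + 1"
    and p: "low_degree (2 * m) d p"
  shows "\<exists>x\<in>cube (2 * m) - Bad. p x \<noteq> monomial {..<2 * m} x"
proof (rule ccontr)
  assume "\<not> ?thesis"
  then have "card (cube (2 * m) - Bad) \<le> card (supports (2 * m) (2 * m div 2 + d))"
    by (intro card_agreement_le[OF _ p]) auto
  then have "4 * card (cube (2 * m) - Bad) \<le> 3 * 4 ^ m"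
    using card_supports_le[OF assms(3)] by simp
  moreover have "card (cube (2 * m)) - card Bad \<le> card (cube (2 * m) - Bad)"
    using assms(1) by (rule diff_card_le_card_Diff)
  moreover have "card (cube (2 * m)) = 4 ^ m" by (simp add: power_mult)
  moreover have "(4::nat) ^ m > 0" by simp
  ultimately show False using assms(2) by linarith
qed

section \<open>Approximating circuits by polynomials\<close>

text \<open>\<open>depth\<close> is a \<open>Max\<close>, which bounds path lengths only once the
  set of these lengths is known to be finite. Well-founded induction bounds the paths from each
  gate, and there are finitely many gates.\<close>

lemma ex_path_bound:
  assumes wf: "wf_circuit n C"
  shows "\<exists>k. wires C ^^ k = {}"
proof -
  have fin: "finite (wires C)"
    using wf finite_subset unfolding wf_circuit_def by blast
  have "\<exists>k. \<forall>h. (g, h) \<notin> wires C ^^ k" for g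
  proof (induction g rule: wf_induct_rule[OF wf_circuit_wf_wires[OF wf]])
    case (1 g)
    then obtain K where K: "\<And>h. (g, h) \<in> wires C \<Longrightarrow> \<forall>h'. (h, h') \<notin> wires C ^^ K h"
      by (simp add: converse_iff) metis
    define k where "k = Max (insert 0 (K ` children C g))"
    have finc: "finite (children C g)"
      unfolding children_def using finite_subset[of "{h. (g, h) \<in> wires C}" "snd ` wires C"] fin
      by (force intro: finite_subset)
    have "(g, h') \<notin> wires C ^^ Suc k" for h'
    proof
      assume "(g, h') \<in> wires C ^^ Suc k"
      then obtain h where h: "(g, h) \<in> wires C" "(h, h') \<in> wires C ^^ k"
        by (metis relpow_Suc_D2)
      have "K h \<le> k" unfolding k_def using finc h(1) by (auto simp: children_def)
      then obtain j where "k = K h + j" using le_Suc_ex by blast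
      then show False using h K[OF h(1)] by (auto simp: relpow_add)
    qed
    then show ?case by blast
  qed
  then obtain K where K: "\<And>g h. (g, h) \<notin> wires C ^^ K g" by metis
  define k where "k = Max (insert 0 (K ` {..<gates C}))"
  have "wires C ^^ Suc k = {}"
  proof (rule ccontr)
    assume "wires C ^^ Suc k \<noteq> {}"
    then obtain g h' where gh: "(g, h') \<in> wires C ^^ Suc k" by auto
    then obtain h where "(g, h) \<in> wires C" by (metis relpow_Suc_D2)
    then have "g < gates C" using wf unfolding wf_circuit_def by auto
    then have "K g \<le> Suc k" unfolding k_def by (intro le_SucI Max_ge) auto
    then obtain j where "Suc k = K g + j" using le_Suc_ex by blast
    then show False using gh K[of g] by (auto simp: relpow_add)
  qed
  then show ?thesis by blast
qed

lemma finite_path_lengths: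
  assumes "wf_circuit n C"
  shows "finite {k. wires C ^^ k \<noteq> {}}"
proof -
  obtain K where "wires C ^^ K = {}" using ex_path_bound[OF assms] by blast
  then have "wires C ^^ k = {}" if "K \<le> k" for k
    using that le_Suc_ex by (metis relpow_add relcomp_empty1)
  then have "{k. wires C ^^ k \<noteq> {}} \<subseteq> {..K}" by (auto simp: not_le[symmetric])
  then show ?thesis by (rule finite_subset) simp
qed

lemma path_length_le_depth:
  assumes "wf_circuit n C" "(g, h) \<in> wires C ^^ k"
  shows "k \<le> depth C"
  unfolding depth_def using finite_path_lengths[OF assms(1)] assms(2) by (intro Max_ge) auto

lemma children_less:
  assumes "wf_circuit n C" "h \<in> children C g"
  shows "h < gates C"
  using assms unfolding wf_circuit_def children_def by auto

lemma finite_children: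
  assumes "wf_circuit n C"
  shows "finite (children C g)"
  by (rule finite_subset[of _ "{..<gates C}"]) (use children_less[OF assms] in auto)

text \<open>The case in which the chosen sums report no true child, rightly or not.\<close>

definition missed :: "(nat \<Rightarrow> nat set) \<Rightarrow> nat \<Rightarrow> (nat \<Rightarrow> bool) \<Rightarrow> bool" where
  "missed S l u \<longleftrightarrow> (\<forall>j<l. (\<Sum>h\<in>S j. of_bool (u h) :: 3) = 0)"

lemma prod_of_bool:
  "finite A \<Longrightarrow> (\<Prod>i\<in>A. of_bool (P i) :: 'a::comm_semiring_1) = of_bool (\<forall>i\<in>A. P i)"
  by (induction A rule: finite_induct) auto

text \<open>With \<open>s j\<close> the sum over \<open>S j\<close>, the polynomial is one minus the
  product of all 1 - (s j)^2. A factor is 1 if the sum vanishes and 0 otherwise. If no child is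
  true, all sums vanish and the value is right; an error thus needs a true child and a miss, which
  \<open>X\<close> excludes.\<close>

lemma approximate_disjunction:
  fixes u :: "nat \<Rightarrow> bool list \<Rightarrow> bool"
  assumes H: "finite H" and S: "\<And>j. j < l \<Longrightarrow> S j \<subseteq> H"
    and p: "\<And>h. h \<in> H \<Longrightarrow> \<exists>p. low_degree n d p \<and> (\<forall>x\<in>X. p x = of_bool (u h x))"
    and X: "\<And>x. x \<in> X \<Longrightarrow> \<exists>h\<in>H. u h x \<Longrightarrow> \<not> missed S l (\<lambda>h. u h x)"
  shows "\<exists>p. low_degree n (2 * l * d) p \<and> (\<forall>x\<in>X. p x = of_bool (\<exists>h\<in>H. u h x))"
proof -
  obtain q where q: "\<And>h. h \<in> H \<Longrightarrow> low_degree n d (q h)"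
    "\<And>h x. h \<in> H \<Longrightarrow> x \<in> X \<Longrightarrow> q h x = of_bool (u h x)"
    using p by metis
  define s where "s j x = (\<Sum>h\<in>S j. q h x)" for j x
  have "low_degree n d (s j)" if "j < l" for j
    unfolding s_def using S[OF that] q(1) by (intro low_degree_sum) auto
  then have "low_degree n (2 * d) (\<lambda>x. 1 - s j x * s j x)" if "j < l" for j
    unfolding mult_2 using that by (intro low_degree_diff low_degree_const low_degree_mult) auto
  then have "low_degree n (card {..<l} * (2 * d)) (\<lambda>x. \<Prod>j<l. 1 - s j x * s j x)"
    by (intro low_degree_prod) auto
  then have "low_degree n (2 * l * d) (\<lambda>x. 1 - (\<Prod>j<l. 1 - s j x * s j x))"
    by (intro low_degree_diff low_degree_const) (simp add: ac_simps)
  moreover have "1 - (\<Prod>j<l. 1 - s j x * s j x) = of_bool (\<exists>h\<in>H. u h x)" if x: "x \<in> X" for x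
  proof -
    have s: "s j x = (\<Sum>h\<in>S j. of_bool (u h x))" if "j < l" for j
      unfolding s_def using S[OF that] q(2) x by (intro sum.cong) auto
    have "1 - s j x * s j x = of_bool (s j x = 0)" for j
      using mod3_square[of "s j x"] by (auto simp: power2_eq_square)
    then have "(\<Prod>j<l. 1 - s j x * s j x) = of_bool (missed S l (\<lambda>h. u h x))"
      unfolding missed_def using s by (simp only: prod_of_bool finite_lessThan lessThan_iff Ball_def cong: imp_cong)
    moreover have "missed S l (\<lambda>h. u h x)" if "\<not> (\<exists>h\<in>H. u h x)"
      unfolding missed_def
    proof (intro allI impI sum.neutral ballI)
      show "of_bool (u h x) = 0" if "j < l" "h \<in> S j" for j h
        using S[OF that(1)] that(2) \<open>\<not> (\<exists>h\<in>H. u h x)\<close> by auto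
    qed
    ultimately show ?thesis using X[OF x] by auto
  qed
  ultimately show ?thesis by blast
qed

text \<open>One exceptional set serves all gates at once: it collects the inputs on which the exact
  values of the children of some gate are missed by the sums chosen for that gate. Errors
  therefore do not have to be propagated through the circuit.\<close>

lemma approximate_circuit:
  assumes wf: "wf_circuit n C" and l: "0 < l"
    and v: "\<And>x. x \<in> cube n \<Longrightarrow> gate_values C x (v x)"
  shows "\<exists>Bad. finite Bad \<and> 2 ^ l * card Bad \<le> gates C * 2 ^ n \<and>
    (\<forall>g<gates C. \<exists>p. low_degree n ((2 * l) ^ Suc (depth C)) p \<and>
       (\<forall>x\<in>cube n - Bad. p x = of_bool (v x g)))"
proof -
  \<comment> \<open>By De Morgan a conjunction is treated as the negated disjunction of its negated
    children.\<close>
  define u where "u g h x = (if kind C g = Conj then \<not> v x h else v x h)" for g h x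
  define good where "good g S \<longleftrightarrow> (\<forall>j<l. S j \<subseteq> children C g) \<and>
      2 ^ l * card {x \<in> cube n. (\<exists>h\<in>children C g. u g h x) \<and> missed S l (\<lambda>h. u g h x)} \<le> 2 ^ n" for g S
  have ex: "\<exists>S. good g S" for g
  proof -
    define B where "B = {x \<in> cube n. \<exists>h\<in>children C g. u g h x}"
    have "finite B" unfolding B_def by simp
    then obtain S where S: "\<forall>j<l. S j \<subseteq> children C g"
      "2 ^ l * card {x \<in> B. missed S l (\<lambda>h. u g h x)} \<le> card B"
      using iterated_halving[OF finite_children[OF wf], of B g "u g" l]
      unfolding B_def missed_def by blast
    have "card B \<le> card (cube n)" unfolding B_def by (intro card_mono) auto
    moreover have "{x \<in> B. missed S l (\<lambda>h. u g h x)} =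
        {x \<in> cube n. (\<exists>h\<in>children C g. u g h x) \<and> missed S l (\<lambda>h. u g h x)}"
      unfolding B_def by auto
    ultimately have "good g S" using S unfolding good_def by simp
    then show ?thesis by blast
  qed
  define S where "S g = (SOME S. good g S)" for g
  have "good g (S g)" for g unfolding S_def by (rule someI_ex[OF ex])
  then have S: "\<And>g j. j < l \<Longrightarrow> S g j \<subseteq> children C g"
    "\<And>g. 2 ^ l * card {x \<in> cube n. (\<exists>h\<in>children C g. u g h x) \<and>
       missed (S g) l (\<lambda>h. u g h x)} \<le> 2 ^ n"
    unfolding good_def by blast+
  define bad where "bad g = {x \<in> cube n. (\<exists>h\<in>children C g. u g h x) \<and>
    missed (S g) l (\<lambda>h. u g h x)}" for g
  define Bad where "Bad = (\<Union>g<gates C. bad g)"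
  have finBad: "finite Bad" unfolding Bad_def bad_def by auto
  have "card Bad \<le> (\<Sum>g<gates C. card (bad g))"
    unfolding Bad_def by (intro card_UN_le) simp
  then have "2 ^ l * card Bad \<le> (\<Sum>g<gates C. 2 ^ l * card (bad g))"
    by (simp flip: sum_distrib_left)
  also have "\<dots> \<le> (\<Sum>g<gates C. 2 ^ n)"
    using S(2) unfolding bad_def by (intro sum_mono) auto
  finally have cardBad: "2 ^ l * card Bad \<le> gates C * 2 ^ n" by simp
  \<comment> \<open>Induction on a bound for the paths that start at \<open>g\<close>. Outside
    \<open>Bad\<close> the polynomials of the children are exact, so each level only multiplies the
    degree by \<open>2 * l\<close>.\<close>
  have step: "\<exists>p. low_degree n ((2 * l) ^ k) p \<and> (\<forall>x\<in>cube n - Bad. p x = of_bool (v x g))"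
    if "g < gates C" "\<forall>h. (g, h) \<notin> wires C ^^ k" for g k
    using that
  proof (induction k arbitrary: g)
    case 0
    then show ?case by auto
  next
    case (Suc k)
    have IH: "\<exists>p. low_degree n ((2 * l) ^ k) p \<and> (\<forall>x\<in>cube n - Bad. p x = of_bool (v x h))"
      if "h \<in> children C g" for h
    proof (rule Suc.IH)
      show "h < gates C" by (rule children_less[OF wf that])
      show "\<forall>h'. (h, h') \<notin> wires C ^^ k"
        using Suc.prems(2) that unfolding children_def by (auto dest: relpow_Suc_I2)
    qed
    have neg: "\<exists>p. low_degree n ((2 * l) ^ k) p \<and> (\<forall>x\<in>cube n - Bad. p x = of_bool (\<not> v x h))"
      if "h \<in> children C g" for h
    proof -
      obtain p where "low_degree n ((2 * l) ^ k) p" "\<forall>x\<in>cube n - Bad. p x = of_bool (v x h)"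
        using IH[OF \<open>h \<in> children C g\<close>] by blast
      then show ?thesis
        by (intro exI[of _ "\<lambda>x. 1 - p x"]) (auto intro!: low_degree_diff low_degree_const)
    qed
    have val: "v x g = (case kind C g of Input i \<Rightarrow> x ! i | Neg \<Rightarrow> \<forall>h\<in>children C g. \<not> v x h
        | Conj \<Rightarrow> \<forall>h\<in>children C g. v x h | Disj \<Rightarrow> \<exists>h\<in>children C g. v x h)" if "x \<in> cube n" for x
      using v[OF that] Suc.prems(1) unfolding gate_values_def by blast
    have kind_wf: "case kind C g of Input i \<Rightarrow> i < n \<and> children C g = {}
        | Neg \<Rightarrow> card (children C g) = 1 | _ \<Rightarrow> True"
      using wf Suc.prems(1) unfolding wf_circuit_def by blast
    have deg: "(2 * l) ^ Suc k = 2 * l * (2 * l) ^ k" by simp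
    have disj: "\<exists>p. low_degree n ((2 * l) ^ Suc k) p \<and>
        (\<forall>x\<in>cube n - Bad. p x = of_bool (\<exists>h\<in>children C g. u g h x))"
      unfolding deg
    proof (rule approximate_disjunction[where S = "S g"])
      show "\<exists>p. low_degree n ((2 * l) ^ k) p \<and> (\<forall>x\<in>cube n - Bad. p x = of_bool (u g h x))"
        if "h \<in> children C g" for h
        using IH[OF that] neg[OF that] unfolding u_def by (cases "kind C g = Conj") simp_all
      show "\<not> missed (S g) l (\<lambda>h. u g h x)" if "x \<in> cube n - Bad" "\<exists>h\<in>children C g. u g h x" for x
        using that Suc.prems(1) unfolding Bad_def bad_def by auto
    qed (use S(1) finite_children[OF wf] in auto)
    show ?case
    proof (cases "kind C g")
      case (Input i)
      have "low_degree n ((2 * l) ^ Suc k) (\<lambda>x. of_bool (x ! i))"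
        by (rule low_degree_mono[OF low_degree_input]) (use Input kind_wf l in auto)
      then show ?thesis using val Input by (intro exI[of _ "\<lambda>x. of_bool (x ! i)"]) auto
    next
      case Neg
      then obtain h where h: "children C g = {h}"
        using kind_wf by (auto simp: card_1_singleton_iff)
      obtain p where "low_degree n ((2 * l) ^ k) p" "\<forall>x\<in>cube n - Bad. p x = of_bool (\<not> v x h)"
        using neg h by blast
      then show ?thesis using val h Neg l
        by (intro exI[of _ p]) (auto elim!: low_degree_mono)
    next
      case Conj
      obtain p where "low_degree n ((2 * l) ^ Suc k) p"
        "\<forall>x\<in>cube n - Bad. p x = of_bool (\<exists>h\<in>children C g. \<not> v x h)"
        using disj Conj unfolding u_def by auto
      then show ?thesis using val Conj
        by (intro exI[of _ "\<lambda>x. 1 - p x"]) (auto intro!: low_degree_diff low_degree_const)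
    next
      case Disj
      then show ?thesis using disj val unfolding u_def by auto
    qed
  qed
  have "(g, h) \<notin> wires C ^^ Suc (depth C)" for g h
    using path_length_le_depth[OF wf, of g h "Suc (depth C)"] by (auto simp del: relpow.simps)
  then have "\<forall>g<gates C. \<exists>p. low_degree n ((2 * l) ^ Suc (depth C)) p \<and>
      (\<forall>x\<in>cube n - Bad. p x = of_bool (v x g))"
    by (intro allI impI step)
  with finBad cardBad show ?thesis by (intro exI conjI)
qed

text \<open>The assumption on \<open>l\<close> makes the exceptional set at most 1/8 of the cube. A
  gate for parity then contradicts the counting unless its degree is of the order of the square root
  of the input length.\<close>

lemma circuit_computes_parity_bound:
  assumes wf: "wf_circuit (2 * m) C" and g: "g < gates C" and l: "0 < l"
    and small: "8 * gates C \<le> 2 ^ l"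
    and comp: "\<And>x. x \<in> cube (2 * m) \<Longrightarrow>
      \<exists>v. gate_values C x v \<and> v g = even (card {i. i < 2 * m \<and> x ! i})"
  shows "2 * m + 1 < (4 * ((2 * l) ^ Suc (depth C) + 1))\<^sup>2"
proof (rule ccontr)
  assume "\<not> ?thesis"
  then have bound: "(4 * ((2 * l) ^ Suc (depth C) + 1))\<^sup>2 \<le> 2 * m + 1" by simp
  obtain v where v: "\<And>x. x \<in> cube (2 * m) \<Longrightarrow> gate_values C x (v x)"
    "\<And>x. x \<in> cube (2 * m) \<Longrightarrow> v x g = even (card {i. i < 2 * m \<and> x ! i})"
    using comp by metis
  obtain Bad where Bad: "finite Bad" "2 ^ l * card Bad \<le> gates C * 2 ^ (2 * m)"
    and approx: "\<forall>g<gates C. \<exists>p. low_degree (2 * m) ((2 * l) ^ Suc (depth C)) p \<and>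
       (\<forall>x\<in>cube (2 * m) - Bad. p x = of_bool (v x g))"
    using approximate_circuit[OF wf l, of v] v(1) by blast
  obtain p where p: "low_degree (2 * m) ((2 * l) ^ Suc (depth C)) p"
      "\<forall>x\<in>cube (2 * m) - Bad. p x = of_bool (v x g)"
    using approx[rule_format, OF g] by blast
  \<comment> \<open>Turns the values 1 and 0 of the gate into 1 and -1, the product of all spins for
    an even and an odd number of ones.\<close>
  define q where "q x = p x + p x - 1" for x
  have "low_degree (2 * m) ((2 * l) ^ Suc (depth C)) q"
    unfolding q_def by (intro low_degree_diff low_degree_add p low_degree_const)
  moreover have "8 * card Bad \<le> 4 ^ m"
  proof -
    have "2 ^ l * (8 * card Bad) \<le> (8 * gates C) * 2 ^ (2 * m)" using Bad(2) by simp
    also have "\<dots> \<le> 2 ^ l * 2 ^ (2 * m)" using small by (intro mult_right_mono) auto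
    finally show ?thesis by (simp add: power_mult)
  qed
  ultimately obtain x where x: "x \<in> cube (2 * m) - Bad" "q x \<noteq> monomial {..<2 * m} x"
    using uncovered_low_degree[OF Bad(1) _ bound] by blast
  have "monomial {..<2 * m} x = (\<Prod>i\<in>{i. i < 2 * m \<and> x ! i}. - 1)"
    unfolding monomial_def spin_def by (intro prod.mono_neutral_cong_right) auto
  also have "\<dots> = (if even (card {i. i < 2 * m \<and> x ! i}) then 1 else - 1)"
    by simp
  finally show False using x v(2)[of x] p(2) unfolding q_def by (auto split: if_splits)
qed

section \<open>An input length that refutes polynomial size and constant depth\<close>

text \<open>Inputs of length \<open>2 * 4 ^ k\<close> make the square root of half the length the
  exact number \<open>2 ^ k\<close>, and polynomial size becomes \<open>2\<close> to a multiple of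
  \<open>k + 1\<close>.\<close>

lemma poly_le_exponential: "\<exists>a. \<forall>k. poly p (2 * 4 ^ k) \<le> (2::nat) ^ (a * (k + 1))"
proof (induction p)
  case (pCons c p)
  then obtain a where a: "\<And>k. poly p (2 * 4 ^ k) \<le> 2 ^ (a * (k + 1))" by blast
  have "poly (pCons c p) (2 * 4 ^ k) \<le> 2 ^ ((c + 3 + a) * (k + 1))" for k
  proof -
    have "c \<le> 2 ^ (c * (k + 1))"
      using less_exp[of "c * (k + 1)"] le_add1[of c "c * k"] by (simp only: distrib_left)
    also have "\<dots> \<le> 2 ^ ((c + 2 + a) * (k + 1))" by (intro power_increasing mult_right_mono) auto
    finally have 1: "c \<le> 2 ^ ((c + 2 + a) * (k + 1))" .
    have "2 * 4 ^ k * poly p (2 * 4 ^ k) \<le> 2 ^ (2 * (k + 1)) * 2 ^ (a * (k + 1))"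
      using a by (intro mult_le_mono) (auto simp: power_mult)
    also have "\<dots> = 2 ^ ((2 + a) * (k + 1))" by (simp only: add_mult_distrib power_add)
    also have "\<dots> \<le> 2 ^ ((c + 2 + a) * (k + 1))" by (intro power_increasing mult_right_mono) auto
    finally have "poly (pCons c p) (2 * 4 ^ k) \<le> 2 ^ Suc ((c + 2 + a) * (k + 1))" using 1 by simp
    also have "\<dots> \<le> 2 ^ ((c + 3 + a) * (k + 1))" by (intro power_increasing) (auto simp: algebra_simps)
    finally show ?thesis .
  qed
  then show ?case by blast
qed simp

lemma ex_exponential_dominates: "\<exists>k. 4 * ((2 * (a * (k + 1))) ^ e + 1) \<le> (2::nat) ^ k"
proof -
  define c where "c = 4 * ((2 * a) ^ e + 1)"
  have "(\<lambda>k. (real k + 1) ^ e / 2 ^ k) \<longlonglongrightarrow> 0" by real_asymp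
  moreover have c_pos: "0 < 1 / real c" by (simp add: c_def add_pos_nonneg)
  ultimately have "eventually (\<lambda>k. (real k + 1) ^ e / 2 ^ k < 1 / real c) sequentially"
    by (rule order_tendstoD(2))
  then obtain k where "(real k + 1) ^ e / 2 ^ k < 1 / real c"
    by (auto simp: eventually_sequentially)
  then have "real (c * (k + 1) ^ e) \<le> real (2 ^ k)"
    using c_pos by (simp add: field_simps)
  then have *: "c * (k + 1) ^ e \<le> 2 ^ k" by (simp only: of_nat_le_iff)
  have "4 * ((2 * (a * (k + 1))) ^ e + 1) \<le> 4 * ((2 * a) ^ e * (k + 1) ^ e + (k + 1) ^ e)"
    by (simp only: power_mult_distrib mult.assoc) simp
  also have "\<dots> = c * (k + 1) ^ e" unfolding c_def by (simp only: add_mult_distrib mult.assoc mult_1)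
  also note *
  finally show ?thesis by blast
qed

lemma odd_bin_value: "w \<noteq> [] \<Longrightarrow> odd (bin_value w) \<longleftrightarrow> last w"
  by (cases w rule: rev_cases) (auto simp: bin_value_def)

theorem parity_not_AC0:
  assumes "C \<in> AC0"
  shows "\<exists>x. \<not> outputs_number C x (1 + of_bool (parity x))"
proof (rule ccontr)
  assume "\<not> ?thesis"
  then have out: "outputs_number C x (1 + of_bool (parity x))" for x by blast
  obtain p :: "nat poly" where p: "\<And>n. circuit_size (C n) \<le> poly p n"
    using assms unfolding AC0_def uniform_poly_size_def poly_bounded_def by blast
  obtain d where d: "\<And>n. depth (C n) \<le> d" using assms unfolding AC0_def by blast
  obtain a where a: "\<And>k. poly p (2 * 4 ^ k) \<le> (2::nat) ^ (a * (k + 1))"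
    using poly_le_exponential by blast
  obtain k where k: "4 * ((2 * ((a + 3) * (k + 1))) ^ Suc d + 1) \<le> (2::nat) ^ k"
    using ex_exponential_dominates by blast
  define m where "m = (4::nat) ^ k"
  \<comment> \<open>The summand 3 absorbs the factor 8 in front of the number of gates.\<close>
  define l where "l = (a + 3) * (k + 1)"
  have wf: "wf_circuit (2 * m) (C (2 * m))"
    using assms unfolding AC0_def uniform_poly_size_def by blast
  \<comment> \<open>The number to be output is positive, and an empty list of outputs would denote
    0. So there is a last output gate.\<close>
  obtain w where w: "circuit_output (C (2 * m)) (replicate (2 * m) False) w" "0 < bin_value w"
    using out[of "replicate (2 * m) False"] unfolding outputs_number_def by auto
  then have ne: "outs (C (2 * m)) \<noteq> []"
    unfolding circuit_output_def by (auto simp: bin_value_def)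
  define g where "g = last (outs (C (2 * m)))"
  have comp: "\<exists>v. gate_values (C (2 * m)) x v \<and> v g = even (card {i. i < 2 * m \<and> x ! i})"
    if x: "x \<in> cube (2 * m)" for x
  proof -
    have len: "length x = 2 * m" using x unfolding cube_def by simp
    obtain v where v: "gate_values (C (2 * m)) x v"
      "bin_value (map v (outs (C (2 * m)))) = 1 + of_bool (parity x)"
      using out[of x] unfolding outputs_number_def circuit_output_def len by blast
    \<comment> \<open>The last digit of 1 plus the parity bit is 1 exactly for an even number of
      ones, however many leading zeros the circuit writes.\<close>
    have "v g = odd (bin_value (map v (outs (C (2 * m)))))"
      using ne by (simp add: odd_bin_value last_map g_def)
    also have "\<dots> = even (card {i. i < 2 * m \<and> x ! i})"
      unfolding v(2) using parity_card[of x] len by auto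
    finally show ?thesis using v(1) by blast
  qed
  have "8 * gates (C (2 * m)) \<le> 8 * 2 ^ (a * (k + 1))"
    using p[of "2 * m"] a[of k] unfolding circuit_size_def m_def by linarith
  also have "\<dots> \<le> 2 ^ (3 * (k + 1)) * 2 ^ (a * (k + 1))"
    by (intro mult_right_mono) (simp_all add: power_add)
  also have "\<dots> = 2 ^ l"
    unfolding l_def by (simp only: power_add[symmetric] add_mult_distrib add.commute)
  finally have "2 * m + 1 < (4 * ((2 * l) ^ Suc (depth (C (2 * m))) + 1))\<^sup>2"
    using ne wf by (intro circuit_computes_parity_bound[OF wf _ _ _ comp])
      (auto simp: wf_circuit_def g_def l_def subset_iff)
  also have "\<dots> \<le> (4 * ((2 * l) ^ Suc d + 1))\<^sup>2"
    using d[of "2 * m"] by (intro power_mono mult_left_mono add_right_mono power_increasing)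
      (auto simp: l_def)
  also have "\<dots> \<le> (2 ^ k)\<^sup>2"
    using k unfolding l_def by (intro power_mono) auto
  also have "\<dots> = m" unfolding m_def by (simp add: power2_eq_square flip: power_mult_distrib)
  finally show False by simp
qed

section \<open>Turing machines with symbolic states\<close>

lemma run_add: "run M x y (s + t) = (step M x y ^^ t) (run M x y s)"
  by (simp add: run_def add.commute[of s t] funpow_add)

lemma step_halted:
  "state c = accept M \<or> state c = reject M \<Longrightarrow> (step M x y ^^ t) c = c"
  by (induction t) (auto simp: step_def)

lemma run_halted:
  assumes "state (run M x y s) = accept M \<or> state (run M x y s) = reject M" "s \<le> t"
  shows "run M x y t = run M x y s"
proof -
  obtain d where "t = s + d" using assms(2) le_Suc_ex by blast
  then show ?thesis using step_halted[OF assms(1)] by (simp add: run_add)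
qed

type_synonym ('q, 'a) program =
  "'q \<Rightarrow> 'a tape_symbol \<Rightarrow> bool option \<Rightarrow> nat list \<Rightarrow> 'q \<times> move \<times> bool \<times> (nat \<times> move) list \<times> bool option"

text \<open>Transfers a program over a finite state type to numbered states along
  \<open>to_nat\<close>, so that the finiteness and closure of the state set come from the
  type.\<close>

definition tm_of :: "nat set \<Rightarrow> nat \<Rightarrow> 'q \<Rightarrow> 'q \<Rightarrow> 'q \<Rightarrow> ('q::finite, 'a) program \<Rightarrow> 'a aux_tm" where
  "tm_of G k s a r f = \<lparr>states = range (to_nat :: 'q \<Rightarrow> nat), symbols = G, work_tapes = k,
     start = to_nat s, accept = to_nat a, reject = to_nat r,
     delta = (\<lambda>q i b ws. case f (from_nat q) i b ws of
       (q', im, adv, acts, em) \<Rightarrow> \<lparr>next_state = to_nat q', input_move = im, aux_advance = adv,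
          work_actions = acts, emit = em\<rparr>)\<rparr>"

lemma wf_tm_of:
  assumes "finite G" "0 \<in> G" "a \<noteq> r"
    and "\<And>q i b ws. length ws = k \<Longrightarrow> set ws \<subseteq> G \<Longrightarrow>
      length (fst (snd (snd (snd (f q i b ws))))) = k \<and>
      fst ` set (fst (snd (snd (snd (f q i b ws))))) \<subseteq> G"
  shows "wf_tm (tm_of G k s a r f)"
  using assms unfolding wf_tm_def tm_of_def by (simp add: split_beta)

definition conf :: "'q::finite \<Rightarrow> nat \<Rightarrow> nat \<Rightarrow> (nat \<times> (nat \<Rightarrow> nat)) list \<Rightarrow> bool list \<Rightarrow> config" where
  "conf q p ap ws out = \<lparr>state = to_nat q, input_pos = p, aux_pos = ap, work = ws, written = out\<rparr>"

lemma conf_sel [simp]: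
  "state (conf q p ap ws out) = to_nat q" "written (conf q p ap ws out) = out"
  "work (conf q p ap ws out) = ws"
  by (simp_all add: conf_def)

lemma tm_of_sel [simp]:
  "accept (tm_of G k s a r f) = to_nat a" "reject (tm_of G k s a r f) = to_nat r"
  by (simp_all add: tm_of_def)

lemma initial_tm_of: "initial (tm_of G k s a r f) = conf s 0 0 (replicate k (0, \<lambda>_. 0)) []"
  by (simp add: initial_def tm_of_def conf_def)

lemma step_tm_of:
  assumes "q \<noteq> a" "q \<noteq> r"
  shows "step (tm_of G k s a r f) x y (conf q p ap ws out) =
    (case f q (input_symbol x p) (aux_symbol y ap) (map (\<lambda>(p, t). t p) ws) of
      (q', im, adv, acts, em) \<Rightarrow>
        conf q' (min (length x + 1) (move_head im p)) (if adv then ap + 1 else ap)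
          (map2 (\<lambda>(p, t) (s, mv). (move_head mv p, t(p := s))) ws acts)
          (out @ (case em of None \<Rightarrow> [] | Some b \<Rightarrow> [b])))"
  using assms by (simp add: step_def conf_def tm_of_def Let_def split: prod.split)

text \<open>The machines for the instances, solutions and measure of the problem keep everything in
  their finite control, so 0 serves as their space bound.\<close>

lemma work_space_no_tapes: "work_space (tm_of G 0 s a r f) x y n"
proof -
  have "work (run (tm_of G 0 s a r f) x y t) = []" for t
    by (induction t) (auto simp: run_def initial_tm_of step_def Let_def)
  then show ?thesis by (simp add: work_space_def)
qed

datatype verdict = Running | Accepting | Rejecting

lemma UNIV_verdict: "UNIV = {Running, Accepting, Rejecting}"
  using verdict.exhaust by blast

instance verdict :: finite
  by standard (simp add: UNIV_verdict)

lemma log_bounded_0: "log_bounded (\<lambda>_. 0)"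
  by (simp add: log_bounded_def)

lemma logspace_UNIV: "logspace UNIV"
proof -
  define M :: "bool aux_tm" where
    "M = tm_of {0} 0 Accepting Accepting Rejecting (\<lambda>q _ _ _. (q, Stay, False, [], None))"
  have "wf_tm M" unfolding M_def by (rule wf_tm_of) auto
  moreover have "decides M x [] True" for x
    unfolding decides_def decides_in_time_def M_def
    by (rule exI[of _ 0]) (simp add: run_def initial_tm_of)
  moreover have "work_space M x [] 0" for x
    unfolding M_def by (rule work_space_no_tapes)
  ultimately show ?thesis
    unfolding logspace_def using log_bounded_0 by (intro exI[of _ M] exI[of _ "\<lambda>_. 0"]) auto
qed

section \<open>The separating problem\<close>

definition parity_problem :: problem where
  "parity_problem = \<lparr>instances = UNIV, SOL = (\<lambda>_. {[]}),
     measr = (\<lambda>x _. 1 + of_bool (parity x)), goal = Maximize\<rparr>"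

definition empty_solution_tm :: "bool aux_tm" where
  "empty_solution_tm = tm_of {0} 0 Running Accepting Rejecting
     (\<lambda>_ _ b _. (if b = None then Accepting else Rejecting, Stay, False, [], None))"

lemma decides_empty_solution: "decides empty_solution_tm x y (y \<in> {[]})"
  unfolding decides_def decides_in_time_def empty_solution_tm_def
  by (rule exI[of _ 1])
    (auto simp: run_def initial_tm_of step_tm_of aux_symbol_def)

datatype scan_state = Scan bool | Last_Bit | Finished | Failed

lemma UNIV_scan_state: "UNIV = {Scan True, Scan False, Last_Bit, Finished, Failed}"
  by (auto intro: scan_state.exhaust) (metis (full_types) scan_state.exhaust)

instance scan_state :: finite
  by standard (simp add: UNIV_scan_state)

text \<open>The measure is written as \<open>bin 1 = [True]\<close> or
  \<open>bin 2 = [True, False]\<close>; \<open>Last_Bit\<close> adds the second digit of the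
  latter.\<close>

fun scan_program :: "(scan_state, bool) program" where
  "scan_program (Scan b) Left_End _ _ = (Scan b, Move_Right, False, [], None)"
| "scan_program (Scan b) (Symbol c) _ _ = (Scan (b \<noteq> c), Move_Right, False, [], None)"
| "scan_program (Scan b) Right_End _ _ =
     (if b then Last_Bit else Finished, Stay, False, [], Some True)"
| "scan_program Last_Bit _ _ _ = (Finished, Stay, False, [], Some False)"
| "scan_program q _ _ _ = (q, Stay, False, [], None)"

definition scan_tm :: "bool aux_tm" where
  "scan_tm = tm_of {0} 0 (Scan False) Finished Failed scan_program"

lemma run_scan:
  \<comment> \<open>The first step only leaves the left end marker, hence \<open>Suc t\<close> steps
    for \<open>t\<close> bits.\<close>
  "t \<le> length x \<Longrightarrow> run scan_tm x y (Suc t) =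
     conf (Scan (parity (take t x))) (Suc t) 0 [] []"
proof (induction t)
  case 0
  then show ?case
    by (simp add: run_def initial_tm_of scan_tm_def)
      (simp add: step_tm_of input_symbol_def parity_def)
next
  case (Suc t)
  have "run scan_tm x y (Suc (Suc t)) = step scan_tm x y (run scan_tm x y (Suc t))"
    by (simp add: run_def)
  also have "\<dots> = conf (Scan (parity (take t x) \<noteq> x ! t)) (Suc (Suc t)) 0 [] []"
    using Suc unfolding scan_tm_def
    by (simp add: step_tm_of input_symbol_def) 
  also have "\<dots> = conf (Scan (parity (take (Suc t) x))) (Suc (Suc t)) 0 [] []"
    using Suc.prems by (simp add: take_Suc_conv_app_nth parity_def)
  finally show ?case .
qed

lemma writes_scan: "writes scan_tm x y (bin (1 + of_bool (parity x)))"
proof -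
  define b where "b \<longleftrightarrow> parity x"
  have start: "run scan_tm x y (Suc (length x)) = conf (Scan b) (Suc (length x)) 0 [] []"
    using run_scan[of "length x" x y] by (simp add: b_def)
  have at_end: "input_symbol x (Suc (length x)) = Right_End"
    by (simp add: input_symbol_def)
  have 1: "run scan_tm x y (Suc (Suc (length x))) =
      conf (if b then Last_Bit else Finished) (Suc (length x)) 0 [] [True]"
  proof -
    have "run scan_tm x y (Suc (Suc (length x))) = step scan_tm x y (run scan_tm x y (Suc (length x)))"
      by (simp add: run_def)
    then show ?thesis unfolding start unfolding scan_tm_def
      by (simp add: step_tm_of at_end)
  qed
  show ?thesis
  proof (cases b)
    case True
    have "run scan_tm x y (Suc (Suc (Suc (length x)))) =
        step scan_tm x y (run scan_tm x y (Suc (Suc (length x))))"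
      by (simp add: run_def)
    also have "\<dots> = conf Finished (Suc (length x)) 0 [] [True, False]"
      unfolding 1 using True unfolding scan_tm_def by (simp add: step_tm_of)
    finally show ?thesis
      unfolding writes_def b_def[symmetric] using True
      by (intro exI[of _ "Suc (Suc (Suc (length x)))"]) (simp add: scan_tm_def bin_pos)
  next
    case False
    then show ?thesis
      unfolding writes_def b_def[symmetric] using 1
      by (intro exI[of _ "Suc (Suc (length x))"]) (simp add: scan_tm_def bin_pos)
  qed
qed

lemma parity_problem_NLO: "parity_problem \<in> NLO"
proof -
  have "\<exists>M s. wf_tm M \<and> log_bounded s \<and>
      (\<forall>x :: bool list. \<forall>y. decides M x y (y \<in> {[]}) \<and> work_space M x y (s (length x)))"
  proof (intro exI conjI allI)
    show "wf_tm empty_solution_tm"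
      unfolding empty_solution_tm_def by (rule wf_tm_of) (auto split: if_splits)
    show "log_bounded (\<lambda>_. 0)" by (rule log_bounded_0)
    show "work_space empty_solution_tm x y 0" for x y
      unfolding empty_solution_tm_def by (rule work_space_no_tapes)
  qed (rule decides_empty_solution)
  moreover have "\<exists>M s. wf_tm M \<and> log_bounded s \<and>
      (\<forall>x. \<forall>y\<in>{[]}. writes M x y (bin (1 + of_bool (parity x))) \<and>
         work_space M x y (s (length x)))"
  proof (intro exI conjI allI ballI)
    show "wf_tm scan_tm" unfolding scan_tm_def
    proof (rule wf_tm_of)
      show "length (fst (snd (snd (snd (scan_program q i b ws))))) = 0 \<and>
          fst ` set (fst (snd (snd (snd (scan_program q i b ws))))) \<subseteq> {0}" for q i b ws
        by (cases "(q, i, b, ws)" rule: scan_program.cases) auto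
    qed auto
    show "log_bounded (\<lambda>_. 0)" by (rule log_bounded_0)
    show "work_space scan_tm x y 0" for x y
      unfolding scan_tm_def by (rule work_space_no_tapes)
  qed (rule writes_scan)
  moreover have "\<exists>p :: nat poly. \<forall>x. \<forall>y\<in>{[]}. length y \<le> poly p (length x)" by simp
  ultimately show ?thesis
    unfolding NLO_def parity_problem_def optimization_problem_def
    using logspace_UNIV by simp
qed

lemma optimum_parity: "optimum parity_problem x = 1 + of_bool (parity x)"
  by (simp add: optimum_def parity_problem_def)

section \<open>The circuit without gates\<close>

definition empty_circuit :: circuit where
  "empty_circuit = \<lparr>gates = 0, kind = (\<lambda>_. Conj), wires = {}, outs = []\<rparr>"

lemma depth_empty_circuit: "depth empty_circuit = 0"
proof -
  have "wires empty_circuit ^^ k \<noteq> {} \<longleftrightarrow> k = 0" for k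
    by (cases k) (auto simp: empty_circuit_def)
  then show ?thesis by (simp add: depth_def)
qed

text \<open>The connection language is empty, and a machine that starts in its rejecting state
  decides it in 0 steps.\<close>

lemma empty_circuit_uniform: "uniform_poly_size (\<lambda>_. empty_circuit)"
proof -
  have "dlogtime_uniform (\<lambda>_. empty_circuit)"
    unfolding dlogtime_uniform_def
  proof (intro exI conjI allI)
    define M :: "bool option aux_tm" where
      "M = tm_of {0} 0 Rejecting Accepting Rejecting (\<lambda>q _ _ _. (q, Stay, False, [], None))"
    show "wf_tm M" unfolding M_def by (rule wf_tm_of) auto
    show "log_bounded (\<lambda>_. 0)" by (rule log_bounded_0)
    show "decides_in_time M (encode_nats (n # q)) [] (n # q \<in> direct_connections (\<lambda>_. empty_circuit)) 0"
      for n q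
      by (simp add: decides_in_time_def run_def M_def initial_tm_of direct_connections_def
          empty_circuit_def)
  qed
  moreover have "poly_bounded (\<lambda>_. circuit_size empty_circuit)"
    by (simp add: poly_bounded_def circuit_size_def empty_circuit_def)
  ultimately show ?thesis
    by (auto simp: uniform_poly_size_def wf_circuit_def empty_circuit_def acyclic_def)
qed

lemma empty_circuit_AC0: "(\<lambda>_. empty_circuit) \<in> AC0"
  using empty_circuit_uniform depth_empty_circuit by (auto simp: AC0_def)

lemma empty_circuit_NC1: "(\<lambda>_. empty_circuit) \<in> NC1"
  using empty_circuit_uniform
  by (simp add: NC1_def depth_empty_circuit log_bounded_0) (simp add: empty_circuit_def)

lemma empty_circuit_outputs: "outputs_string (\<lambda>_. empty_circuit) x (Some [])"
  by (auto simp: outputs_string_def circuit_output_def gate_values_def empty_circuit_def)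

lemma parity_problem_AC0AS: "parity_problem \<in> AC0AS_NLO"
proof -
  have "approximates (\<lambda>_. empty_circuit) parity_problem (of_rat r)" if "r > 1" for r
    using that empty_circuit_outputs
    by (auto simp: approximates_def ratio_def optimum_parity) (auto simp: parity_problem_def)
  then show ?thesis
    unfolding AC0AS_NLO_def using parity_problem_NLO empty_circuit_AC0 by auto
qed

section \<open>A log-depth circuit for parity\<close>

abbreviation bit_length :: "nat \<Rightarrow> nat" where
  "bit_length n \<equiv> length (bin n)"

lemma bit_length_pos: "0 < n \<Longrightarrow> bit_length n = Suc (bit_length (n div 2))"
  by (simp add: bin_pos)

lemma less_bit_length: "n < 2 ^ bit_length n"
proof (induction n rule: less_induct)
  case (less n)
  show ?case
  proof (cases "n = 0")
    case False
    then have "n div 2 < 2 ^ bit_length (n div 2)" using less by simp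
    then show ?thesis using False by (simp add: bit_length_pos)
  qed simp
qed

lemma bit_length_le: "0 < n \<Longrightarrow> 2 ^ bit_length n \<le> 2 * n"
proof (induction n rule: less_induct)
  case (less n)
  show ?case
  proof (cases "n = 1")
    case False
    then have "2 ^ bit_length (n div 2) \<le> 2 * (n div 2)" using less by simp
    then show ?thesis using less.prems by (simp add: bit_length_pos)
  qed (simp add: bin_pos)
qed

lemma bit_length_double: "0 < w \<Longrightarrow> bit_length (2 * w + of_bool b) = Suc (bit_length w)"
  by (subst bit_length_pos) auto

lemma bit_length_le_iff: "bit_length w \<le> L \<longleftrightarrow> w < 2 ^ L"
proof
  assume "bit_length w \<le> L"
  then have "(2::nat) ^ bit_length w \<le> 2 ^ L" by simp
  then show "w < 2 ^ L" using less_bit_length[of w] by linarith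
next
  assume w: "w < 2 ^ L"
  show "bit_length w \<le> L"
  proof (cases "w = 0")
    case False
    then have "(2::nat) ^ bit_length w < 2 ^ Suc L" using bit_length_le[of w] w by simp
    then show ?thesis by (subst (asm) power_strict_increasing_iff) auto
  qed simp
qed

lemma log_bounded_bit_length:
  assumes "\<And>n. f n \<le> a * bit_length n + b"
  shows "log_bounded f"
  unfolding log_bounded_def
proof (rule bigoI)
  show "\<forall>\<^sub>F n in sequentially. norm (real (f n)) \<le> real (3 * a + b) * norm (ln (real n))"
    \<comment> \<open>From 3 on, \<open>ln n\<close> is at least 1. With \<open>ln 2\<close> at
      least 1/2, the binary length is at most \<open>2 * ln n + 1\<close> and so at most
      \<open>3 * ln n\<close>; the summand \<open>b\<close> is absorbed in the same way.\<close>
    using eventually_ge_at_top[of 3]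
  proof eventually_elim
    case (elim n)
    have "3 \<le> real n" using elim by simp
    then have "exp 1 \<le> real n" using exp_le by linarith
    then have ln1: "1 \<le> ln (real n)" using elim by (simp add: ln_ge_iff)
    have "real (2 ^ bit_length n) \<le> real (2 * n)"
      using bit_length_le[of n] elim by (intro of_nat_mono) simp
    then have "ln (2 ^ bit_length n) \<le> ln (2 * real n)" using elim by simp
    then have "real (bit_length n) * ln 2 \<le> ln 2 + ln (real n)"
      using elim by (simp add: ln_mult ln_realpow)
    moreover have "1 / 2 \<le> ln (2::real)"
    proof -
      have "exp 1 \<le> (2 * 2 :: real)" using exp_le by simp
      then have "1 \<le> ln (2 * 2 :: real)" by (subst ln_ge_iff) auto
      then show ?thesis by (subst (asm) ln_mult) auto
    qed
    then have "(real (bit_length n) - 1) * (1 / 2) \<le> (real (bit_length n) - 1) * ln 2"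
      using elim by (intro mult_left_mono) (auto simp: bin_pos)
    ultimately have "real (bit_length n) \<le> 3 * ln (real n)"
      using ln1 by (simp add: algebra_simps)
    then have "real a * real (bit_length n) + real b \<le> real a * (3 * ln (real n)) + real b * ln (real n)"
      using ln1 mult_left_mono[OF ln1, of "real b"] by (intro add_mono mult_left_mono) auto
    moreover have "real (f n) \<le> real a * real (bit_length n) + real b"
      using assms[of n] by (simp flip: of_nat_mult of_nat_add)
    ultimately show ?case using ln1 by (simp add: algebra_simps)
  qed
qed

text \<open>A path of \<open>k\<close> wires lowers the rank by at least \<open>k\<close>, which
  excludes cycles and long paths alike.\<close>

lemma depth_le_rank:
  assumes "\<And>g h. (g, h) \<in> wires C \<Longrightarrow> r h < r g \<and> r g \<le> R"
  shows "acyclic (wires C)" "depth C \<le> R"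
proof -
  have "r h + k \<le> r g" if "(g, h) \<in> wires C ^^ k" for g h k
    using that
  proof (induction k arbitrary: h)
    case (Suc k)
    then obtain h' where "(g, h') \<in> wires C ^^ k" "(h', h) \<in> wires C" by auto
    then show ?case using Suc.IH[of h'] assms[of h' h] by linarith
  qed auto
  then have path: "r h + k \<le> r g" if "(g, h) \<in> wires C ^^ k" for g h k using that .
  show "acyclic (wires C)"
    unfolding acyclic_def
  proof (intro allI notI)
    fix g assume "(g, g) \<in> (wires C)\<^sup>+"
    then obtain k where "0 < k" "(g, g) \<in> wires C ^^ k" by (auto simp: trancl_power)
    then show False using path[of g g k] by simp
  qed
  have bound: "k \<le> R" if nonempty: "wires C ^^ k \<noteq> {}" for k
  proof (cases k)
    case (Suc j)
    obtain g h where gh: "(g, h) \<in> wires C ^^ k" using nonempty by auto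
    then obtain h' where "(g, h') \<in> wires C" unfolding Suc by (metis relpow_Suc_D2)
    then show ?thesis using assms path[OF gh] by fastforce
  qed simp
  have "finite {k. wires C ^^ k \<noteq> {}}"
    by (rule finite_subset[of _ "{..R}"]) (use bound in auto)
  moreover have "(0, 0) \<in> wires C ^^ 0" by simp
  then have "{k. wires C ^^ k \<noteq> {}} \<noteq> {}" by blast
  ultimately show "depth C \<le> R"
    unfolding depth_def using bound by (subst Max_le_iff) auto
qed

text \<open>Let \<open>N = 2 ^ bit_length n\<close>. The tree has the root \<open>1\<close>, the children of the node \<open>w\<close> are \<open>2 * w\<close>
  and \<open>2 * w + 1\<close>, and the nodes \<open>N + i\<close>, where \<open>i < N\<close>, are the leaves. The gate \<open>s * N + w\<close> has the
  type \<open>s < 8\<close>. For bits \<open>e\<close> and \<open>c\<close>, the type \<open>e\<close> stands for the value of the leaf \<open>N + w\<close>, and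
  \<open>2 + e\<close> for the parity of the leaves below the node \<open>w\<close>, both negated if \<open>e = 1\<close>. The latter is
  the disjunction of the types \<open>4 + 2 * e + c\<close>, which are conjunctions of two children of the tree
  node, the first one negated if \<open>c = 1\<close> and the second one if \<open>c = e\<close>; \<open>flag\<close> is this
  negation. No node is \<open>0\<close>, and the corresponding gates are constants. If \<open>n = 0\<close>, then the outputs
  happen to be two of them, with the right values.\<close>

definition flag :: "nat \<Rightarrow> bool \<Rightarrow> bool" where
  "flag s b \<longleftrightarrow> (if b then odd s \<longleftrightarrow> odd (s div 2) else odd s)"

definition tree_kind :: "nat \<Rightarrow> nat \<Rightarrow> nat \<Rightarrow> gate" where
  "tree_kind n s w = (if s = 0 then if w < n then Input w else Disj
     else if s = 1 then Neg else if s < 4 then Disj else Conj)"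

definition tree_wire :: "nat \<Rightarrow> nat \<Rightarrow> nat \<Rightarrow> nat \<Rightarrow> nat \<Rightarrow> bool" where
  "tree_wire N s w s' w' \<longleftrightarrow>
     s = 1 \<and> s' = 0 \<and> w' = w \<or>
     2 \<le> s \<and> s < 4 \<and> 0 < w \<and> s' div 2 = s \<and> w' = w \<or>
     4 \<le> s \<and> s < 8 \<and> 0 < w \<and>
       (\<exists>b. w' = (2 * w + of_bool b) mod N \<and>
          s' = (if 2 * w + of_bool b < N then 2 else 0) + of_bool (flag s b))"

definition parity_circuit :: "nat \<Rightarrow> circuit" where
  "parity_circuit n = (let N = 2 ^ bit_length n in
     \<lparr>gates = 8 * N, kind = (\<lambda>g. tree_kind n (g div N) (g mod N)),
      wires = {(g, h). g < 8 * N \<and> h < 8 * N \<and> tree_wire N (g div N) (g mod N) (h div N) (h mod N)},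
      outs = [2 * N + 1, 3 * N + 1]\<rparr>)"

text \<open>Each tree level costs two ranks, a disjunction above its conjunctions. On the lowest
  inner level, where \<open>bit_length w = L\<close>, the conjunctions have rank 2, just above the
  leaves and their negations with 0 and 1.\<close>

definition gate_rank :: "nat \<Rightarrow> nat \<Rightarrow> nat \<Rightarrow> nat" where
  "gate_rank L s w = (if s < 2 then s else 2 * (L - bit_length w) + (if s < 4 then 3 else 2))"

lemma tree_wire_rank:
  assumes "tree_wire (2 ^ L) s w s' w'" "w < 2 ^ L"
  shows "gate_rank L s' w' < gate_rank L s w"
proof -
  have L: "bit_length w \<le> L" using assms(2) by (simp add: bit_length_le_iff)
  consider "s = 1" "s' = 0" | "2 \<le> s" "s < 4" "s' div 2 = s" "w' = w"
    | b where "4 \<le> s" "s < 8" "0 < w" "w' = (2 * w + of_bool b) mod 2 ^ L"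
      "s' = (if 2 * w + of_bool b < 2 ^ L then 2 else 0) + of_bool (flag s b)"
    using assms(1) unfolding tree_wire_def by blast
  then show ?thesis
  proof cases
    case 2
    then have "4 \<le> s'" by linarith
    then show ?thesis using 2 by (simp add: gate_rank_def)
  next
    case (3 b)
    show ?thesis
    proof (cases "2 * w + of_bool b < 2 ^ L")
      case True
      then have "Suc (bit_length w) \<le> L"
        using bit_length_double[OF 3(3), of b] by (simp add: bit_length_le_iff[symmetric])
      moreover have "bit_length w' = Suc (bit_length w)"
        using True 3 bit_length_double[OF 3(3), of b] by simp
      moreover have "2 \<le> s'" "s' < 4" using True 3(5) by auto
      ultimately show ?thesis using 3(1,2) by (auto simp: gate_rank_def)
    next
      case False
      then have "s' < 2" using 3(5) by auto
      then show ?thesis using 3(1,2) by (auto simp: gate_rank_def)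
    qed
  qed (auto simp: gate_rank_def)
qed

lemma gate_rank_le: "gate_rank L s w \<le> 2 * L + 3"
  by (auto simp: gate_rank_def)

context
  fixes n N L :: nat
  assumes L: "L = bit_length n" and N: "N = 2 ^ L"
begin

lemma N_pos: "0 < N" using N by simp

lemma parity_circuit_sel:
  "gates (parity_circuit n) = 8 * N"
  "kind (parity_circuit n) g = tree_kind n (g div N) (g mod N)"
  "(g, h) \<in> wires (parity_circuit n) \<longleftrightarrow>
     g < 8 * N \<and> h < 8 * N \<and> tree_wire N (g div N) (g mod N) (h div N) (h mod N)"
  "outs (parity_circuit n) = [2 * N + 1, 3 * N + 1]"
  by (simp_all add: parity_circuit_def Let_def L N)

lemma children_parity_circuit:
  "children (parity_circuit n) g =
     {h. g < 8 * N \<and> h < 8 * N \<and> tree_wire N (g div N) (g mod N) (h div N) (h mod N)}"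
  by (simp add: children_def parity_circuit_sel)

lemma parity_circuit_rank:
  "acyclic (wires (parity_circuit n))" "depth (parity_circuit n) \<le> 2 * L + 3"
proof -
  have "gate_rank L (h div N) (h mod N) < gate_rank L (g div N) (g mod N) \<and>
      gate_rank L (g div N) (g mod N) \<le> 2 * L + 3"
    if "(g, h) \<in> wires (parity_circuit n)" for g h
    using that tree_wire_rank[of L "g div N" "g mod N"] N_pos
    by (auto simp: parity_circuit_sel N gate_rank_le)
  then show "acyclic (wires (parity_circuit n))" "depth (parity_circuit n) \<le> 2 * L + 3"
    by (rule depth_le_rank[where r = "\<lambda>g. gate_rank L (g div N) (g mod N)"], blast)+
qed

lemma gate_code:
  assumes "h div N = s" "h mod N = w"
  shows "h = s * N + w"
  using assms div_mult_mod_eq[of h N] by simp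

text \<open>One bit indexes the children of any gate, which gives fan-in 2. For a negation both bits
  name the same child.\<close>

lemma children_subset:
  "children (parity_circuit n) g \<subseteq> (\<lambda>b. if g div N = 1 then g mod N
     else if g div N < 4 then (2 * (g div N) + of_bool b) * N + g mod N
     else (let u = 2 * (g mod N) + of_bool b in
       ((if u < N then 2 else 0) + of_bool (flag (g div N) b)) * N + u mod N)) ` UNIV"
    (is "_ \<subseteq> ?c ` UNIV")
proof
  fix h assume "h \<in> children (parity_circuit n) g"
  then have wire: "tree_wire N (g div N) (g mod N) (h div N) (h mod N)"
    by (simp add: children_parity_circuit)
  show "h \<in> ?c ` UNIV"
    using wire unfolding tree_wire_def
  proof (elim disjE conjE exE)
    assume *: "g div N = 1" "h div N = 0" "h mod N = g mod N"
    have "h = ?c True" using gate_code[OF *(2,3)] *(1) by simp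
    then show ?thesis by blast
  next
    assume *: "2 \<le> g div N" "g div N < 4" "h div N div 2 = g div N" "h mod N = g mod N"
    have "h div N = 2 * (h div N div 2) + of_bool (odd (h div N))" by simp
    then have "h div N = 2 * (g div N) + of_bool (odd (h div N))" unfolding *(3) .
    then have "h = ?c (odd (h div N))" using gate_code[OF _ *(4)] *(1,2) by auto
    then show ?thesis by blast
  next
    fix b
    assume *: "4 \<le> g div N" "h mod N = (2 * (g mod N) + of_bool b) mod N"
      "h div N = (if 2 * (g mod N) + of_bool b < N then 2 else 0) + of_bool (flag (g div N) b)"
    have "h = ?c b" using gate_code[OF *(3,2)] *(1) by (simp add: Let_def)
    then show ?thesis by blast
  qed
qed

lemma card_children_le: "card (children (parity_circuit n) g) \<le> 2"
proof -
  have "card (children (parity_circuit n) g) \<le> card (UNIV :: bool set)"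
    using children_subset by (rule surj_card_le[rotated]) simp
  then show ?thesis by simp
qed

lemma children_negation:
  assumes "g div N = 1"
  shows "children (parity_circuit n) g = {g mod N}"
proof -
  have mod: "g mod N < N" using N_pos by simp
  have g: "g = N + g mod N" using gate_code[OF assms refl] by simp
  have "h = g mod N" if "h div N = 0" "h mod N = g mod N" for h
    using gate_code[OF that] by simp
  moreover have "g < 8 * N" "g mod N < 8 * N" using g mod by linarith+
  moreover have "tree_wire N 1 w s' w' \<longleftrightarrow> s' = 0 \<and> w' = w" for w s' w'
    by (auto simp: tree_wire_def)
  moreover have "g mod N div N = 0" "g mod N mod N = g mod N" using mod by simp_all
  ultimately show ?thesis
    unfolding children_parity_circuit assms by blast
qed

lemma wf_parity_circuit: "wf_circuit n (parity_circuit n)"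
proof -
  have "0 < N" by (rule N_pos)
  moreover have "case kind (parity_circuit n) g of Input i \<Rightarrow> i < n \<and> children (parity_circuit n) g = {}
      | Neg \<Rightarrow> card (children (parity_circuit n) g) = 1 | _ \<Rightarrow> True" if "g < 8 * N" for g
    using children_negation[of g]
    by (auto simp: parity_circuit_sel tree_kind_def children_parity_circuit tree_wire_def)
  ultimately show ?thesis
    unfolding wf_circuit_def
    using parity_circuit_rank(1) by (auto simp: parity_circuit_sel)
qed

end

section \<open>Parities of subtrees as gate values\<close>

text \<open>Positions past the end of \<open>x\<close> count as false, which pads the input to a
  power of two of leaves.\<close>

definition segment_parity :: "bool list \<Rightarrow> nat \<Rightarrow> nat \<Rightarrow> bool" where
  "segment_parity x a b \<longleftrightarrow> odd (card {i \<in> {a..<b}. i < length x \<and> x ! i})"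

lemma segment_parity_split:
  assumes "a \<le> b" "b \<le> c"
  shows "segment_parity x a c \<longleftrightarrow> segment_parity x a b \<noteq> segment_parity x b c"
proof -
  have "{i \<in> {a..<c}. i < length x \<and> x ! i} =
      {i \<in> {a..<b}. i < length x \<and> x ! i} \<union> {i \<in> {b..<c}. i < length x \<and> x ! i}"
    using assms by auto
  then have "card {i \<in> {a..<c}. i < length x \<and> x ! i} =
      card {i \<in> {a..<b}. i < length x \<and> x ! i} + card {i \<in> {b..<c}. i < length x \<and> x ! i}"
    by (simp add: card_Un_disjoint disjoint_iff)
  then show ?thesis by (simp add: segment_parity_def)
qed

text \<open>The leaves of the tree are the nodes \<open>2 ^ L + i\<close>, where \<open>i < 2 ^ L\<close>.\<close>

definition node_parity :: "bool list \<Rightarrow> nat \<Rightarrow> nat \<Rightarrow> bool" where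
  "node_parity x L w = (let m = 2 ^ (Suc L - bit_length w) in
     segment_parity x (w * m - 2 ^ L) (Suc w * m - 2 ^ L))"

lemma node_parity_leaf:
  assumes "i < 2 ^ L"
  shows "node_parity x L (2 ^ L + i) \<longleftrightarrow> i < length x \<and> x ! i"
proof -
  have "\<not> bit_length (2 ^ L + i) \<le> L" by (simp add: bit_length_le_iff)
  moreover have "bit_length (2 ^ L + i) \<le> Suc L" using assms by (simp add: bit_length_le_iff)
  ultimately have "bit_length (2 ^ L + i) = Suc L" by linarith
  moreover have "{j. i \<le> j \<and> j < Suc i \<and> j < length x \<and> x ! j} = (if i < length x \<and> x ! i then {i} else {})"
    using le_antisym by (auto simp: less_Suc_eq_le)
  ultimately show ?thesis
    by (simp add: node_parity_def segment_parity_def Suc_diff_le)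
qed

text \<open>The leaves below \<open>w\<close> form an interval of length
  \<open>2 ^ (Suc L - bit_length w)\<close>. Doubling \<open>w\<close> adds one to its binary
  length, so the two children own the two halves of the interval.\<close>

lemma node_parity_inner:
  assumes "0 < w" "w < 2 ^ L"
  shows "node_parity x L w \<longleftrightarrow> node_parity x L (2 * w) \<noteq> node_parity x L (Suc (2 * w))"
proof -
  define m :: nat where "m = 2 ^ (L - bit_length w)"
  have len: "bit_length w \<le> L" using assms(2) by (simp add: bit_length_le_iff)
  then have "Suc L - bit_length w = Suc (L - bit_length w)" by simp
  then have m2: "(2::nat) ^ (Suc L - bit_length w) = 2 * m" by (simp add: m_def)
  have "2 ^ L \<le> w * (2 * m)"
  proof -
    have "(2::nat) ^ L = 2 ^ bit_length w * m"
      using len unfolding m_def by (simp flip: power_add)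
    also have "\<dots> \<le> (2 * w) * m" using bit_length_le[OF assms(1)] by (rule mult_le_mono1)
    finally show ?thesis by (simp add: mult.assoc mult.commute mult.left_commute)
  qed
  then have "segment_parity x (w * (2 * m) - 2 ^ L) (Suc w * (2 * m) - 2 ^ L) \<longleftrightarrow>
      segment_parity x (w * (2 * m) - 2 ^ L) (Suc (2 * w) * m - 2 ^ L) \<noteq>
      segment_parity x (Suc (2 * w) * m - 2 ^ L) (Suc w * (2 * m) - 2 ^ L)"
    by (intro segment_parity_split) (auto intro!: diff_le_mono)
  moreover have "bit_length (2 * w) = Suc (bit_length w)" "bit_length (Suc (2 * w)) = Suc (bit_length w)"
    using bit_length_double[OF assms(1), of False] bit_length_double[OF assms(1), of True] by simp_all
  moreover have "w * (2 * m) = 2 * w * m" "Suc w * (2 * m) = Suc (Suc (2 * w)) * m"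
    by (simp_all add: algebra_simps)
  ultimately show ?thesis
    unfolding node_parity_def Let_def m2 by (simp only: diff_Suc_Suc m_def)
qed

lemma node_parity_root:
  assumes "length x \<le> 2 ^ L"
  shows "node_parity x L 1 \<longleftrightarrow> parity x"
proof -
  have "{i \<in> {0..<2 ^ L}. i < length x \<and> x ! i} = {i. i < length x \<and> x ! i}"
    using assms by auto
  then show ?thesis
    by (simp add: node_parity_def segment_parity_def parity_card bin_pos)
qed

text \<open>The proposed value of each gate, to be checked against the gate semantics. At node 0 the
  types from 2 on have no children: an empty disjunction is false and an empty conjunction
  true.\<close>

definition tree_value :: "bool list \<Rightarrow> nat \<Rightarrow> nat \<Rightarrow> nat \<Rightarrow> bool" where
  "tree_value x L s w \<longleftrightarrow>
     (if s < 2 then node_parity x L (2 ^ L + w) \<noteq> odd s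
      else if s < 4 then 0 < w \<and> node_parity x L w \<noteq> odd s
      else w = 0 \<or> (\<forall>b. node_parity x L (2 * w + of_bool b) \<noteq> flag s b))"

lemma tree_value_leaf:
  assumes "w < 2 ^ L" "s < 2"
  shows "tree_value x L s w \<longleftrightarrow> (w < length x \<and> x ! w) \<noteq> odd s"
  using assms by (simp add: tree_value_def node_parity_leaf)

text \<open>Exclusive or, and likewise its negation, is a disjunction of two conjunctions of
  literals, one for each value of the first operand.\<close>

lemma tree_value_or:
  assumes "w < 2 ^ L" "2 \<le> s" "s < 4"
  shows "tree_value x L s w \<longleftrightarrow> 0 < w \<and> (\<exists>a. tree_value x L (2 * s + of_bool a) w)"
proof (cases "w = 0")
  case False
  have "tree_value x L (2 * s + of_bool a) w \<longleftrightarrow>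
      node_parity x L (2 * w) \<noteq> a \<and> node_parity x L (Suc (2 * w)) \<noteq> (a \<longleftrightarrow> odd s)" for a
    using assms False by (auto simp: tree_value_def flag_def all_bool_eq)
  moreover have "tree_value x L s w \<longleftrightarrow>
      (node_parity x L (2 * w) \<noteq> node_parity x L (Suc (2 * w))) \<noteq> odd s"
    using assms False node_parity_inner[of w L x] by (simp add: tree_value_def)
  ultimately show ?thesis using False by (auto simp: ex_bool_eq)
qed (use assms in \<open>auto simp: tree_value_def\<close>)

text \<open>A child below \<open>2 ^ L\<close> is an inner node, with type 2 or 3. Any other child
  is a leaf, with type 0 or 1, and reduction modulo \<open>2 ^ L\<close> gives its input
  position.\<close>

lemma tree_value_and:
  assumes "w < 2 ^ L" "4 \<le> s" "0 < w"
  shows "tree_value x L s w \<longleftrightarrow> (\<forall>b. tree_value x L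
    ((if 2 * w + of_bool b < 2 ^ L then 2 else 0) + of_bool (flag s b)) ((2 * w + of_bool b) mod 2 ^ L))"
proof -
  have "tree_value x L ((if u < 2 ^ L then 2 else 0) + of_bool (flag s b)) (u mod 2 ^ L) \<longleftrightarrow>
      node_parity x L u \<noteq> flag s b" if u: "u = 2 * w + of_bool b" for b u
  proof (cases "u < 2 ^ L")
    case True
    then show ?thesis using u assms by (auto simp: tree_value_def)
  next
    case False
    moreover have "u < 2 * 2 ^ L" using u assms(1) by (cases b) auto
    ultimately have "u mod 2 ^ L = u - 2 ^ L" by (simp add: mod_if)
    then show ?thesis using False by (auto simp: tree_value_def)
  qed
  then show ?thesis using assms(2,3) by (simp add: tree_value_def)
qed

lemma gate_values_parity_circuit:
  assumes "length x = n"
  shows "gate_values (parity_circuit n) x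
    (\<lambda>g. tree_value x (bit_length n) (g div 2 ^ bit_length n) (g mod 2 ^ bit_length n))"
proof -
  define L where "L = bit_length n"
  define N :: nat where "N = 2 ^ L"
  note sel = parity_circuit_sel[OF L_def N_def]
  note child = children_parity_circuit[OF L_def N_def]
  have N0: "0 < N" by (simp add: N_def)
  have code: "(s * N + w) div N = s" "(s * N + w) mod N = w" if "w < N" for s w
    using that by simp_all
  have in_child: "s' * N + w' \<in> children (parity_circuit n) g"
    if "g < 8 * N" "tree_wire N (g div N) (g mod N) s' w'" "s' < 8" "w' < N" for g s' w'
  proof -
    have "Suc s' * N \<le> 8 * N" using that(3) by (intro mult_le_mono1) simp
    then have "s' * N + w' < 8 * N" using that(4) unfolding mult_Suc by linarith
    then show ?thesis using that unfolding child by (simp add: code)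
  qed
  have "tree_value x L (g div N) (g mod N) = (case kind (parity_circuit n) g of
      Input i \<Rightarrow> x ! i
    | Neg \<Rightarrow> \<forall>h\<in>children (parity_circuit n) g. \<not> tree_value x L (h div N) (h mod N)
    | Conj \<Rightarrow> \<forall>h\<in>children (parity_circuit n) g. tree_value x L (h div N) (h mod N)
    | Disj \<Rightarrow> \<exists>h\<in>children (parity_circuit n) g. tree_value x L (h div N) (h mod N))"
    if g: "g < 8 * N" for g
  proof -
    define s where "s = g div N"
    define w where "w = g mod N"
    have s: "s < 8" using g unfolding s_def by (rule less_mult_imp_div_less)
    have w: "w < 2 ^ L" using N0 unfolding w_def N_def by simp
    have kind: "kind (parity_circuit n) g = tree_kind n s w" by (simp add: sel s_def w_def)
    have wire: "tree_wire N s w (h div N) (h mod N)" if "h \<in> children (parity_circuit n) g" for h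
      using that by (simp add: child s_def w_def)
    consider "s = 0" | "s = 1" | "2 \<le> s" "s < 4" | "4 \<le> s" by linarith
    then have "tree_value x L s w = (case tree_kind n s w of
        Input i \<Rightarrow> x ! i
      | Neg \<Rightarrow> \<forall>h\<in>children (parity_circuit n) g. \<not> tree_value x L (h div N) (h mod N)
      | Conj \<Rightarrow> \<forall>h\<in>children (parity_circuit n) g. tree_value x L (h div N) (h mod N)
      | Disj \<Rightarrow> \<exists>h\<in>children (parity_circuit n) g. tree_value x L (h div N) (h mod N))"
    proof cases
      case 1
      then show ?thesis
        using w assms wire by (auto simp: tree_value_leaf tree_kind_def tree_wire_def)
    next
      case 2
      have "children (parity_circuit n) g = {w}"
        using children_negation[OF L_def N_def, of g] 2 by (simp add: s_def w_def)
      moreover have "w div N = 0" "w mod N = w" using w by (simp_all add: N_def)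
      ultimately show ?thesis
        using 2 w by (simp add: tree_kind_def tree_value_leaf)
    next
      case 3
      have "(\<exists>h\<in>children (parity_circuit n) g. tree_value x L (h div N) (h mod N)) \<longleftrightarrow>
          0 < w \<and> (\<exists>a. tree_value x L (2 * s + of_bool a) w)" (is "?l \<longleftrightarrow> ?r")
      proof
        assume ?l
        then obtain h where h: "h \<in> children (parity_circuit n) g"
          "tree_value x L (h div N) (h mod N)" by blast
        have "0 < w" "h div N div 2 = s" "h mod N = w"
          using wire[OF h(1)] 3 by (auto simp: tree_wire_def)
        moreover have "h div N = 2 * (h div N div 2) + of_bool (odd (h div N))" by simp
        ultimately show ?r using h(2) by metis
      next
        assume ?r
        then obtain a where a: "0 < w" "tree_value x L (2 * s + of_bool a) w" by blast
        have "(2 * s + of_bool a) * N + w \<in> children (parity_circuit n) g"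
          using 3 a(1) w by (intro in_child[OF g]) (auto simp: tree_wire_def N_def s_def w_def)
        then show ?l using a(2) w by (intro bexI) (auto simp: code N_def)
      qed
      then show ?thesis using 3 w by (simp add: tree_kind_def tree_value_or)
    next
      case 4
      show ?thesis
      proof (cases "w = 0")
        case True
        then have "children (parity_circuit n) g = {}"
          using wire 4 by (auto simp: tree_wire_def)
        then show ?thesis using 4 True by (simp add: tree_kind_def tree_value_def)
      next
        case False
        define u where "u b = 2 * w + of_bool b" for b :: bool
        define t :: "bool \<Rightarrow> nat"
          where "t b = (if u b < N then 2 else 0) + of_bool (flag s b)" for b
        have "(\<forall>h\<in>children (parity_circuit n) g. tree_value x L (h div N) (h mod N)) \<longleftrightarrow>
            (\<forall>b. tree_value x L (t b) (u b mod N))" (is "?l \<longleftrightarrow> ?r")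
        proof
          assume l: ?l
          show ?r
          proof
            fix b
            have "t b * N + u b mod N \<in> children (parity_circuit n) g"
            proof (rule in_child[OF g])
              show "tree_wire N (g div N) (g mod N) (t b) (u b mod N)"
                using 4 s False unfolding tree_wire_def t_def u_def by (auto simp: s_def w_def)
            qed (auto simp: t_def N0)
            then show "tree_value x L (t b) (u b mod N)" using l N0 by (auto dest!: bspec simp: code)
          qed
        next
          assume r: ?r
          show ?l
          proof
            fix h assume "h \<in> children (parity_circuit n) g"
            then obtain b where "h mod N = u b mod N" "h div N = t b"
              using wire[of h] 4 unfolding tree_wire_def t_def u_def by auto
            then show "tree_value x L (h div N) (h mod N)" using r by simp
          qed
        qed
        then show ?thesis
          using 4 False tree_value_and[OF w 4, of x] by (simp add: tree_kind_def t_def u_def N_def)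
      qed
    qed
    then show ?thesis unfolding kind s_def w_def .
  qed
  then show ?thesis unfolding gate_values_def sel(1) L_def[symmetric] N_def[symmetric] by blast
qed

lemma parity_circuit_output: "outputs_number parity_circuit x (1 + of_bool (parity x))"
proof -
  define n where "n = length x"
  define L where "L = bit_length n"
  define N :: nat where "N = 2 ^ L"
  define v where "v g = tree_value x L (g div N) (g mod N)" for g
  have "gate_values (parity_circuit n) x v"
    using gate_values_parity_circuit[of x n] unfolding v_def n_def L_def N_def by simp
  moreover have "outs (parity_circuit n) = [2 * N + 1, 3 * N + 1]"
    using parity_circuit_sel(4)[OF L_def N_def] .
  ultimately have out: "circuit_output (parity_circuit (length x)) x [v (2 * N + 1), v (3 * N + 1)]"
    unfolding circuit_output_def n_def by fastforce
  have "v (2 * N + 1) = parity x \<and> v (3 * N + 1) = (\<not> parity x)"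
  proof (cases "n = 0")
    case True
    \<comment> \<open>With \<open>N = 1\<close> the outputs are the gates 3 and 4, that is, the
      types 3 and 4 at node 0: an empty disjunction and an empty conjunction.\<close>
    then have "N = 1" "x = []" by (simp_all add: N_def L_def n_def)
    then show ?thesis by (simp add: v_def tree_value_def parity_def)
  next
    case False
    then have "1 < N" using less_bit_length[of n] by (simp add: N_def L_def)
    then have "(s * N + 1) div N = s" "(s * N + 1) mod N = 1" for s
      by (simp_all only: div_mult_self3 mod_mult_self3 div_less mod_less)
    then have "(2 * N + 1) div N = 2" "(2 * N + 1) mod N = 1" "(3 * N + 1) div N = 3" "(3 * N + 1) mod N = 1"
      by blast+
    moreover have "length x \<le> 2 ^ L" using less_bit_length[of n] by (simp add: L_def n_def)
    ultimately show ?thesis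
      unfolding v_def using node_parity_root[of x L] by (simp add: tree_value_def)
  qed
  \<comment> \<open>For a parity bit p, the digits p and 1 - p denote 2 p + (1 - p) = 1 + p, which
    is why the negated parity is output as well.\<close>
  then have "bin_value [v (2 * N + 1), v (3 * N + 1)] = 1 + of_bool (parity x)"
    by (simp add: bin_value_def)
  then show ?thesis using out unfolding outputs_number_def by blast
qed

lemma parity_circuit_size: "poly_bounded (\<lambda>n. circuit_size (parity_circuit n))"
proof -
  \<comment> \<open>There are \<open>8 * N\<close> gates and two outputs, where \<open>N\<close> is
    at most \<open>2 * n\<close> for positive \<open>n\<close>; for \<open>n = 0\<close> the size is
    10.\<close>
  have "circuit_size (parity_circuit n) \<le> poly [:10, 16:] n" for n
    using bit_length_le[of n]
    by (cases "n = 0") (simp_all add: circuit_size_def parity_circuit_sel[OF refl refl])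
  then show ?thesis unfolding poly_bounded_def by blast
qed

lemma parity_circuit_depth: "log_bounded (\<lambda>n. depth (parity_circuit n))"
  using parity_circuit_rank(2)[OF refl refl]
  by (intro log_bounded_bit_length[where a = 2 and b = 3])

lemma parity_circuit_NC1:
  assumes "dlogtime_uniform parity_circuit"
  shows "parity_circuit \<in> NC1"
  using assms wf_parity_circuit[OF refl refl] parity_circuit_size parity_circuit_depth
    card_children_le[OF refl refl]
  by (simp add: NC1_def uniform_poly_size_def)

section \<open>Recognizing the direct connection language\<close>

text \<open>A register keeps three bits, and the last component records whether a further bit was set.\<close>

type_synonym register = "bool option \<times> bool option \<times> bool option \<times> bool"

fun push :: "bool \<Rightarrow> register \<Rightarrow> register" where
  "push c (None, y, z, ov) = (Some c, y, z, ov)"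
| "push c (Some x, None, z, ov) = (Some x, Some c, z, ov)"
| "push c (Some x, Some y, None, ov) = (Some x, Some y, Some c, ov)"
| "push c (Some x, Some y, Some z, ov) = (Some x, Some y, Some z, ov \<or> c)"

definition register_of :: "(nat \<Rightarrow> bool) \<Rightarrow> nat \<Rightarrow> register" where
  "register_of f k = (if 0 < k then Some (f 0) else None, if 1 < k then Some (f 1) else None,
     if 2 < k then Some (f 2) else None, \<exists>i<k. 3 \<le> i \<and> f i)"

text \<open>Values are cut off at 8. Gate types are below 8 and question codes below 6, so 8 stands
  for everything out of range.\<close>

definition register_value :: "register \<Rightarrow> nat" where
  "register_value r = (case r of (x, y, z, ov) \<Rightarrow>
     if ov then 8 else of_bool (x = Some True) + 2 * of_bool (y = Some True) + 4 * of_bool (z = Some True))"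

lemma push_register_of: "push (f k) (register_of f k) = register_of f (Suc k)"
proof -
  consider "k = 0" | "k = 1" | "k = 2" | "3 \<le> k" by linarith
  then show ?thesis
  proof cases
    case 4
    then show ?thesis by (auto simp: register_of_def less_Suc_eq)
  qed (auto simp: register_of_def less_Suc_eq numeral_2_eq_2)
qed

lemma register_value_of:
  fixes m :: nat
  assumes "\<And>i. k \<le> i \<Longrightarrow> \<not> bit m i"
  shows "register_value (register_of (bit m) k) = min m 8"
proof -
  have overflow: "(\<exists>i<k. 3 \<le> i \<and> bit m i) \<longleftrightarrow> 8 \<le> m"
  proof
    assume "\<exists>i<k. 3 \<le> i \<and> bit m i"
    then obtain i where i: "3 \<le> i" "bit m i" by blast
    then have "bit (drop_bit 3 m) (i - 3)" by (simp add: bit_drop_bit_eq)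
    then have "drop_bit 3 m \<noteq> 0" by (intro notI) simp
    then show "8 \<le> m" by (simp add: drop_bit_eq_div div_eq_0_iff)
  next
    assume "8 \<le> m"
    then have "drop_bit 3 m \<noteq> 0" by (simp add: drop_bit_eq_div div_eq_0_iff)
    then obtain j where "bit (drop_bit 3 m) j" by (auto simp: bit_eq_iff)
    then have "bit m (3 + j)" by (simp add: bit_drop_bit_eq)
    then show "\<exists>i<k. 3 \<le> i \<and> bit m i" using assms[of "3 + j"]
      by (intro exI[of _ "3 + j"]) (auto simp: not_le[symmetric])
  qed
  have entry: "(if j < k then Some (bit m j) else None) = Some True \<longleftrightarrow> bit m j" for j
    using assms[of j] by auto
  have "of_bool (bit m 0) + 2 * of_bool (bit m 1) + 4 * of_bool (bit m 2) = m" if "m < 8"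
  proof -
    have "take_bit 3 m = m" using that by (simp add: take_bit_nat_eq_self_iff)
    moreover have "take_bit 3 m = of_bool (bit m 0) + 2 * of_bool (bit m 1) + 4 * of_bool (bit m 2)"
    proof -
      have "take_bit 3 m = take_bit (Suc (Suc (Suc 0))) m" by (simp only: numeral_3_eq_3)
      also have "\<dots> = of_bool (bit m 0) + 2 * of_bool (bit m (Suc 0)) + 4 * of_bool (bit m (Suc (Suc 0)))"
        by (simp add: take_bit_Suc_from_most)
      finally show ?thesis by (simp only: One_nat_def numeral_2_eq_2[symmetric])
    qed
    ultimately show ?thesis by simp
  qed
  then have "(if 8 \<le> m then 8 else of_bool (bit m 0) + 2 * of_bool (bit m 1) + 4 * of_bool (bit m 2)) =
      min m 8"
    by (cases "8 \<le> m") (simp_all only: min_def if_True if_False not_le[symmetric] not_False_eq_True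
        not_True_eq_False, auto)
  then show ?thesis
    unfolding register_value_def register_of_def prod.case overflow entry .
qed

text \<open>The numbers \<open>n\<close>, \<open>t\<close>, \<open>a\<close> and \<open>b\<close> of a query are read in parallel, least significant bit
  first. The low parts of \<open>a\<close> and \<open>b\<close>, which hold the tree nodes, end together with \<open>n\<close>. The
  components of the state are: \<open>a < n\<close>, \<open>a = b\<close>, the test whether \<open>b\<close> is \<open>a\<close> shifted by one bit,
  \<open>a \<noteq> 0\<close>, \<open>a = 1\<close>, \<open>b = 1\<close>, the last bit of \<open>a\<close>, the first bit of \<open>b\<close> (all of these for the low
  parts), \<open>n > 0\<close>, and registers for \<open>t\<close> and for the high parts of \<open>a\<close> and \<open>b\<close>.\<close>

type_synonym scanner =
  "(bool \<times> bool \<times> bool \<times> bool \<times> bool \<times> bool \<times> bool \<times> bool \<times> bool) \<times> register \<times> register \<times> register"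

definition scan_step :: "bool option \<Rightarrow> bool \<Rightarrow> bool \<Rightarrow> bool \<Rightarrow> scanner \<Rightarrow> scanner" where
  "scan_step x t a b d = (case d of ((lt, eq, sh, nz, one1, one2, prev, fst2, pos), rt, ra, rb) \<Rightarrow>
     (case x of
       Some c \<Rightarrow> ((if a = c then lt else c, eq \<and> a = b, sh \<and> (pos \<longrightarrow> b = prev), nz \<or> a,
         one1 \<and> a \<noteq> pos, one2 \<and> b \<noteq> pos, a, if pos then fst2 else b, True), push t rt, ra, rb)
     | None \<Rightarrow> ((lt, eq, sh, nz, one1, one2, prev, fst2, pos), push t rt, push a ra, push b rb)))"

text \<open>The invariant of the scan in closed form: the state after \<open>p\<close> positions.
  Comparisons of low parts stop at position \<open>L\<close>, from where the bits of
  \<open>a\<close> and \<open>b\<close> go into their registers.\<close>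

definition scanned :: "nat \<Rightarrow> nat \<Rightarrow> nat \<Rightarrow> nat \<Rightarrow> nat \<Rightarrow> nat \<Rightarrow> scanner" where
  "scanned L n t a b p = (let m = min p L in
     ((take_bit m a < take_bit m n, \<forall>i<m. bit a i = bit b i, \<forall>i<m. 0 < i \<longrightarrow> bit b i = bit a (i - 1),
       \<exists>i<m. bit a i, \<forall>i<m. bit a i \<longleftrightarrow> i = 0, \<forall>i<m. bit b i \<longleftrightarrow> i = 0,
       0 < m \<and> bit a (m - 1), 0 < m \<and> bit b 0, 0 < m),
      register_of (bit t) p, register_of (\<lambda>i. bit a (L + i)) (p - L),
      register_of (\<lambda>i. bit b (L + i)) (p - L)))"

text \<open>When the least significant bit comes first, a later difference overrides all earlier
  ones.\<close>

lemma take_bit_less_step: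
  fixes a n :: nat
  shows "take_bit (Suc p) a < take_bit (Suc p) n \<longleftrightarrow>
    (if bit a p = bit n p then take_bit p a < take_bit p n else bit n p)"
proof -
  define u v where "u = take_bit p a" and "v = take_bit p n"
  have "u < 2 ^ p" "v < 2 ^ p" by (simp_all add: u_def v_def)
  then show ?thesis by (auto simp: take_bit_Suc_from_most simp flip: u_def v_def)
qed

lemma scan_step_scanned:
  "scan_step (if p < L then Some (bit n p) else None) (bit t p) (bit a p) (bit b p)
     (scanned L n t a b p) = scanned L n t a b (Suc p)"
proof (cases "p < L")
  case True
  then have m: "min p L = p" "min (Suc p) L = Suc p" "p - L = 0" "Suc p - L = 0" by auto
  show ?thesis
    unfolding scanned_def scan_step_def m Let_def prod.case
    using True
    by (auto simp: push_register_of take_bit_less_step All_less_Suc Ex_less_Suc)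
next
  case False
  then have m: "min p L = L" "min (Suc p) L = L" "Suc p - L = Suc (p - L)" by auto
  have "L + (p - L) = p" using False by simp
  then have "push (bit a p) (register_of (\<lambda>i. bit a (L + i)) (p - L)) =
      register_of (\<lambda>i. bit a (L + i)) (Suc (p - L))" for a :: nat
    using push_register_of[of "\<lambda>i. bit a (L + i)" "p - L"] by simp
  then show ?thesis
    unfolding scanned_def scan_step_def m Let_def prod.case using False
    by (simp add: push_register_of)
qed

text \<open>In the wire test, \<open>prev\<close> is the top bit of the parent node, which tells
  whether the child is a leaf, and \<open>fst2\<close> is the last bit of the child, which tells
  first from second child. Without \<open>pos\<close>, \<open>n = 0\<close> and
  \<open>N = 1\<close>: the numbers consist of their high parts only, and the outputs are the gates
  3 and 4.\<close>

definition scan_result :: "bool \<Rightarrow> scanner \<Rightarrow> bool" where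
  "scan_result four d =
    (case d of ((lt, eq, sh, nz, one1, one2, prev, fst2, pos), rt, ra, rb) \<Rightarrow>
    (let t = register_value rt; s = register_value ra; s' = register_value rb in
     if four then
       t = 3 \<and> s = 0 \<and> lt \<and> s' = 0 \<and> eq \<or>
       t = 4 \<and> (s = 1 \<and> s' = 0 \<and> eq \<or> 2 \<le> s \<and> s < 4 \<and> nz \<and> s' div 2 = s \<and> eq \<or>
         4 \<le> s \<and> s < 8 \<and> nz \<and> sh \<and> s' = (if prev then 0 else 2) + of_bool (flag s fst2)) \<or>
       t = 5 \<and> (if pos then s = 0 \<and> (\<not> nz \<and> s' = 2 \<or> one1 \<and> s' = 3) \<and> one2
         else s = 0 \<and> s' = 3 \<or> s = 1 \<and> s' = 4)
     else t = 0 \<and> s = 1 \<or> t = 1 \<and> 4 \<le> s \<and> s < 8 \<or>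
       t = 2 \<and> (2 \<le> s \<and> s < 4 \<or> s = 0 \<and> \<not> lt)))"

section \<open>The connection language in terms of types and tree nodes\<close>

lemma direct_connections_iff:
  "n # q \<in> direct_connections C \<longleftrightarrow>
     (\<exists>g. q = [0, g] \<and> g < gates (C n) \<and> kind (C n) g = Neg) \<or>
     (\<exists>g. q = [1, g] \<and> g < gates (C n) \<and> kind (C n) g = Conj) \<or>
     (\<exists>g. q = [2, g] \<and> g < gates (C n) \<and> kind (C n) g = Disj) \<or>
     (\<exists>g i. q = [3, g, i] \<and> g < gates (C n) \<and> kind (C n) g = Input i) \<or>
     (\<exists>g h. q = [4, g, h] \<and> (g, h) \<in> wires (C n)) \<or>
     (\<exists>j g. q = [5, j, g] \<and> j < length (outs (C n)) \<and> outs (C n) ! j = g)"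
  unfolding direct_connections_def by auto

lemma direct_connections_four:
  "[n, t, a, b] \<in> direct_connections C \<longleftrightarrow>
     t = 3 \<and> (kind (C n) a = Input b \<and> a < gates (C n)) \<or>
     t = 4 \<and> (a, b) \<in> wires (C n) \<or>
     t = 5 \<and> (a < length (outs (C n)) \<and> outs (C n) ! a = b)"
  unfolding direct_connections_iff by blast

context
  fixes n N L :: nat
  assumes L: "L = bit_length n" and N: "N = 2 ^ L"
begin

lemma less_gates_iff: "g < 8 * N \<longleftrightarrow> g div N < 8"
  using N by (simp add: div_less_iff_less_mult)

lemma connection_three:
  "[n, t, g] \<in> direct_connections parity_circuit \<longleftrightarrow>
     t = 0 \<and> g div N = 1 \<or> t = 1 \<and> 4 \<le> g div N \<and> g div N < 8 \<or>
     t = 2 \<and> (2 \<le> g div N \<and> g div N < 4 \<or> g div N = 0 \<and> \<not> g mod N < n)"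
  unfolding direct_connections_iff parity_circuit_sel[OF L N] less_gates_iff tree_kind_def
  by auto

lemma connection_four:
  "[n, t, a, b] \<in> direct_connections parity_circuit \<longleftrightarrow>
     t = 3 \<and> a div N = 0 \<and> a mod N < n \<and> b div N = 0 \<and> a mod N = b mod N \<or>
     t = 4 \<and> a div N < 8 \<and> b div N < 8 \<and> tree_wire N (a div N) (a mod N) (b div N) (b mod N) \<or>
     t = 5 \<and> (a = 0 \<and> b = 2 * N + 1 \<or> a = 1 \<and> b = 3 * N + 1)"
proof -
  have "b = a mod N \<longleftrightarrow> b div N = 0 \<and> a mod N = b mod N"
    using gate_code[OF L N, of b 0 "a mod N"] N by auto
  then have "kind (parity_circuit n) a = Input b \<and> a < 8 * N \<longleftrightarrow>
      a div N = 0 \<and> a mod N < n \<and> b div N = 0 \<and> a mod N = b mod N"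
    unfolding parity_circuit_sel[OF L N] less_gates_iff tree_kind_def by auto
  moreover have "a < length [2 * N + 1, 3 * N + 1] \<and> [2 * N + 1, 3 * N + 1] ! a = b \<longleftrightarrow>
      a = 0 \<and> b = 2 * N + 1 \<or> a = 1 \<and> b = 3 * N + 1"
    by (auto simp: less_Suc_eq)
  moreover have "(a, b) \<in> wires (parity_circuit n) \<longleftrightarrow>
      a div N < 8 \<and> b div N < 8 \<and> tree_wire N (a div N) (a mod N) (b div N) (b mod N)"
    by (simp only: parity_circuit_sel(3)[OF L N] less_gates_iff)
  ultimately show ?thesis
    by (simp only: direct_connections_four parity_circuit_sel(1,4)[OF L N])
qed

text \<open>This is what allows the machine to reject every query that is too long or contains a
  number too long for its tapes.\<close>

lemma connections_bounded:
  assumes "n # q \<in> direct_connections parity_circuit"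
  shows "length q = 2 \<or> length q = 3" "k \<in> set q \<Longrightarrow> bit_length k \<le> L + 3"
proof -
  have "1 \<le> N" using N by simp
  then have N1: "0 < 8 * N" "1 < 8 * N" "2 < 8 * N" by linarith+
  show "length q = 2 \<or> length q = 3" using assms unfolding direct_connections_iff by auto
  assume k: "k \<in> set q"
  have "k < 8 * N"
  proof -
    consider t g where "q = [t, g]" | t a b where "q = [t, a, b]"
      using assms unfolding direct_connections_iff by auto
    then show ?thesis
    proof cases
      case 1
      then show ?thesis
        using assms k N1 less_gates_iff[of g] unfolding 1 connection_three
        by (elim disjE conjE) auto
    next
      case 2
      have "b < 8 * N" "a < 8 * N" "t < 8"
        using assms less_gates_iff[of a] less_gates_iff[of b] N1 unfolding 2 connection_four by auto
      moreover from this have "t < 8 * N" using \<open>1 \<le> N\<close> by linarith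
      ultimately show ?thesis using k 2 N1 by auto
    qed
  qed
  then show "bit_length k \<le> L + 3" unfolding bit_length_le_iff by (simp add: N power_add)
qed

lemma low_equal: "(\<forall>i<L. bit a i = bit b i) \<longleftrightarrow> a mod N = b mod N" for a b :: nat
proof -
  have "a mod N = b mod N \<longleftrightarrow> take_bit L a = take_bit L b" by (simp add: take_bit_eq_mod N)
  also have "\<dots> \<longleftrightarrow> (\<forall>i<L. bit a i = bit b i)" by (auto simp: bit_eq_iff bit_take_bit_iff)
  finally show ?thesis by simp
qed

lemma low_nonzero: "(\<exists>i<L. bit a i) \<longleftrightarrow> 0 < a mod N" for a :: nat
  using low_equal[of a 0] by auto

lemma low_one: "0 < L \<Longrightarrow> (\<forall>i<L. bit a i \<longleftrightarrow> i = 0) \<longleftrightarrow> a mod N = 1" for a :: nat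
  using low_equal[of a 1] by (simp add: bit_Suc_0_iff N)

text \<open>The shift test leaves bit 0 of \<open>b\<close> free: it is the choice between the two
  children.\<close>

lemma low_shift:
  fixes a b :: nat
  assumes "0 < L"
  shows "(\<forall>i<L. 0 < i \<longrightarrow> bit b i = bit a (i - 1)) \<longleftrightarrow>
    b mod N = (2 * (a mod N) + of_bool (bit b 0)) mod N"
proof -
  define c where "c = bit b 0"
  have "bit (2 * a + of_bool c) i \<longleftrightarrow> (if i = 0 then c else bit a (i - 1))" for i
    by (cases i; cases c) (simp_all add: bit_0 bit_Suc)
  then have "(0 < i \<longrightarrow> bit b i = bit a (i - 1)) \<longleftrightarrow> bit b i = bit (2 * a + of_bool c) i" for i
    by (cases "i = 0") (simp_all add: c_def)
  then have "(\<forall>i<L. 0 < i \<longrightarrow> bit b i = bit a (i - 1)) \<longleftrightarrow> b mod N = (2 * a + of_bool c) mod N"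
    unfolding low_equal[symmetric] by blast
  also have "(2 * a + of_bool c) mod N = (2 * (a mod N) + of_bool c) mod N"
    by (metis mod_add_left_eq mod_mult_right_eq)
  finally show ?thesis unfolding c_def .
qed

lemma top_bit:
  assumes "0 < L"
  shows "2 * (a mod N) + of_bool c < N \<longleftrightarrow> \<not> bit a (L - 1)"
proof -
  obtain l where l: "L = Suc l" using assms by (cases L) auto
  define u where "u = take_bit l a"
  have "a mod N = 2 ^ l * of_bool (bit a l) + u"
    unfolding u_def N l by (simp only: take_bit_eq_mod[symmetric] take_bit_Suc_from_most)
  moreover have "u < 2 ^ l" by (simp add: u_def)
  ultimately show ?thesis by (auto simp: N l)
qed

text \<open>\<open>N\<close> is even as soon as there is an inner node, so reduction modulo
  \<open>N\<close> keeps the last bit, and the bit under the existential quantifier can be recovered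
  from \<open>w'\<close>.\<close>

lemma wire_shift:
  assumes "0 < w" "w < N" "4 \<le> s"
  shows "tree_wire N s w s' w' \<longleftrightarrow> s < 8 \<and> w' = (2 * w + of_bool (odd w')) mod N \<and>
    s' = (if 2 * w + of_bool (odd w') < N then 2 else 0) + of_bool (flag s (odd w'))"
proof -
  have "even N"
  proof -
    have "L \<noteq> 0" using assms(1,2) N by (metis less_one not_less_zero power_0 not_gr_zero)
    then show ?thesis by (simp add: N)
  qed
  then have last: "odd ((2 * w + of_bool b) mod N) = b" for b
    by (simp add: dvd_mod_iff)
  have "(\<exists>b. w' = (2 * w + of_bool b) mod N \<and> P b) \<longleftrightarrow>
      w' = (2 * w + of_bool (odd w')) mod N \<and> P (odd w')" (is "?l \<longleftrightarrow> ?r") for P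
  proof
    assume ?l
    then obtain b where b: "w' = (2 * w + of_bool b) mod N" "P b" by (elim exE conjE)
    have "odd w' = b" unfolding b(1) by (rule last)
    with b show ?r by simp
  next
    assume ?r
    then show ?l by (intro exI)
  qed
  moreover have "s \<noteq> 1" "\<not> s < 4" using assms(3) by auto
  ultimately show ?thesis using assms by (simp only: tree_wire_def simp_thms)
qed

lemma scan_result_correct:
  assumes "\<And>i. p \<le> i \<Longrightarrow> \<not> bit t i" "\<And>i. p \<le> i \<Longrightarrow> \<not> bit a i" "\<And>i. p \<le> i \<Longrightarrow> \<not> bit b i"
    and "L \<le> p"
  shows "scan_result four (scanned L n t a b p) \<longleftrightarrow>
    (if four then [n, t, a, b] else [n, t, a]) \<in> direct_connections parity_circuit"
proof -
  have m: "min p L = L" using assms(4) by simp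
  have n: "take_bit L n = n"
    using less_bit_length[of n] by (simp add: take_bit_nat_eq_self_iff L)
  have high: "register_value (register_of (\<lambda>i. bit k (L + i)) (p - L)) = min (k div N) 8"
    if "\<And>i. p \<le> i \<Longrightarrow> \<not> bit k i" for k :: nat
  proof -
    have "(\<lambda>i. bit k (L + i)) = bit (drop_bit L k)" by (auto simp: bit_drop_bit_eq)
    moreover have "register_value (register_of (bit (drop_bit L k)) (p - L)) = min (drop_bit L k) 8"
      using that by (intro register_value_of) (auto simp: bit_drop_bit_eq)
    ultimately show ?thesis by (simp add: drop_bit_eq_div N)
  qed
  have low: "take_bit L a = a mod N" by (simp add: take_bit_eq_mod N)
  have vals: "register_value (register_of (bit t) p) = min t 8"
    "register_value (register_of (\<lambda>i. bit a (L + i)) (p - L)) = min (a div N) 8"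
    "register_value (register_of (\<lambda>i. bit b (L + i)) (p - L)) = min (b div N) 8"
    using assms(1-3) by (simp_all add: register_value_of high)
  \<comment> \<open>Comparisons with these small constants do not notice the cut-off of the
    registers at 8.\<close>
  have min8: "min k 8 = 0 \<longleftrightarrow> k = 0" "min k 8 = 1 \<longleftrightarrow> k = 1" "min k 8 = 2 \<longleftrightarrow> k = 2"
    "min k 8 = 3 \<longleftrightarrow> k = 3" "min k 8 = 4 \<longleftrightarrow> k = 4" "min k 8 = 5 \<longleftrightarrow> k = 5"
    "2 \<le> min k 8 \<longleftrightarrow> 2 \<le> k" "min k 8 < 4 \<longleftrightarrow> k < 4" "4 \<le> min k 8 \<longleftrightarrow> 4 \<le> k"
    "min k 8 < 8 \<longleftrightarrow> k < 8" for k :: nat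
    by (auto simp: min_def)
  show ?thesis
  proof (cases four)
    case False
    then show ?thesis
      unfolding scanned_def m Let_def scan_result_def prod.case vals n low min8
      by (simp only: if_False connection_three)
  next
    case True
    define s where "s = a div N"
    define w where "w = a mod N"
    define s' where "s' = b div N"
    define w' where "w' = b mod N"
    have w: "w < N" using N by (simp add: w_def)
    have wire: "4 \<le> s \<and> s < 8 \<and> (\<exists>i<L. bit a i) \<and> (\<forall>i<L. 0 < i \<longrightarrow> bit b i = bit a (i - 1)) \<and>
        s' = (if 0 < L \<and> bit a (L - 1) then 0 else 2) + of_bool (flag s (0 < L \<and> bit b 0)) \<longleftrightarrow>
        4 \<le> s \<and> s < 8 \<and> s' < 8 \<and> tree_wire N s w s' w'"
    proof (cases "4 \<le> s \<and> 0 < w")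
      case True
      then have L0: "0 < L" using w N by (cases L) auto
      then have last: "odd w' = bit b 0"
        by (simp add: w'_def N bit_0 dvd_mod_iff)
      define c where "c = bit b 0"
      define X :: nat where "X = (if bit a (L - 1) then 0 else 2) + of_bool (flag s c)"
      have target: "(if 2 * w + of_bool c < N then 2 else 0) + of_bool (flag s c) = X"
        unfolding X_def w_def using top_bit[OF L0, of a c] by (cases "bit a (L - 1)") simp_all
      have "tree_wire N s w s' w' \<longleftrightarrow> s < 8 \<and> w' = (2 * w + of_bool c) mod N \<and> s' = X"
        using True wire_shift[OF _ w, of s s' w'] unfolding last c_def[symmetric] target by blast
      moreover have "X < 8" by (simp add: X_def)
      moreover have "(\<forall>i<L. 0 < i \<longrightarrow> bit b i = bit a (i - 1)) \<longleftrightarrow> w' = (2 * w + of_bool c) mod N"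
        unfolding w_def w'_def c_def by (rule low_shift[OF L0])
      moreover have "(\<exists>i<L. bit a i)" using True by (simp only: low_nonzero w_def)
      ultimately show ?thesis
        using True unfolding X_def c_def by (simp only: L0 simp_thms) metis
    next
      case False
      then show ?thesis
        unfolding low_nonzero w_def[symmetric] by (auto simp: tree_wire_def)
    qed
    have outs: "(if 0 < L then s = 0 \<and> (\<not> 0 < w \<and> s' = 2 \<or> w = 1 \<and> s' = 3) \<and> w' = 1
        else s = 0 \<and> s' = 3 \<or> s = 1 \<and> s' = 4) \<longleftrightarrow> a = 0 \<and> b = 2 * N + 1 \<or> a = 1 \<and> b = 3 * N + 1"
    proof -
      have code: "k = c * N + e \<longleftrightarrow> k div N = c \<and> k mod N = e" if "e < N" for k c e
        using that gate_code[OF L N, of k c e] by auto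
      show ?thesis
      proof (cases "L = 0")
        case True
        then show ?thesis by (simp add: N s_def w_def s'_def w'_def)
      next
        case False
        then have "1 < N" unfolding N by (intro one_less_power) simp_all
        then have "a = 0 \<longleftrightarrow> s = 0 \<and> w = 0" "a = 1 \<longleftrightarrow> s = 0 \<and> w = 1"
          "b = 2 * N + 1 \<longleftrightarrow> s' = 2 \<and> w' = 1" "b = 3 * N + 1 \<longleftrightarrow> s' = 3 \<and> w' = 1"
          using code[of 0 a 0] code[of 1 a 0] code[of 1 b 2] code[of 1 b 3]
          unfolding s_def w_def s'_def w'_def by simp_all
        moreover have "0 < L" using False by simp
        ultimately show ?thesis by (simp only: if_True not_gr_zero) blast
      qed
    qed
    have ones: "0 < L \<Longrightarrow> (\<forall>i<L. bit a i \<longleftrightarrow> i = 0) \<longleftrightarrow> w = 1"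
      "0 < L \<Longrightarrow> (\<forall>i<L. bit b i \<longleftrightarrow> i = 0) \<longleftrightarrow> w' = 1"
      by (simp_all add: low_one w_def w'_def)
    have wires: "s < 8 \<and> s' < 8 \<and> tree_wire N s w s' w' \<longleftrightarrow>
        s = 1 \<and> s' = 0 \<and> w = w' \<or> 2 \<le> s \<and> s < 4 \<and> 0 < w \<and> s' div 2 = s \<and> w = w' \<or>
        4 \<le> s \<and> s < 8 \<and> (\<exists>i<L. bit a i) \<and> (\<forall>i<L. 0 < i \<longrightarrow> bit b i = bit a (i - 1)) \<and>
        s' = (if 0 < L \<and> bit a (L - 1) then 0 else 2) + of_bool (flag s (0 < L \<and> bit b 0))"
    proof (cases "4 \<le> s")
      case True
      then show ?thesis using wire by (simp only: simp_thms) linarith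
    next
      case False
      then show ?thesis unfolding tree_wire_def by (simp only: simp_thms) (auto simp: div_eq_0_iff)
    qed
    \<comment> \<open>A number cut off to 8 has half 4, which differs from every \<open>s\<close>
      below 4, just as the half of the original number does.\<close>
    have div2: "2 \<le> s \<and> s < 4 \<and> A \<and> min s' 8 div 2 = min s 8 \<and> B \<longleftrightarrow>
        2 \<le> s \<and> s < 4 \<and> A \<and> s' div 2 = s \<and> B" for A B
      by (auto simp: min_def)
    have target: "4 \<le> s \<and> s < 8 \<and> A \<and> B \<and> min s' 8 = (if D then 0 else 2) + of_bool (flag (min s 8) F) \<longleftrightarrow>
        4 \<le> s \<and> s < 8 \<and> A \<and> B \<and> s' = (if D then 0 else 2) + of_bool (flag s F)" for A B D F
      by (auto simp: min_def)
    have "scan_result four (scanned L n t a b p) \<longleftrightarrow>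
        t = 3 \<and> s = 0 \<and> w < n \<and> s' = 0 \<and> w = w' \<or>
        t = 4 \<and> (s < 8 \<and> s' < 8 \<and> tree_wire N s w s' w') \<or>
        t = 5 \<and> (if 0 < L then s = 0 \<and> (\<not> 0 < w \<and> s' = 2 \<or> w = 1 \<and> s' = 3) \<and> w' = 1
        else s = 0 \<and> s' = 3 \<or> s = 1 \<and> s' = 4)"
      unfolding wires scanned_def m Let_def scan_result_def prod.case vals n low low_equal
        s_def[symmetric] s'_def[symmetric] w_def[symmetric] w'_def[symmetric] min8 div2 target
      using True ones low_nonzero[of a, folded w_def]
      by (cases "0 < L") (simp_all only: if_True if_False simp_thms)
    then show ?thesis
      unfolding outs
      unfolding connection_four if_P[OF True] s_def w_def s'_def w'_def .
  qed
qed

end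

section \<open>The checking machine\<close>

datatype tape = Question | First | Second

datatype checker_state = Margin1 | Margin2 | Margin3 | Read_Index | Read tape | Probe | Read_End
  | Scanning bool scanner | Accepted | Rejected

lemma UNIV_tape: "UNIV = {Question, First, Second}"
  using tape.exhaust by blast

instance tape :: finite
  by standard (simp add: UNIV_tape)

lemma UNIV_checker_state:
  "UNIV = {Margin1, Margin2, Margin3, Read_Index, Probe, Read_End, Accepted, Rejected} \<union>
    range Read \<union> range (\<lambda>(four, d). Scanning four d)"
proof -
  have "q \<in> {Margin1, Margin2, Margin3, Read_Index, Probe, Read_End, Accepted, Rejected} \<union>
    range Read \<union> range (\<lambda>(four, d). Scanning four d)" for q
    by (cases q) auto
  then show ?thesis by blast
qed

instance checker_state :: finite
  by standard (simp add: UNIV_checker_state)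

fun tape_index :: "tape \<Rightarrow> nat" where
  "tape_index Question = 1" | "tape_index First = 2" | "tape_index Second = 3"

text \<open>A query has two or three numbers after the index. \<open>Probe\<close> finds out which,
  looking at the next symbol without consuming it.\<close>

fun after_tape :: "tape \<Rightarrow> checker_state" where
  "after_tape Question = Read First" | "after_tape First = Probe" | "after_tape Second = Read_End"

text \<open>On the work tapes, \<open>0\<close> is the blank, \<open>1\<close> marks the leftmost cell, and \<open>2\<close> and \<open>3\<close> are the
  bits.\<close>

definition bit_symbol :: "bool \<Rightarrow> nat" where
  "bit_symbol b = (if b then 3 else 2)"

definition keep :: "nat list \<Rightarrow> (nat \<times> move) list" where
  "keep ws = map (\<lambda>w. (w, Stay)) ws"

definition scanner_start :: scanner where
  "scanner_start = ((False, True, True, False, True, True, False, False, False),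
     (None, None, None, False), (None, None, None, False), (None, None, None, False))"

text \<open>The index \<open>n\<close> is written from left to right on tape \<open>0\<close>, while the heads of the other tapes
  move to cell \<open>bit_length n + 3\<close>. From there the further numbers are written from right to left,
  so that the left end bounds their lengths. The scan then reads all four tapes in parallel from
  the least significant bits on, moving left on tape \<open>0\<close> and right on the others.\<close>

fun checker :: "(checker_state, bool option) program" where
  "checker Margin1 x _ ws = (Margin2, Stay, False,
     [(1, Move_Right), (1, Move_Right), (1, Move_Right), (1, Move_Right)], None)"
| "checker Margin2 x _ ws = (Margin3, Stay, False,
     (keep ws)[1 := (ws ! 1, Move_Right), 2 := (ws ! 2, Move_Right), 3 := (ws ! 3, Move_Right)], None)"
| "checker Margin3 x _ ws = (Read_Index, Move_Right, False,
     (keep ws)[1 := (ws ! 1, Move_Right), 2 := (ws ! 2, Move_Right), 3 := (ws ! 3, Move_Right)], None)"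
| "checker Read_Index (Symbol (Some b)) _ ws = (Read_Index, Move_Right, False,
     [(bit_symbol b, Move_Right), (ws ! 1, Move_Right), (ws ! 2, Move_Right), (ws ! 3, Move_Right)], None)"
| "checker Read_Index (Symbol None) _ ws =
     (Read Question, Move_Right, False, (keep ws)[0 := (ws ! 0, Move_Left)], None)"
| "checker (Read j) (Symbol (Some b)) _ ws =
     (if ws ! tape_index j = 1 then (Rejected, Stay, False, keep ws, None)
     else (Read j, Move_Right, False, (keep ws)[tape_index j := (bit_symbol b, Move_Left)], None))"
| "checker (Read j) (Symbol None) _ ws =
     (after_tape j, Move_Right, False, (keep ws)[tape_index j := (ws ! tape_index j, Move_Right)], None)"
| "checker Probe Right_End _ ws = (Scanning False scanner_start, Stay, False, keep ws, None)"
| "checker Probe _ _ ws = (Read Second, Stay, False, keep ws, None)"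
| "checker Read_End Right_End _ ws = (Scanning True scanner_start, Stay, False, keep ws, None)"
| "checker (Scanning four d) _ _ ws = (if ws ! 0 = 1 \<and> ws ! 1 = 0 \<and> ws ! 2 = 0 \<and> ws ! 3 = 0
     then (if scan_result four d then Accepted else Rejected, Stay, False, keep ws, None)
     else (Scanning four (scan_step (if ws ! 0 = 1 then None else Some (ws ! 0 = 3))
         (ws ! 1 = 3) (ws ! 2 = 3) (ws ! 3 = 3) d), Stay, False,
       [(ws ! 0, if ws ! 0 = 1 then Stay else Move_Left), (ws ! 1, Move_Right), (ws ! 2, Move_Right),
        (ws ! 3, Move_Right)], None))"
| "checker _ _ _ ws = (Rejected, Stay, False, keep ws, None)"

definition checker_tm :: "bool option aux_tm" where
  "checker_tm = tm_of {0, 1, 2, 3} 4 Margin1 Accepted Rejected checker"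

lemma length_keep [simp]: "length (keep ws) = length ws"
  by (simp add: keep_def)

lemma wf_checker_tm: "wf_tm checker_tm"
  unfolding checker_tm_def
proof (rule wf_tm_of)
  fix q x b and ws :: "nat list"
  assume ws: "length ws = 4" "set ws \<subseteq> {0, 1, 2, 3}"
  have keep: "fst ` set (keep ws) \<subseteq> {0, 1, 2, 3}"
    using ws(2) unfolding keep_def by auto
  have nth: "ws ! i \<in> {0, 1, 2, 3}" if "i < 4" for i
    using that ws nth_mem by (metis subset_iff)
  have upd: "fst ` set (zs[i := (s, mv)]) \<subseteq> {0, 1, 2, 3}"
    if "fst ` set zs \<subseteq> {0, 1, 2, 3}" "s \<in> {0, 1, 2, 3}" for zs :: "(nat \<times> move) list" and i s mv
    using that set_update_subset_insert[of zs i "(s, mv)"] by (auto simp: image_subset_iff dest!: subsetD)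
  have sym: "bit_symbol c \<in> {0, 1, 2, 3}" for c by (simp add: bit_symbol_def)
  have idx: "tape_index j < 4" for j by (cases j) auto
  show "length (fst (snd (snd (snd (checker q x b ws))))) = 4 \<and>
      fst ` set (fst (snd (snd (snd (checker q x b ws))))) \<subseteq> {0, 1, 2, 3}"
  proof (cases "(q, x, b, ws)" rule: checker.cases)
    case 1 then show ?thesis by auto
  next case 2 then show ?thesis using ws keep nth upd by simp
  next case 3 then show ?thesis using ws keep nth upd by simp
  next case (4 c) then show ?thesis using sym[of c] nth[of 1] nth[of 2] nth[of 3] by simp
  next case 5 then show ?thesis using ws keep nth upd by simp
  next case (6 j c) then show ?thesis using ws keep sym[of c] upd by simp
  next case (7 j) then show ?thesis using ws keep nth[OF idx[of j]] upd by simp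
  qed (use ws keep nth[of 0] nth[of 1] nth[of 2] nth[of 3] in \<open>simp_all\<close>)
qed auto

lemma step_checker:
  assumes "q \<noteq> Accepted" "q \<noteq> Rejected"
  shows "step checker_tm x y (conf q p ap ws out) =
    (case checker q (input_symbol x p) (aux_symbol y ap) (map (\<lambda>(p, t). t p) ws) of
      (q', im, adv, acts, em) \<Rightarrow>
        conf q' (min (length x + 1) (move_head im p)) (if adv then ap + 1 else ap)
          (map2 (\<lambda>(p, t) (s, mv). (move_head mv p, t(p := s))) ws acts)
          (out @ (case em of None \<Rightarrow> [] | Some b \<Rightarrow> [b])))"
  unfolding checker_tm_def by (rule step_tm_of[OF assms])

section \<open>Runs of the checking machine\<close>

abbreviation update_tapes :: "(nat \<times> (nat \<Rightarrow> nat)) list \<Rightarrow> (nat \<times> move) list \<Rightarrow> (nat \<times> (nat \<Rightarrow> nat)) list" where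
  "update_tapes ws acts \<equiv> map2 (\<lambda>(p, t) (s, mv). (move_head mv p, t(p := s))) ws acts"

lemma update_tapes_keep: "update_tapes ws (keep (map (\<lambda>(p, t). t p) ws)) = ws"
  by (induction ws) (auto simp: keep_def)

lemma update_tapes_update:
  assumes "j < length ws" "ws ! j = (h, f)"
  shows "update_tapes ws ((keep (map (\<lambda>(p, t). t p) ws))[j := (s, mv)]) = ws[j := (move_head mv h, f(h := s))]"
proof (rule nth_equalityI)
  fix i assume "i < length (update_tapes ws ((keep (map (\<lambda>(p, t). t p) ws))[j := (s, mv)]))"
  then have i: "i < length ws" by simp
  obtain h' f' where "ws ! i = (h', f')" by (cases "ws ! i")
  then show "update_tapes ws ((keep (map (\<lambda>(p, t). t p) ws))[j := (s, mv)]) ! i = ws[j := (move_head mv h, f(h := s))] ! i"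
    using i assms by (cases "i = j") (auto simp: keep_def nth_list_update)
qed simp

lemma input_symbol_drop:
  "drop p x = [] \<Longrightarrow> input_symbol x (Suc p) = Right_End"
  "drop p x = z # zs \<Longrightarrow> input_symbol x (Suc p) = Symbol z"
proof -
  show "drop p x = [] \<Longrightarrow> input_symbol x (Suc p) = Right_End"
    by (simp add: input_symbol_def)
  assume z: "drop p x = z # zs"
  then have "p < length x" by (metis drop_all list.distinct(1) not_le)
  moreover have "x ! p = z" using z \<open>p < length x\<close> by (metis Cons_nth_drop_Suc list.inject)
  ultimately show "input_symbol x (Suc p) = Symbol z" by (simp add: input_symbol_def)
qed

lemma drop_Cons:
  assumes "drop p x = z # zs"
  shows "drop (Suc p) x = zs" "p < length x"
  using assms by (metis drop_Suc tl_drop list.sel(3), metis drop_all list.distinct(1) not_le)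

text \<open>Made for reasoning backwards: each phase of a run gets a lemma whose assumption is that
  the rest of the run ends with verdict \<open>v\<close>, and the time bounds add up.\<close>

definition ends :: "bool option list \<Rightarrow> config \<Rightarrow> bool \<Rightarrow> nat \<Rightarrow> bool" where
  "ends x c v T \<longleftrightarrow> (\<exists>t\<le>T. state ((step checker_tm x [] ^^ t) c) = to_nat (if v then Accepted else Rejected))"

lemma ends_now: "ends x (conf (if v then Accepted else Rejected) p ap ws out) v 0"
  by (simp add: ends_def)

lemma ends_rejected: "ends x (conf Rejected p ap ws out) False 0"
  using ends_now[of x False] by simp

lemma ends_mono: "ends x c v T \<Longrightarrow> T \<le> T' \<Longrightarrow> ends x c v T'"
  unfolding ends_def using le_trans by blast

lemma ends_step: "ends x (step checker_tm x [] c) v T \<Longrightarrow> ends x c v (Suc T)"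
  unfolding ends_def by (auto intro!: exI[of _ "Suc _"] simp: funpow_swap1)

fun write_right :: "(nat \<Rightarrow> nat) \<Rightarrow> nat \<Rightarrow> bool list \<Rightarrow> nat \<Rightarrow> nat" where
  "write_right f h [] = f"
| "write_right f h (b # bs) = write_right (f(h := bit_symbol b)) (Suc h) bs"

fun write_left :: "(nat \<Rightarrow> nat) \<Rightarrow> nat \<Rightarrow> bool list \<Rightarrow> nat \<Rightarrow> nat" where
  "write_left f h [] = f"
| "write_left f h (b # bs) = write_left (f(h := bit_symbol b)) (h - 1) bs"

lemma write_right_nth:
  "write_right f h bs c = (if h \<le> c \<and> c < h + length bs then bit_symbol (bs ! (c - h)) else f c)"
proof (induction bs arbitrary: f h)
  case (Cons b bs)
  show ?case
  proof (cases "c = h")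
    case False
    then show ?thesis
      by (cases "h < c") (auto simp: Cons.IH nth_Cons' Suc_le_eq)
  next
    case True
    show ?thesis by (simp only: write_right.simps Cons.IH) (simp add: True)
  qed
qed simp

lemma write_left_nth:
  "length bs \<le> h \<Longrightarrow>
   write_left f h bs c = (if h < c + length bs \<and> c \<le> h then bit_symbol (bs ! (h - c)) else f c)"
proof (induction bs arbitrary: f h)
  case (Cons b bs)
  have h: "0 < h" "length bs \<le> h - 1" using Cons.prems by auto
  show ?case
  proof (cases "c = h")
    case True
    have "\<not> h \<le> h - 1" using h(1) by arith
    then show ?thesis by (simp only: write_left.simps Cons.IH[OF h(2)]) (simp add: True)
  next
    case False
    then show ?thesis
      using h by (simp only: write_left.simps Cons.IH[OF h(2)]) (auto simp: nth_Cons')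
  qed
qed simp

text \<open>The moving heads of the other tapes measure out the length of the index in unary. At the
  separator, head 0 steps back onto the least significant bit, hence the \<open>- 1\<close>.\<close>

lemma read_index:
  assumes "drop p x = map Some bs @ None # rest"
    "ends x (conf (Read Question) (Suc (p + length bs + 1)) 0
       [(h + length bs - 1, write_right f h bs), (h' + length bs, g), (h' + length bs, g), (h' + length bs, g)] []) v T"
  shows "ends x (conf Read_Index (Suc p) 0 [(h, f), (h', g), (h', g), (h', g)] []) v (T + length bs + 1)"
  using assms
proof (induction bs arbitrary: p h h' f)
  case Nil
  note d = drop_Cons[OF Nil(1)[simplified]]
  have "step checker_tm x [] (conf Read_Index (Suc p) 0 [(h, f), (h', g), (h', g), (h', g)] []) =
      conf (Read Question) (Suc (Suc p)) 0 [(h - 1, f), (h', g), (h', g), (h', g)] []"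
    using d by (simp add: step_checker input_symbol_drop(2)[OF Nil(1)[simplified]] keep_def)
  then show ?case using ends_step Nil(2) by simp
next
  case (Cons b bs)
  note d = drop_Cons[OF Cons.prems(1)[simplified]]
  have "step checker_tm x [] (conf Read_Index (Suc p) 0 [(h, f), (h', g), (h', g), (h', g)] []) =
      conf Read_Index (Suc (Suc p)) 0 [(Suc h, f(h := bit_symbol b)), (Suc h', g), (Suc h', g), (Suc h', g)] []"
    using d by (simp add: step_checker input_symbol_drop(2)[OF Cons.prems(1)[simplified]])
  moreover have "ends x (conf Read_Index (Suc (Suc p)) 0
      [(Suc h, f(h := bit_symbol b)), (Suc h', g), (Suc h', g), (Suc h', g)] []) v (T + length bs + 1)"
    by (rule Cons.IH[where f = "f(h := bit_symbol b)" and h = "Suc h"])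
      (use d(1) Cons.prems(2) in \<open>simp_all del: fun_upd_apply\<close>)
  ultimately show ?case using ends_step by simp
qed

text \<open>Writing leftwards puts the least significant bit leftmost; the step to the right at the
  separator places the head on it, ready for the scan.\<close>

lemma read_number:
  assumes "drop p x = map Some bs @ None # rest" "length ws = 4" "ws ! tape_index j = (h, f)"
    "f 0 = 1" "\<And>c. 0 < c \<Longrightarrow> c \<le> h \<Longrightarrow> f c \<noteq> 1" "length bs \<le> h"
    "ends x (conf (after_tape j) (Suc (p + length bs + 1)) 0
       (ws[tape_index j := (Suc (h - length bs), write_left f h bs)]) []) v T"
  shows "ends x (conf (Read j) (Suc p) 0 ws []) v (T + length bs + 1)"
  using assms
proof (induction bs arbitrary: p h f ws)
  case Nil
  have idx: "tape_index j < length ws" using Nil.prems(2) by (cases j) auto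
  note d = drop_Cons[OF Nil(1)[simplified]]
  have "step checker_tm x [] (conf (Read j) (Suc p) 0 ws []) =
      conf (after_tape j) (Suc (Suc p)) 0 (ws[tape_index j := (Suc h, f)]) []"
    using d idx Nil.prems(3)
    by (simp add: step_checker input_symbol_drop(2)[OF Nil(1)[simplified]] update_tapes_update)
  then show ?case using ends_step Nil.prems(7) by simp
next
  case (Cons b bs)
  have idx: "tape_index j < length ws" using Cons.prems(2) by (cases j) auto
  note d = drop_Cons[OF Cons.prems(1)[simplified]]
  have h: "0 < h" using Cons.prems(6) by auto
  have "step checker_tm x [] (conf (Read j) (Suc p) 0 ws []) =
      conf (Read j) (Suc (Suc p)) 0 (ws[tape_index j := (h - 1, f(h := bit_symbol b))]) []"
    using d idx h Cons.prems(3,5)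
    by (simp add: step_checker input_symbol_drop(2)[OF Cons.prems(1)[simplified]] update_tapes_update)
  moreover have "ends x (conf (Read j) (Suc (Suc p)) 0
      (ws[tape_index j := (h - 1, f(h := bit_symbol b))]) []) v (T + length bs + 1)"
  proof (rule Cons.IH)
    show "ws[tape_index j := (h - 1, f(h := bit_symbol b))] ! tape_index j = (h - 1, f(h := bit_symbol b))"
      using idx by simp
    show "ends x (conf (after_tape j) (Suc (Suc p + length bs + 1)) 0
       ((ws[tape_index j := (h - 1, f(h := bit_symbol b))])[tape_index j :=
         (Suc (h - 1 - length bs), write_left (f(h := bit_symbol b)) (h - 1) bs)]) []) v T"
      using Cons.prems(7) h by simp
  qed (use Cons.prems d(1) h in \<open>auto simp: bit_symbol_def\<close>)
  ultimately show ?case using ends_step by simp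
qed

text \<open>The marker in cell 0 is met after at most \<open>h\<close> written bits. The time
  depends on \<open>h\<close> alone and not on the query, whose length has no bound in terms of
  \<open>n\<close>.\<close>

lemma read_number_overflow:
  assumes "drop p x = map Some bs @ rest" "length ws = 4" "ws ! tape_index j = (h, f)"
    "f 0 = 1" "h < length bs"
  shows "ends x (conf (Read j) (Suc p) 0 ws []) False (Suc h)"
  using assms
proof (induction bs arbitrary: p h f ws)
  case (Cons b bs)
  have idx: "tape_index j < length ws" using Cons.prems(2) by (cases j) auto
  note d = drop_Cons[OF Cons.prems(1)[simplified]]
  show ?case
  proof (cases "f h = 1")
    case True
    have "step checker_tm x [] (conf (Read j) (Suc p) 0 ws []) = conf Rejected (Suc p) 0 ws []"
      using d idx True Cons.prems(3)
      by (simp add: step_checker input_symbol_drop(2)[OF Cons.prems(1)[simplified]] update_tapes_keep)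
    then have "ends x (conf (Read j) (Suc p) 0 ws []) False (Suc 0)"
      by - (rule ends_step, simp add: ends_rejected)
    then show ?thesis by (rule ends_mono) simp
  next
    case False
    then have h: "0 < h" using Cons.prems(4) by (cases h) auto
    have "step checker_tm x [] (conf (Read j) (Suc p) 0 ws []) =
        conf (Read j) (Suc (Suc p)) 0 (ws[tape_index j := (h - 1, f(h := bit_symbol b))]) []"
      using d idx False Cons.prems(3)
      by (simp add: step_checker input_symbol_drop(2)[OF Cons.prems(1)[simplified]] update_tapes_update)
    moreover have "ends x (conf (Read j) (Suc (Suc p)) 0
        (ws[tape_index j := (h - 1, f(h := bit_symbol b))]) []) False (Suc (h - 1))"
      using Cons.prems h d(1) idx by (intro Cons.IH[where f = "f(h := bit_symbol b)"]) auto
    ultimately show ?thesis using ends_step h by simp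
  qed
qed simp

lemma read_rejects:
  assumes "drop p x = []"
  shows "ends x (conf (Read j) (Suc p) 0 ws []) False 1"
proof -
  have "step checker_tm x [] (conf (Read j) (Suc p) 0 ws []) =
      conf Rejected (min (Suc (length x)) (Suc p)) 0 ws []"
    using assms by (simp add: step_checker input_symbol_drop(1) update_tapes_keep)
  then show ?thesis
    using ends_step[of x "conf (Read j) (Suc p) 0 ws []" False 0] by (simp add: ends_rejected)
qed

lemma drop_number:
  assumes "drop p x = map Some bs @ None # rest"
  shows "drop (p + length bs + 1) x = rest" "p + length bs + 1 \<le> length x"
proof -
  have "drop (length bs + 1) (drop p x) = rest" unfolding assms by simp
  then show "drop (p + length bs + 1) x = rest" by (simp add: add.commute add.left_commute)
  have "length (drop p x) = length bs + 1 + length rest" unfolding assms by simp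
  then show "p + length bs + 1 \<le> length x" by simp
qed

lemma not_bit_bit_length: "bit_length k \<le> i \<Longrightarrow> \<not> bit k i"
  by (simp add: bit_length_le_iff bit_iff_odd)

lemma bin_nth: "i < bit_length k \<Longrightarrow> bin k ! (bit_length k - Suc i) = bit k i"
proof (induction k arbitrary: i rule: less_induct)
  case (less k)
  then have "0 < k" by (cases k) auto
  then have k: "bin k = bin (k div 2) @ [odd k]" by (rule bin_pos)
  show ?case
  proof (cases i)
    case 0
    then show ?thesis by (simp add: k bit_0)
  next
    case (Suc j)
    then have j: "j < bit_length (k div 2)" using less.prems by (simp add: k)
    then have "bit_length (k div 2) - Suc j < bit_length (k div 2)" by simp
    then show ?thesis
      using less.IH[of "k div 2" j] j \<open>0 < k\<close> Suc by (simp add: k nth_append bit_Suc)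
  qed
qed

text \<open>The least significant bit lies under the head, and blanks follow the top bit, so reading
  further yields zeros and the end can be noticed.\<close>

definition tape_holds :: "(nat \<Rightarrow> nat) \<Rightarrow> nat \<Rightarrow> nat \<Rightarrow> bool" where
  "tape_holds f h k \<longleftrightarrow> (\<forall>i. f (h + i) = (if i < bit_length k then bit_symbol (bit k i) else 0))"

definition blank_tape :: "nat \<Rightarrow> nat" where
  "blank_tape = (\<lambda>_. 0)(0 := 1)"

text \<open>\<open>bin 0\<close> is empty, so in a query with two numbers the blank third tape
  serves as the number 0.\<close>

lemma blank_tape_holds_0: "0 < h \<Longrightarrow> tape_holds blank_tape h 0"
  by (simp add: tape_holds_def blank_tape_def)

lemma write_left_holds:
  assumes "bit_length k \<le> h"
  shows "tape_holds (write_left blank_tape h (bin k)) (Suc (h - bit_length k)) k"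
  unfolding tape_holds_def
proof
  fix i
  show "write_left blank_tape h (bin k) (Suc (h - bit_length k) + i) =
      (if i < bit_length k then bit_symbol (bit k i) else 0)"
  proof (cases "i < bit_length k")
    case True
    then have cond: "h < Suc (h - bit_length k) + i + bit_length k \<and> Suc (h - bit_length k) + i \<le> h"
      and "h - (Suc (h - bit_length k) + i) = bit_length k - Suc i"
      using assms by linarith+
    then show ?thesis
      by (simp only: write_left_nth[OF assms] if_P[OF cond] if_P[OF True] bin_nth[OF True] if_True simp_thms)
  next
    case False
    then have cond: "\<not> (h < Suc (h - bit_length k) + i + bit_length k \<and> Suc (h - bit_length k) + i \<le> h)"
      using assms by linarith
    show ?thesis
      unfolding write_left_nth[OF assms] if_not_P[OF cond] if_not_P[OF False]
      by (simp add: blank_tape_def)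
  qed
qed

lemma scanned_0: "scanned L n t a b 0 = scanner_start"
  by (simp add: scanned_def scanner_start_def register_of_def)

text \<open>The machine stops scanning exactly when \<open>p\<close> has passed the lengths of all
  four numbers, and from then on \<open>scan_result\<close> gives the right answer. \<open>P\<close>
  bounds these lengths and thus the time.\<close>

lemma scan_tapes:
  assumes L: "L = bit_length n" and pos: "pos \<le> Suc (length x)"
    and f0: "f0 0 = 1" "\<And>i. i < L \<Longrightarrow> f0 (L - i) = bit_symbol (bit n i)"
    and holds: "tape_holds f1 h1 t" "tape_holds f2 h2 a" "tape_holds f3 h3 b"
    and bounds: "L \<le> P" "bit_length t \<le> P" "bit_length a \<le> P" "bit_length b \<le> P"
    and p: "p \<le> P"
  shows "ends x (conf (Scanning four (scanned L n t a b p)) pos 0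
      [(L - p, f0), (h1 + p, f1), (h2 + p, f2), (h3 + p, f3)] [])
    ((if four then [n, t, a, b] else [n, t, a]) \<in> direct_connections parity_circuit) (Suc (P - p))"
  using p
proof (induction "P - p" arbitrary: p rule: less_induct)
  case less
  let ?c = "conf (Scanning four (scanned L n t a b p)) pos 0
    [(L - p, f0), (h1 + p, f1), (h2 + p, f2), (h3 + p, f3)] []"
  let ?v = "(if four then [n, t, a, b] else [n, t, a]) \<in> direct_connections parity_circuit"
  \<comment> \<open>From \<open>p = L\<close> on, \<open>L - p\<close> is 0 and the head rests on
    the marker, which signals the end of the index.\<close>
  have r0: "f0 (L - p) = (if p < L then bit_symbol (bit n p) else 1)"
    using f0 by (cases "p < L") auto
  have r: "f1 (h1 + p) = (if p < bit_length t then bit_symbol (bit t p) else 0)"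
    "f2 (h2 + p) = (if p < bit_length a then bit_symbol (bit a p) else 0)"
    "f3 (h3 + p) = (if p < bit_length b then bit_symbol (bit b p) else 0)"
    using holds unfolding tape_holds_def by blast+
  have sym: "bit_symbol c \<noteq> 0" "bit_symbol c \<noteq> 1" "bit_symbol c = 3 \<longleftrightarrow> c" for c
    by (simp_all add: bit_symbol_def)
  show ?case
  proof (cases "L \<le> p \<and> bit_length t \<le> p \<and> bit_length a \<le> p \<and> bit_length b \<le> p")
    case True
    then have "scan_result four (scanned L n t a b p) \<longleftrightarrow> ?v"
      by (intro scan_result_correct[OF L refl] not_bit_bit_length) auto
    moreover have "step checker_tm x [] ?c = conf (if scan_result four (scanned L n t a b p)
        then Accepted else Rejected) pos 0
        [(L - p, f0), (h1 + p, f1), (h2 + p, f2), (h3 + p, f3)] []"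
      using True r0 r pos by (simp add: step_checker keep_def fun_upd_idem)
    ultimately have "ends x ?c ?v (Suc 0)"
      by - (rule ends_step, simp only: ends_now)
    then show ?thesis by (rule ends_mono) simp
  next
    case False
    then have "p < P" using bounds less.prems by linarith
    have bits: "f1 (h1 + p) = 3 \<longleftrightarrow> bit t p" "f2 (h2 + p) = 3 \<longleftrightarrow> bit a p" "f3 (h3 + p) = 3 \<longleftrightarrow> bit b p"
      using r sym not_bit_bit_length[of _ p] by (auto simp: not_less)
    have "step checker_tm x [] ?c = conf (Scanning four (scanned L n t a b (Suc p))) pos 0
        [(L - Suc p, f0), (h1 + Suc p, f1), (h2 + Suc p, f2), (h3 + Suc p, f3)] []"
    proof (cases "p < L")
      case True
      then have w0: "f0 (L - p) = bit_symbol (bit n p)" using f0(2) by simp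
      have "scan_step (Some (bit n p)) (bit t p) (bit a p) (bit b p) (scanned L n t a b p) =
          scanned L n t a b (Suc p)"
        using scan_step_scanned[of p L n t a b] True by simp
      then show ?thesis
        using pos by (simp add: step_checker bits w0 sym[simplified] fun_upd_idem)
    next
      case ends: False
      then have "f1 (h1 + p) \<noteq> 0 \<or> f2 (h2 + p) \<noteq> 0 \<or> f3 (h3 + p) \<noteq> 0"
        using False r sym by (auto simp: not_le)
      moreover have "scan_step None (bit t p) (bit a p) (bit b p) (scanned L n t a b p) =
          scanned L n t a b (Suc p)"
        using scan_step_scanned[of p L n t a b] ends by simp
      ultimately show ?thesis
        using pos ends f0(1) by (auto simp: step_checker bits fun_upd_idem)
    qed
    moreover have "ends x (conf (Scanning four (scanned L n t a b (Suc p))) pos 0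
        [(L - Suc p, f0), (h1 + Suc p, f1), (h2 + Suc p, f2), (h3 + Suc p, f3)] []) ?v (Suc (P - Suc p))"
      using \<open>p < P\<close> by (intro less.hyps) auto
    ultimately have "ends x ?c ?v (Suc (Suc (P - Suc p)))"
      by - (rule ends_step, simp only:)
    then show ?thesis by (rule ends_mono) (use \<open>p < P\<close> in simp)
  qed
qed

lemma checker_margins:
  assumes "ends x (conf Read_Index (Suc 0) 0
    [(1, blank_tape), (3, blank_tape), (3, blank_tape), (3, blank_tape)] []) v T"
  shows "ends x (initial checker_tm) v (T + 3)"
proof -
  have upd: "blank_tape(Suc 0 := 0) = blank_tape" "blank_tape(2 := 0) = blank_tape"
    "blank_tape (Suc 0) = 0" "blank_tape 2 = 0"
    by (auto simp: blank_tape_def)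
  have "initial checker_tm = conf Margin1 0 0 (replicate 4 (0, \<lambda>_. 0)) []"
    unfolding checker_tm_def by (rule initial_tm_of)
  also have "replicate 4 (0, \<lambda>_. 0) = [(0, \<lambda>_. 0), (0, \<lambda>_. 0), (0, \<lambda>_. 0), (0, \<lambda>_. 0 :: nat)]"
    by (simp add: numeral_eq_Suc)
  finally have start: "initial checker_tm = conf Margin1 0 0
    [(0, \<lambda>_. 0), (0, \<lambda>_. 0), (0, \<lambda>_. 0), (0, \<lambda>_. 0)] []" by simp
  have 1: "step checker_tm x [] (initial checker_tm) = conf Margin2 0 0
      [(Suc 0, blank_tape), (Suc 0, blank_tape), (Suc 0, blank_tape), (Suc 0, blank_tape)] []"
    unfolding start by (simp add: step_checker blank_tape_def)
  have 2: "step checker_tm x [] (conf Margin2 0 0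
      [(Suc 0, blank_tape), (Suc 0, blank_tape), (Suc 0, blank_tape), (Suc 0, blank_tape)] []) =
      conf Margin3 0 0 [(Suc 0, blank_tape), (2, blank_tape), (2, blank_tape), (2, blank_tape)] []"
    by (simp add: step_checker keep_def upd numeral_eq_Suc)
  have 3: "step checker_tm x [] (conf Margin3 0 0
      [(Suc 0, blank_tape), (2, blank_tape), (2, blank_tape), (2, blank_tape)] []) =
      conf Read_Index (Suc 0) 0 [(1, blank_tape), (3, blank_tape), (3, blank_tape), (3, blank_tape)] []"
    by (simp add: step_checker keep_def upd numeral_eq_Suc)
  have "ends x (initial checker_tm) v (Suc (Suc (Suc T)))"
    using assms by - (rule ends_step, simp only: 1, rule ends_step, simp only: 2, rule ends_step, simp only: 3)
  then show ?thesis by (rule ends_mono) simp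
qed

lemma encode_nats_Cons: "encode_nats (k # ks) = map Some (bin k) @ None # encode_nats ks"
  by (simp add: encode_nats_def)

lemma encode_nats_Nil: "encode_nats ks = [] \<longleftrightarrow> ks = []"
  by (cases ks) (simp_all add: encode_nats_def)

text \<open>The three outcomes of reading a number: it is missing, too long, or fits. In the first
  two the machine rejects, so the verdict has to be negative there; the third passes the time on to
  the continuation.\<close>

lemma read_next:
  assumes p: "drop p x = encode_nats ks" and ws: "length ws = 4" "ws ! tape_index j = (h, blank_tape)"
    and reject: "\<And>k ks'. ks = k # ks' \<Longrightarrow> h < bit_length k \<Longrightarrow> \<not> v" "ks = [] \<Longrightarrow> \<not> v"
    and continue: "\<And>k ks' p' f h'. ks = k # ks' \<Longrightarrow> bit_length k \<le> h \<Longrightarrow> drop p' x = encode_nats ks' \<Longrightarrow>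
      p' \<le> length x \<Longrightarrow> tape_holds f h' k \<Longrightarrow>
      ends x (conf (after_tape j) (Suc p') 0 (ws[tape_index j := (h', f)]) []) v T"
  shows "ends x (conf (Read j) (Suc p) 0 ws []) v (T + h + 1)"
proof (cases ks)
  case Nil
  then have "ends x (conf (Read j) (Suc p) 0 ws []) v 1"
    using read_rejects[of p x j ws] p reject(2) by (simp add: encode_nats_def)
  then show ?thesis by (rule ends_mono) simp
next
  case (Cons k ks')
  then have d: "drop p x = map Some (bin k) @ None # encode_nats ks'"
    using p by (simp add: encode_nats_Cons)
  show ?thesis
  proof (cases "bit_length k \<le> h")
    case True
    note dn = drop_number[OF d]
    have "ends x (conf (Read j) (Suc p) 0 ws []) v (T + bit_length k + 1)"
    proof (rule read_number[OF d ws])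
      show "ends x (conf (after_tape j) (Suc (p + bit_length k + 1)) 0
          (ws[tape_index j := (Suc (h - bit_length k), write_left blank_tape h (bin k))]) []) v T"
        by (rule continue[OF Cons True dn write_left_holds[OF True]])
    qed (use True in \<open>simp_all add: blank_tape_def\<close>)
    then show ?thesis by (rule ends_mono) (use True in simp)
  next
    case False
    then have "ends x (conf (Read j) (Suc p) 0 ws []) False (Suc h)"
      by (intro read_number_overflow[OF d ws]) (simp_all add: blank_tape_def)
    moreover have "\<not> v" using reject(1)[OF Cons] False by simp
    ultimately have "ends x (conf (Read j) (Suc p) 0 ws []) v (Suc h)" by simp
    then show ?thesis by (rule ends_mono) simp
  qed
qed

lemma list_update_tapes: "[a, b, c, d][2 := e] = [a, b, e, d]" "[a, b, c, d][3 := e] = [a, b, c, e]"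
  by (simp_all add: numeral_2_eq_2 numeral_3_eq_3)

lemma checker_decides:
  fixes n :: nat and q :: "nat list"
  defines "x \<equiv> encode_nats (n # q)" and "v \<equiv> n # q \<in> direct_connections parity_circuit"
  shows "ends x (initial checker_tm) v (5 * bit_length n + 22)"
proof -
  define L where "L = bit_length n"
  define K where "K = L + 3"
  define f0 where "f0 = write_right blank_tape 1 (bin n)"
  note bounded = connections_bounded[OF L_def refl]
  have f0: "f0 (L - i) = bit_symbol (bit n i)" if "i < L" for i
  proof -
    have "1 \<le> L - i \<and> L - i < 1 + bit_length n" "L - i - 1 = bit_length n - Suc i"
      using that by (auto simp: L_def)
    then show ?thesis
      unfolding f0_def write_right_nth using that bin_nth[of i n] by (simp add: L_def)
  qed
  have f00: "f0 0 = 1" by (simp add: f0_def write_right_nth blank_tape_def)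
  \<comment> \<open>The run is assembled from its end: the scan, the check that the input is
    exhausted, and then the reading phases in reverse order.\<close>
  have scan: "ends x (conf (Scanning four scanner_start) (Suc p) 0
      [(L, f0), (h1, f1), (h2, f2), (h3, f3)] []) v (K + 1)"
    if "tape_holds f1 h1 t" "tape_holds f2 h2 a" "tape_holds f3 h3 b" "p \<le> length x"
      "bit_length t \<le> K" "bit_length a \<le> K" "bit_length b \<le> K"
      "q = (if four then [t, a, b] else [t, a])"
    for four p h1 h2 h3 f1 f2 f3 t a b
  proof -
    have "L \<le> K" by (simp add: K_def)
    have "v = ((if four then [n, t, a, b] else [n, t, a]) \<in> direct_connections parity_circuit)"
      unfolding v_def that(8) by simp
    then show ?thesis
      using scan_tapes[OF L_def _ f00 f0 that(1-3) \<open>L \<le> K\<close> that(5-7), of "Suc p" x 0 four] that(4)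
      by (simp add: scanned_0)
  qed
  have len: "length q = 2 \<or> length q = 3" if v using bounded(1) that unfolding v_def by blast
  have short: "bit_length k \<le> K" if v "k \<in> set q" for k
    using bounded(2) that unfolding v_def K_def L_def by blast
  have hK: "0 < K" by (simp add: K_def)
  have read_end: "ends x (conf Read_End (Suc p) 0 [(L, f0), (h1, f1), (h2, f2), (h3, f3)] []) v (K + 2)"
    if "drop p x = encode_nats ks" "p \<le> length x" "q = t # a # b # ks"
      "tape_holds f1 h1 t" "tape_holds f2 h2 a" "tape_holds f3 h3 b"
      "bit_length t \<le> K" "bit_length a \<le> K" "bit_length b \<le> K"
    for p ks t a b h1 h2 h3 f1 f2 f3
  proof (cases ks)
    case Nil
    then have "step checker_tm x [] (conf Read_End (Suc p) 0 [(L, f0), (h1, f1), (h2, f2), (h3, f3)] []) =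
        conf (Scanning True scanner_start) (Suc p) 0 [(L, f0), (h1, f1), (h2, f2), (h3, f3)] []"
      using that(1,2) by (simp add: step_checker input_symbol_drop(1) encode_nats_def keep_def)
    then show ?thesis
      using ends_step[of x "conf Read_End (Suc p) 0 [(L, f0), (h1, f1), (h2, f2), (h3, f3)] []" v "K + 1"]
        scan[OF that(4-6,2,7-9), of True] that(3) Nil by simp
  next
    case (Cons k ks')
    then have "drop p x \<noteq> []" using that(1) encode_nats_Nil[of ks] by simp
    then obtain z zs where z: "drop p x = z # zs" by (cases "drop p x") auto
    have "step checker_tm x [] (conf Read_End (Suc p) 0 [(L, f0), (h1, f1), (h2, f2), (h3, f3)] []) =
        conf Rejected (Suc p) 0 [(L, f0), (h1, f1), (h2, f2), (h3, f3)] []"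
      using that(2) by (simp add: step_checker input_symbol_drop(2)[OF z] keep_def)
    then have "ends x (conf Read_End (Suc p) 0 [(L, f0), (h1, f1), (h2, f2), (h3, f3)] []) False (Suc 0)"
      by - (rule ends_step, simp add: ends_rejected)
    moreover have "\<not> v" using len that(3) Cons by auto
    ultimately have "ends x (conf Read_End (Suc p) 0 [(L, f0), (h1, f1), (h2, f2), (h3, f3)] []) v (Suc 0)"
      by simp
    then show ?thesis by (rule ends_mono) simp
  qed
  have probe: "ends x (conf Probe (Suc p) 0 [(L, f0), (h1, f1), (h2, f2), (K, blank_tape)] []) v (2 * K + 4)"
    if "drop p x = encode_nats ks" "p \<le> length x" "q = t # a # ks"
      "tape_holds f1 h1 t" "tape_holds f2 h2 a" "bit_length t \<le> K" "bit_length a \<le> K"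
    for p ks t a h1 h2 f1 f2
  proof (cases ks)
    case Nil
    then have "step checker_tm x [] (conf Probe (Suc p) 0 [(L, f0), (h1, f1), (h2, f2), (K, blank_tape)] []) =
        conf (Scanning False scanner_start) (Suc p) 0 [(L, f0), (h1, f1), (h2, f2), (K, blank_tape)] []"
      using that(1,2) by (simp add: step_checker input_symbol_drop(1) encode_nats_def keep_def)
    then have "ends x (conf Probe (Suc p) 0 [(L, f0), (h1, f1), (h2, f2), (K, blank_tape)] []) v (Suc (K + 1))"
      using scan[OF that(4,5) blank_tape_holds_0[OF hK] that(2,6,7), of False] that(3) Nil
      by - (rule ends_step, simp)
    then show ?thesis by (rule ends_mono) simp
  next
    case (Cons k ks')
    then have "drop p x \<noteq> []" using that(1) encode_nats_Nil[of ks] by simp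
    then obtain z zs where z: "drop p x = z # zs" by (cases "drop p x") auto
    have "step checker_tm x [] (conf Probe (Suc p) 0 [(L, f0), (h1, f1), (h2, f2), (K, blank_tape)] []) =
        conf (Read Second) (Suc p) 0 [(L, f0), (h1, f1), (h2, f2), (K, blank_tape)] []"
      using that(2) by (simp add: step_checker input_symbol_drop(2)[OF z] keep_def)
    moreover have "ends x (conf (Read Second) (Suc p) 0 [(L, f0), (h1, f1), (h2, f2), (K, blank_tape)] []) v
        (K + 2 + K + 1)"
    proof (rule read_next[OF that(1)])
      fix k ks' p' f h'
      assume *: "ks = k # ks'" "bit_length k \<le> K" "drop p' x = encode_nats ks'" "p' \<le> length x"
        "tape_holds f h' k"
      show "ends x (conf (after_tape Second) (Suc p') 0
          ([(L, f0), (h1, f1), (h2, f2), (K, blank_tape)][tape_index Second := (h', f)]) []) v (K + 2)"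
        using read_end[OF *(3,4) _ that(4,5) *(5) that(6,7) *(2)] that(3) *(1)
        by (simp add: list_update_tapes)
    next
      show "\<not> v" if "ks = k # ks'" "K < bit_length k" for k ks'
        using short[of k] that \<open>q = t # a # ks\<close> by auto
    qed (use Cons in simp_all)
    ultimately have "ends x (conf Probe (Suc p) 0 [(L, f0), (h1, f1), (h2, f2), (K, blank_tape)] []) v
        (Suc (K + 2 + K + 1))"
      by - (rule ends_step, simp)
    then show ?thesis by (rule ends_mono) simp
  qed
  have first: "ends x (conf (Read First) (Suc p) 0 [(L, f0), (h1, f1), (K, blank_tape), (K, blank_tape)] []) v
      (2 * K + 4 + K + 1)"
    if "drop p x = encode_nats ks" "p \<le> length x" "q = t # ks" "tape_holds f1 h1 t" "bit_length t \<le> K"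
    for p ks t h1 f1
  proof (rule read_next[OF that(1)])
    fix k ks' p' f h'
    assume *: "ks = k # ks'" "bit_length k \<le> K" "drop p' x = encode_nats ks'" "p' \<le> length x"
      "tape_holds f h' k"
    show "ends x (conf (after_tape First) (Suc p') 0
        ([(L, f0), (h1, f1), (K, blank_tape), (K, blank_tape)][tape_index First := (h', f)]) []) v (2 * K + 4)"
      using probe[OF *(3,4) _ that(4) *(5) that(5) *(2)] that(3) *(1) by (simp add: list_update_tapes)
  next
    show "\<not> v" if "ks = k # ks'" "K < bit_length k" for k ks'
      using short[of k] that \<open>q = t # ks\<close> by auto
    show "\<not> v" if "ks = []" using len that \<open>q = t # ks\<close> by auto
  qed simp_all
  have d: "drop 0 x = map Some (bin n) @ None # encode_nats q"
    by (simp add: x_def encode_nats_Cons)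
  note dn = drop_number[OF d]
  have "ends x (conf (Read Question) (Suc (0 + bit_length n + 1)) 0
      [(L, f0), (K, blank_tape), (K, blank_tape), (K, blank_tape)] []) v (2 * K + 4 + K + 1 + K + 1)"
  proof (rule read_next[OF dn(1)])
    fix k ks' p' f h'
    assume *: "q = k # ks'" "bit_length k \<le> K" "drop p' x = encode_nats ks'" "p' \<le> length x"
      "tape_holds f h' k"
    show "ends x (conf (after_tape Question) (Suc p') 0
        ([(L, f0), (K, blank_tape), (K, blank_tape), (K, blank_tape)][tape_index Question := (h', f)]) []) v
        (2 * K + 4 + K + 1)"
      using first[OF *(3,4,1,5,2)] by simp
  next
    show "\<not> v" if "q = k # ks'" "K < bit_length k" for k ks'
      using short[of k] that by auto
    show "\<not> v" if "q = []" using len that by auto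
  qed simp_all
  then have "ends x (conf Read_Index (Suc 0) 0
      [(1, blank_tape), (3, blank_tape), (3, blank_tape), (3, blank_tape)] []) v
      (2 * K + 4 + K + 1 + K + 1 + bit_length n + 1)"
    by (intro read_index[OF d]) (simp add: L_def K_def f0_def add.commute)
  then have "ends x (initial checker_tm) v (2 * K + 4 + K + 1 + K + 1 + bit_length n + 1 + 3)"
    by (rule checker_margins)
  \<comment> \<open>The steps add up to \<open>4 * K + L + 10\<close>, where
    \<open>K = L + 3\<close> is the room for a number: \<open>L\<close> cells and the three margin
    cells.\<close>
  then show ?thesis by (rule ends_mono) (simp add: K_def L_def)
qed

lemma parity_circuit_uniform: "dlogtime_uniform parity_circuit"
  unfolding dlogtime_uniform_def
proof (intro exI conjI allI)
  show "wf_tm checker_tm" by (rule wf_checker_tm)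
  show "log_bounded (\<lambda>n. 5 * bit_length n + 22)"
    by (rule log_bounded_bit_length) (rule order_refl)
  fix n q
  let ?v = "n # q \<in> direct_connections parity_circuit"
  have sel: "accept checker_tm = to_nat Accepted" "reject checker_tm = to_nat Rejected"
    by (simp_all add: checker_tm_def)
  obtain t where t: "t \<le> 5 * bit_length n + 22"
    "state (run checker_tm (encode_nats (n # q)) [] t) = to_nat (if ?v then Accepted else Rejected)"
    using checker_decides[of n q] unfolding ends_def run_def by blast
  \<comment> \<open>\<open>decides_in_time\<close> looks at one fixed step count, and a halted run
    stays as it is until then.\<close>
  then have "run checker_tm (encode_nats (n # q)) [] (5 * bit_length n + 22) =
      run checker_tm (encode_nats (n # q)) [] t"
    by (intro run_halted) (auto simp: sel)
  then show "decides_in_time checker_tm (encode_nats (n # q)) [] ?v (5 * bit_length n + 22)"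
    unfolding decides_in_time_def using t(2) by (simp add: sel)
qed

section \<open>The separating problem in the four classes\<close>

lemma parity_problem_NC1O: "parity_problem \<in> NC1O_NLO"
proof -
  have "exactly_solvable NC1 parity_problem"
    unfolding exactly_solvable_def
  proof (intro conjI bexI ballI impI)
    show "(\<lambda>_. empty_circuit) \<in> NC1" by (rule empty_circuit_NC1)
    show "parity_circuit \<in> NC1" by (rule parity_circuit_NC1[OF parity_circuit_uniform])
    show "if SOL parity_problem x = {} then outputs_string (\<lambda>_. empty_circuit) x None
        else \<exists>y\<in>optimal_solutions parity_problem x. outputs_string (\<lambda>_. empty_circuit) x (Some y)" for x
      using empty_circuit_outputs
      by (simp add: optimal_solutions_def optimum_parity) (simp add: parity_problem_def)
    show "outputs_number parity_circuit x (optimum parity_problem x)" for x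
      unfolding optimum_parity by (rule parity_circuit_output)
  qed
  then show ?thesis unfolding NC1O_NLO_def using parity_problem_NLO by blast
qed

lemma parity_problem_not_AC0O: "parity_problem \<notin> AC0O_NLO"
proof
  assume "parity_problem \<in> AC0O_NLO"
  then obtain D where "D \<in> AC0" "\<And>x. outputs_number D x (optimum parity_problem x)"
    unfolding AC0O_NLO_def exactly_solvable_def by (auto simp: parity_problem_def)
  then show False using parity_not_AC0 unfolding optimum_parity by blast
qed

text \<open>The empty string is the only solution, so whatever the ratio, an approximating family
  must output it, and the family for the measure then computes parity on every input.\<close>

lemma parity_problem_not_APXAC0: "parity_problem \<notin> APXAC0_NLO"
proof
  assume "parity_problem \<in> APXAC0_NLO"
  then obtain \<gamma> C D where C: "approximates C parity_problem \<gamma>" and D: "D \<in> AC0"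
    "\<forall>x\<in>instances parity_problem. \<forall>y\<in>SOL parity_problem x.
      outputs_string C x (Some y) \<longrightarrow> outputs_number D x (measr parity_problem x y)"
    unfolding APXAC0_NLO_def by blast
  have "outputs_string C x (Some [])" for x
    using C unfolding approximates_def by (auto simp: parity_problem_def)
  then have "outputs_number D x (1 + of_bool (parity x))" for x
    using D(2) by (simp add: parity_problem_def)
  then show False using parity_not_AC0[OF D(1)] by blast
qed

text \<open>In each inequality the problem lies in one of the two classes, \<open>AC0AS_NLO\<close>
  or \<open>NC1O_NLO\<close>, and outside the other one, \<open>AC0O_NLO\<close> or
  \<open>APXAC0_NLO\<close>.\<close>

theorem theorem6p6:
  shows "AC0O_NLO \<noteq> AC0AS_NLO \<and> AC0AS_NLO \<noteq> APXAC0_NLO \<and> APXAC0_NLO \<noteq> NC1O_NLO"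
  using parity_problem_AC0AS parity_problem_NC1O parity_problem_not_AC0O parity_problem_not_APXAC0
  by blast

end
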